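(* Let $q$ be a prime power. Then $$|\mathrm{SE}_6(q)| = q^{36}(q^{12}-1)(q^9-1)(q^8-1)(q^6-1)(q^5-1)(q^2-1)$$ and $$|\mathrm{E}_6(q)| = \frac{1}{\gcd(3,q-1)}\, q^{36}(q^{12}-1)(q^9-1)(q^8-1)(q^6-1)(q^5-1)(q^2-1).$$
   Context: An octonion algebra $\mathbb{O}$ over a field $F$ is an $8$-dimensional unital (not necessarily associative) $F$-algebra with a quadratic form $N:\mathbb{O}\to F$ whose polar form $\langle x,y\rangle=N(x+y)-N(x)-N(y)$ is non-degenerate and such that $N(xy)=N(x)N(y)$. It is split if there is a non-zero $x$ with $N(x)=0$; over a finite field $\mathbb{F}_q$ the (unique) octonion algebra is split. Put $T(x)=\langle x,1\rangle$. The Albert space $\mathbb{J}$ over $F$ is the $27$-dimensional $F$-space of tuples $(a,b,c\mid A,B,C)$ with $a,b,c\in F$, $A,B,C\in\mathbb{O}$. The Dickson–Freudenthal determinant is $\Delta(a,b,c\mid A,B,C)=abc-aN(A)-bN(B)-cN(C)+T((AB)C)$. $\mathrm{SE}_6(F)$ is the group of all $F$-linear maps $\mathbb{J}\to\mathbb{J}$ preserving $\Delta$, and $\mathrm{E}_6(F)$ is the quotient of $\mathrm{SE}_6(F)$ by its centre. For $F=\mathbb{F}_q$ these groups are denoted $\mathrm{SE}_6(q)$ and $\mathrm{E}_6(q)$. *)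

theory Defs
  imports
    "HOL-Algebra.Coset"
    "HOL-Library.Product_Plus"
    "HOL-Number_Theory.Prime_Powers"
begin

definition polar :: "('o::plus \<Rightarrow> 'f::minus) \<Rightarrow> 'o \<Rightarrow> 'o \<Rightarrow> 'f" where
  "polar Q x y = Q (x + y) - Q x - Q y"

text \<open>
  The whole type \<open>'o\<close> is the underlying space of the algebra. \<^const>\<open>vector_space.dim\<close> is \<open>0\<close>
  on spaces without a finite basis, so \<open>dim_eq_8\<close> includes finite-dimensionality.
  The assumptions \<open>norm_scale\<close>, \<open>polar_left\<close> and \<open>polar_right\<close> say that \<open>N\<close> is a quadratic form;
  no division by 2 is involved, so characteristic 2 is covered.
\<close>

locale octonion_algebra = vector_space scale
  for scale :: "'f::field \<Rightarrow> 'o::ab_group_add \<Rightarrow> 'o" (infixr \<open>*s\<close> 75) +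
  fixes mult :: "'o \<Rightarrow> 'o \<Rightarrow> 'o" (infixl \<open>\<odot>\<close> 70)
    and unit :: 'o (\<open>\<e>\<close>)
    and N :: "'o \<Rightarrow> 'f"
  assumes dim_eq_8: "dim (UNIV :: 'o set) = 8"
    and mult_left: "\<And>y. Vector_Spaces.linear scale scale (\<lambda>x. x \<odot> y)"
    and mult_right: "\<And>x. Vector_Spaces.linear scale scale (\<lambda>y. x \<odot> y)"
    and unit_left: "\<And>x. \<e> \<odot> x = x"
    and unit_right: "\<And>x. x \<odot> \<e> = x"
    and norm_scale: "\<And>r x. N (r *s x) = r\<^sup>2 * N x"
    and polar_left: "\<And>y. Vector_Spaces.linear scale (*) (\<lambda>x. polar N x y)"
    and polar_right: "\<And>x. Vector_Spaces.linear scale (*) (\<lambda>y. polar N x y)"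
    and polar_nondegenerate: "\<And>x. (\<And>y. polar N x y = 0) \<Longrightarrow> x = 0"
    and norm_mult: "\<And>x y. N (x \<odot> y) = N x * N y"

type_synonym ('f, 'o) albert = "'f \<times> 'f \<times> 'f \<times> 'o \<times> 'o \<times> 'o"

definition centre :: "('a, 'b) monoid_scheme \<Rightarrow> 'a set" where
  "centre G = {z \<in> carrier G. \<forall>g \<in> carrier G. z \<otimes>\<^bsub>G\<^esub> g = g \<otimes>\<^bsub>G\<^esub> z}"

lemma (in group) centre_normal: "centre G \<lhd> G"
proof -
  have carr: "z \<in> carrier G" if "z \<in> centre G" for z
    using that unfolding centre_def by blast
  have comm: "z \<otimes> g = g \<otimes> z" if "z \<in> centre G" "g \<in> carrier G" for z g
    using that unfolding centre_def by blast
  have centreI: "z \<in> centre G" if "z \<in> carrier G" "\<And>g. g \<in> carrier G \<Longrightarrow> z \<otimes> g = g \<otimes> z" for z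
    using that unfolding centre_def by blast
  have "subgroup (centre G) G"
  proof (rule subgroupI)
    show "centre G \<subseteq> carrier G" using carr by blast
    show "centre G \<noteq> {}" using centreI[of \<one>] by auto
  next
    fix z assume z: "z \<in> centre G"
    show "inv z \<in> centre G"
    proof (rule centreI)
      fix g assume g: "g \<in> carrier G"
      have "inv (inv g \<otimes> z) = inv (z \<otimes> inv g)"
        using comm[OF z, of "inv g"] g by simp
      then show "inv z \<otimes> g = g \<otimes> inv z"
        using carr[OF z] g by (simp add: inv_mult_group)
    qed (simp add: carr z)
  next
    fix y z assume y: "y \<in> centre G" and z: "z \<in> centre G"
    show "y \<otimes> z \<in> centre G"
    proof (rule centreI)
      fix g assume g: "g \<in> carrier G"
      show "y \<otimes> z \<otimes> g = g \<otimes> (y \<otimes> z)"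
        using carr[OF y] carr[OF z] g comm[OF y g] comm[OF z g] by (metis m_assoc)
    qed (simp add: carr y z)
  qed
  moreover have "x \<otimes> h \<otimes> inv x \<in> centre G" if x: "x \<in> carrier G" and h: "h \<in> centre G" for x h
  proof -
    have "x \<otimes> h \<otimes> inv x = h \<otimes> x \<otimes> inv x"
      by (simp only: comm[OF h x])
    then show ?thesis using h x carr[OF h] by (simp add: m_assoc)
  qed
  ultimately show ?thesis unfolding normal_inv_iff by blast
qed

context octonion_algebra
begin

definition T :: "'o \<Rightarrow> 'f" where
  "T x = polar N x \<e>"

definition albert_scale :: "'f \<Rightarrow> ('f, 'o) albert \<Rightarrow> ('f, 'o) albert" where
  "albert_scale r = (\<lambda>(a, b, c, A, B, C). (r * a, r * b, r * c, r *s A, r *s B, r *s C))"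

definition \<Delta> :: "('f, 'o) albert \<Rightarrow> 'f" where
  "\<Delta> = (\<lambda>(a, b, c, A, B, C).
     a * b * c - a * N A - b * N B - c * N C + T ((A \<odot> B) \<odot> C))"

definition SE6 :: "(('f, 'o) albert \<Rightarrow> ('f, 'o) albert) monoid" where
  "SE6 = \<lparr>carrier = {g. Vector_Spaces.linear albert_scale albert_scale g \<and> (\<forall>x. \<Delta> (g x) = \<Delta> x)},
          monoid.mult = (\<circ>), one = id\<rparr>"

definition E6 :: "(('f, 'o) albert \<Rightarrow> ('f, 'o) albert) set monoid" where
  "E6 = SE6 Mod centre SE6"

lemma N_zero: "N 0 = 0"
  using norm_scale[of 0 0] by simp

lemma T_zero: "T 0 = 0"
  using N_zero by (simp add: T_def polar_def)

lemma mult_zero: "0 \<odot> x = 0" "x \<odot> 0 = 0"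
proof -
  interpret l: Vector_Spaces.linear scale scale "\<lambda>y. y \<odot> x" by (rule mult_left)
  interpret r: Vector_Spaces.linear scale scale "\<lambda>y. x \<odot> y" by (rule mult_right)
  show "0 \<odot> x = 0" "x \<odot> 0 = 0" using l.zero r.zero by simp_all
qed

lemma \<Delta>_radical:
  assumes "\<And>x. \<Delta> (x + k) = \<Delta> x"
  shows "k = 0"
proof -
  obtain a b c A B C where k: "k = (a, b, c, A, B, C)"
    by (cases k) auto
  have D: "\<Delta> ((x, y, z, X, Y, Z) + k) = \<Delta> (x, y, z, X, Y, Z)" for x y z X Y Z
    by (rule assms)
  note s = k \<Delta>_def plus_prod_def N_zero T_zero mult_zero
  have 0: "a * b * c - a * N A - b * N B - c * N C + T ((A \<odot> B) \<odot> C) = 0"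
    using D[of 0 0 0 0 0 0] by (simp add: s)
  have 1: "b * c = N A"
    using D[of 1 0 0 0 0 0] 0 by (simp add: s) algebra
  have 2: "a * c = N B"
    using D[of 0 1 0 0 0 0] 0 by (simp add: s) algebra
  have 3: "a * b = N C"
    using D[of 0 0 1 0 0 0] 0 by (simp add: s) algebra
  have c: "c = 0"
    using D[of 1 1 0 0 0 0] 0 1 2 by (simp add: s) algebra
  have b: "b = 0"
    using D[of 1 0 1 0 0 0] 0 1 3 by (simp add: s) algebra
  have a: "a = 0"
    using D[of 0 1 1 0 0 0] 0 2 3 by (simp add: s) algebra
  have N: "N A = 0" "N B = 0" "N C = 0"
    using 1 2 3 a b by auto
  have "polar N A X = 0" for X
    using D[of 0 0 0 X 0 0] D[of 1 0 0 X 0 0] N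
    by (simp add: s a b c polar_def add.commute)
  moreover have "polar N B X = 0" for X
    using D[of 0 0 0 0 X 0] D[of 0 1 0 0 X 0] N
    by (simp add: s a b c polar_def add.commute)
  moreover have "polar N C X = 0" for X
    using D[of 0 0 0 0 0 X] D[of 0 0 1 0 0 X] N
    by (simp add: s a b c polar_def add.commute)
  ultimately show ?thesis
    using polar_nondegenerate k a b c by (simp add: zero_prod_def)
qed

lemma vector_space_albert: "vector_space albert_scale"
  by unfold_locales (auto simp: albert_scale_def algebra_simps)

lemma finite_dimensional_albert: "\<exists>B. finite_dimensional_vector_space albert_scale B"
proof -
  interpret J: vector_space albert_scale by (rule vector_space_albert)
  interpret F: vector_space "(*) :: 'f \<Rightarrow> 'f \<Rightarrow> 'f" by unfold_locales (auto simp: algebra_simps)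
  obtain B :: "'o set" where "independent B" and span: "UNIV \<subseteq> span B" and "card B = 8"
    using basis_exists[of UNIV] dim_eq_8 by metis
  then have "finite B" using card.infinite by fastforce
  define S :: "('f, 'o) albert set" where "S = {(1,0,0,0,0,0), (0,1,0,0,0,0), (0,0,1,0,0,0)}
    \<union> (\<lambda>X. (0,0,0,X,0,0)) ` B \<union> (\<lambda>X. (0,0,0,0,X,0)) ` B \<union> (\<lambda>X. (0,0,0,0,0,X)) ` B"
  have fin: "finite S" using \<open>finite B\<close> by (simp add: S_def)
  have emb: "f x \<in> J.span S" if "Vector_Spaces.linear scale albert_scale f" "f ` B \<subseteq> S" for f x
  proof -
    interpret f: Vector_Spaces.linear scale albert_scale f by fact
    have "f x \<in> f ` span B" using span by auto
    also have "\<dots> = J.span (f ` B)" by (simp add: f.span_image)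
    also have "\<dots> \<subseteq> J.span S" using that by (intro J.span_mono)
    finally show ?thesis .
  qed
  have lin: "Vector_Spaces.linear scale albert_scale (\<lambda>X. (0,0,0,X,0,0))"
    "Vector_Spaces.linear scale albert_scale (\<lambda>X. (0,0,0,0,X,0))"
    "Vector_Spaces.linear scale albert_scale (\<lambda>X. (0,0,0,0,0,X))"
    by (unfold_locales; simp add: albert_scale_def)+
  have o: "(0,0,0,X,0,0) \<in> J.span S" "(0,0,0,0,X,0) \<in> J.span S" "(0,0,0,0,0,X) \<in> J.span S" for X
    by (rule emb[OF lin(1)] emb[OF lin(2)] emb[OF lin(3)]; force simp: S_def)+
  have f: "(a,0,0,0,0,0) \<in> J.span S" "(0,a,0,0,0,0) \<in> J.span S" "(0,0,a,0,0,0) \<in> J.span S" for a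
    using J.span_scale[OF J.span_base, of "(1,0,0,0,0,0)" S a]
      J.span_scale[OF J.span_base, of "(0,1,0,0,0,0)" S a]
      J.span_scale[OF J.span_base, of "(0,0,1,0,0,0)" S a]
    by (simp_all add: S_def albert_scale_def)
  have "(a,b,c,X,Y,Z) \<in> J.span S" for a b c X Y Z
    using J.span_add[OF J.span_add[OF J.span_add[OF f(1)[of a] f(2)[of b]] f(3)[of c]]
        J.span_add[OF J.span_add[OF o(1)[of X] o(2)[of Y]] o(3)[of Z]]] by simp
  then have U: "J.span S = UNIV" by auto
  obtain B' where "B' \<subseteq> S" "J.independent B'" "S \<subseteq> J.span B'"
    using J.maximal_independent_subset by metis
  moreover then have "J.span B' = UNIV"
    using U J.span_minimal[of S "J.span B'"] by auto
  ultimately have "finite_dimensional_vector_space albert_scale B'"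
    using fin by unfold_locales (auto intro: finite_subset)
  then show ?thesis by blast
qed

lemma group_SE6: "group SE6"
proof -
  interpret J: vector_space albert_scale by (rule vector_space_albert)
  obtain Bs where "finite_dimensional_vector_space albert_scale Bs"
    using finite_dimensional_albert by blast
  then interpret J: finite_dimensional_vector_space albert_scale Bs .
  interpret JJ: vector_space_pair albert_scale albert_scale ..
  show ?thesis
  proof (rule groupI)
    fix x y assume "x \<in> carrier SE6" "y \<in> carrier SE6"
    then show "x \<otimes>\<^bsub>SE6\<^esub> y \<in> carrier SE6"
      by (auto simp: SE6_def simp del: split_paired_All intro: Vector_Spaces.linear_compose)
  next
    show "\<one>\<^bsub>SE6\<^esub> \<in> carrier SE6"
      by (simp add: SE6_def J.linear_id)
  next
    fix g assume g: "g \<in> carrier SE6"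
    then interpret g: Vector_Spaces.linear albert_scale albert_scale g
      by (simp add: SE6_def)
    have inv: "\<Delta> (g x) = \<Delta> x" for x using g by (simp add: SE6_def del: split_paired_All)
    have "k = 0" if "g k = 0" for k
      using \<Delta>_radical[of k] inv g.add that by (metis add.right_neutral)
    then have "inj g" using g.inj_iff_eq_0 by blast
    moreover have lin: "Vector_Spaces.linear albert_scale albert_scale g" by unfold_locales
    ultimately have "surj g" using J.linear_inj_imp_surj by blast
    obtain h where h: "Vector_Spaces.linear albert_scale albert_scale h" "h \<circ> g = id"
      using JJ.linear_injective_left_inverse[OF lin] \<open>inj g\<close> by blast
    have "\<Delta> (h x) = \<Delta> x" for x
      using \<open>surj g\<close> inv h(2) by (metis comp_apply id_apply surj_def)
    with h show "\<exists>y\<in>carrier SE6. y \<otimes>\<^bsub>SE6\<^esub> g = \<one>\<^bsub>SE6\<^esub>"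
      by (auto simp: SE6_def simp del: split_paired_All)
  qed (auto simp: SE6_def)
qed

lemma group_E6: "group E6"
  unfolding E6_def
  by (intro normal.factorgroup_is_group group.centre_normal group_SE6)

end

end

theory Submission
  imports "HOL-Computational_Algebra.Polynomial" Defs
begin

text \<open>
  Write \<open>\<langle>x, y\<rangle>\<close> for the polar form of the norm. The order is computed by the orbit-stabiliser
  theorem, applied three times, down to a stabiliser that is counted by hand.

  A vector of the Albert space is called white if the quadratic adjoint
  \<open>x\<^sup>#\<close> vanishes on it; the diagonal vectors \<open>e1\<close>, \<open>e2\<close>, \<open>e3\<close> are white. The determinant is
  preserved by explicit transvections, one family for each ordered pair of distinct diagonal
  positions. They carry every non-zero vector to a diagonal one
  (\<open>reach_diagonal\<close>), and show that the group is transitive on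
  non-zero white vectors, that the stabiliser of \<open>e1\<close> is transitive on the white vectors outside the
  radical of the trilinear form at \<open>e1\<close>, and that the stabiliser of \<open>e1\<close> and \<open>e2\<close> is transitive on
  the white vectors \<open>z\<close> with \<open>D e1 e2 z = 1\<close>. The three orbits have
  \<open>(q^8 + q^4 + 1) (q^9 - 1)\<close>, \<open>q^8 (q^5 - 1) (q^4 + 1)\<close> and \<open>q^16\<close> elements.

  For the orbits to be no larger, whiteness must be an invariant of the determinant as a function.
  Over the field with two elements a function does not determine its quadratic and linear parts, so
  the adjoint is not visibly invariant. The fully polarised trilinear form \<open>D\<close> is, and
  \<open>white_iff_radical\<close> recognises the non-zero white vectors \<open>x\<close> as those for which the radical of \<open>D x\<close>
  has \<open>q^17\<close> elements; by diagonalisation this needs checking on diagonal vectors only.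

  The joint stabiliser of \<open>e1\<close>, \<open>e2\<close>, \<open>e3\<close> acts on the three octonion coordinates by isometries with
  \<open>f A \<odot> g B = h (A \<odot> B)\<close> (up to conjugations), i.e. by isotopies of the octonion algebra. The pair
  \<open>(f \<e>, g \<e>)\<close> is an arbitrary pair of norm-1 octonions \<open>(u, v)\<close>, and the isotopies with given \<open>(u, v)\<close>
  are the isomorphisms from the octonion algebra to its isotope with product
  \<open>(x \<odot> cnj v) \<odot> (cnj u \<odot> y)\<close> and unit \<open>u \<odot> v\<close>. So it remains to count the isomorphisms between two
  octonion algebras over the same finite field. An isomorphism is determined by its effect on a
  frame: an idempotent \<open>p\<close> and three vectors of a Peirce space of \<open>p\<close> with triple product 1. Every frame
  provides coordinates in which the product is that of Zorn's vector matrices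
  (\<open>zorn_mult\<close>), so the isomorphisms correspond to the frames of the target, and there
  are \<open>(q^6 + q^3) (q^3 - 1) (q^3 - q) q^2 = q^6 (q^6 - 1) (q^2 - 1)\<close> of these.

  A central element commutes with all transvections, hence is a scalar, and the scalars that preserve
  the determinant are the cube roots of unity.
\<close>

section \<open>Counting tools\<close>

lemma card_eq_fibres:
  assumes "finite A" "finite B" "f ` A \<subseteq> B"
    and "\<And>b. b \<in> B \<Longrightarrow> card {a \<in> A. f a = b} = k"
  shows "card A = card B * k"
proof -
  have "card A = (\<Sum>b\<in>B. \<Sum>a\<in>{a \<in> A. f a = b}. 1)"
    by (subst sum.group[OF assms(1-3)]) simp
  also have "\<dots> = (\<Sum>b\<in>B. k)"
    by (intro sum.cong) (simp_all add: assms(4))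
  finally show ?thesis by simp
qed

lemma card_additive:
  fixes f :: "'a::ab_group_add \<Rightarrow> 'b::ab_group_add"
  assumes "finite A" and diff: "\<And>x y. x \<in> A \<Longrightarrow> y \<in> A \<Longrightarrow> x - y \<in> A"
    and f: "\<And>x y. f (x - y) = f x - f y"
  shows "card A = card (f ` A) * card {x \<in> A. f x = 0}"
proof (rule card_eq_fibres)
  fix b assume "b \<in> f ` A"
  then obtain a where a: "a \<in> A" "f a = b" by blast
  have add: "f (x + a) = f x + f a" for x
    using f[of "x + a" a] by (metis add_diff_cancel_right' diff_add_cancel)
  have "x + a \<in> A" if "x \<in> A" for x
    using diff[OF that diff[OF diff[OF a(1) a(1)] a(1)]] by simp
  then have "bij_betw (\<lambda>x. x - a) {x \<in> A. f x = b} {x \<in> A. f x = 0}"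
    using a diff f add by (intro bij_betw_byWitness[where f' = "\<lambda>x. x + a"]) auto
  then show "card {x \<in> A. f x = b} = card {x \<in> A. f x = 0}"
    by (rule bij_betw_same_card)
qed (use assms in auto)

lemma card_functional_zero:
  fixes f :: "'a::ab_group_add \<Rightarrow> 'b::{ab_group_add, finite}"
  assumes "finite A" "\<And>x y. x \<in> A \<Longrightarrow> y \<in> A \<Longrightarrow> x - y \<in> A" "\<And>x y. f (x - y) = f x - f y"
  shows "card A \<le> card (UNIV :: 'b set) * card {x \<in> A. f x = 0}"
  by (subst card_additive[of A f, OF assms]) (auto intro: mult_le_mono1 card_mono)

lemma card_hyperbola:
  "card {(a, b). a * b = (t :: 'f::{field, finite})} =
    (if t = 0 then 2 * card (UNIV :: 'f set) - 1 else card (UNIV :: 'f set) - 1)"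
proof (cases "t = 0")
  case True
  have "{(a, b). a * b = t} = insert (0, 0) ((\<lambda>a. (a, 0)) ` (- {0}) \<union> (\<lambda>a. (0, a)) ` (- {0}))"
    using True by auto
  also have "card \<dots> = Suc ((card (UNIV :: 'f set) - 1) + (card (UNIV :: 'f set) - 1))"
    by (subst card_insert_disjoint, simp, force, subst card_Un_disjoint)
      (auto simp: card_image inj_on_def Compl_eq_Diff_UNIV)
  finally show ?thesis
    using True card_mono[of "UNIV :: 'f set" "{0, 1}"] by simp
next
  case False
  then have "{(a, b). a * b = t} = (\<lambda>a. (a, t / a)) ` (- {0})"
    by (auto simp: image_iff)
  also have "card \<dots> = card (- {0 :: 'f})"
    by (rule card_image) (auto simp: inj_on_def)
  finally show ?thesis
    using False by (simp add: Compl_eq_Diff_UNIV)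
qed

text \<open>For each \<open>s\<close> the equation \<open>a * b = f s - t\<close> has \<open>2 q - 1\<close> solutions if \<open>f s = t\<close> and \<open>q - 1\<close>
  otherwise. Iterating this recursion counts the values of every form that is built up from
  hyperbolic planes.\<close>

lemma card_hyperbolic_extension:
  fixes f :: "'a \<Rightarrow> 'f::{field, finite}"
  assumes "finite S"
  shows "card {(s, a, b). s \<in> S \<and> f s - a * b = t} =
    card S * (card (UNIV :: 'f set) - 1) + card (UNIV :: 'f set) * card {s \<in> S. f s = t}"
proof -
  let ?q = "card (UNIV :: 'f set)"
  have q: "?q > 0" by (simp add: card_gt_0_iff)
  have "{(s, a, b). s \<in> S \<and> f s - a * b = t} = (SIGMA s:S. {(a, b). a * b = f s - t})"
    by (auto simp: algebra_simps)
  also have "card \<dots> = (\<Sum>s\<in>S. card {(a, b). a * b = f s - t})"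
    using assms by (intro card_SigmaI) auto
  also have "\<dots> = (\<Sum>s\<in>S. (?q - 1) + (if f s = t then ?q else 0))"
    using q by (intro sum.cong) (auto simp: card_hyperbola)
  also have "\<dots> = card S * (?q - 1) + ?q * card {s \<in> S. f s = t}"
    using assms by (simp add: sum.distrib flip: sum.inter_filter)
  finally show ?thesis .
qed

text \<open>More than half of the field consists of squares. Two subsets of this size meet, which
  gives isotropic vectors without separating characteristic 2.\<close>

lemma card_squares:
  "card (UNIV :: 'f::{field, finite} set) + 1 \<le> 2 * card (range (\<lambda>r :: 'f. r ^ 2))"
proof -
  let ?sq = "\<lambda>r :: 'f. r ^ 2"
  \<comment> \<open>Fibres of squaring have at most two elements; the fibre over 0 has only one.\<close>
  have two: "card {r. r ^ 2 = s ^ 2} \<le> 2" for s :: 'f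
  proof -
    have "{r. r ^ 2 = s ^ 2} \<subseteq> {s, - s}"
      by (auto simp: power2_eq_iff)
    then have "card {r. r ^ 2 = s ^ 2} \<le> card {s, - s}"
      by (intro card_mono) auto
    also have "\<dots> \<le> 2"
      by (simp add: card_insert_if)
    finally show ?thesis .
  qed
  have "card (UNIV :: 'f set) = (\<Sum>b\<in>range ?sq. \<Sum>a\<in>{a \<in> UNIV. a ^ 2 = b}. 1)"
    by (subst sum.group) auto
  also have "\<dots> = (\<Sum>b\<in>range ?sq. card {a. a ^ 2 = b})"
    by simp
  also have "\<dots> = card {a :: 'f. a ^ 2 = 0} + (\<Sum>b\<in>range ?sq - {0}. card {a. a ^ 2 = b})"
    by (rule sum.remove) (auto simp: image_iff intro: exI[of _ 0])
  also have "\<dots> \<le> 1 + (\<Sum>b\<in>range ?sq - {0}. 2)"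
    by (intro add_mono sum_mono) (auto intro: two)
  also have "\<dots> = 1 + 2 * (card (range ?sq) - 1)"
    by (simp add: card_Diff_singleton image_iff)
  finally show ?thesis
    using card_gt_0_iff[of "range ?sq"] by simp
qed

lemma card_Sigma_const:
  assumes "finite A" "\<And>a. a \<in> A \<Longrightarrow> finite (B a)" "\<And>a. a \<in> A \<Longrightarrow> card (B a) = k"
  shows "card (Sigma A B) = card A * k"
  using assms by (simp add: card_SigmaI)

lemma bij_betw_Collect:
  assumes "bij f" and eq: "\<And>c. Q c \<longleftrightarrow> P (f c)"
  shows "bij_betw f {c. Q c} {x. P x}"
proof -
  have "f ` {c. Q c} = {x. P x}"
  proof
    show "{x. P x} \<subseteq> f ` {c. Q c}"
    proof clarify
      fix x assume "P x"
      moreover obtain c where "x = f c"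
        using assms(1) by (rule bij_pointE)
      ultimately show "x \<in> f ` {c. Q c}"
        using eq by blast
    qed
  qed (auto simp: eq)
  moreover have "inj_on f {c. Q c}"
    using bij_is_inj[OF assms(1)] by (rule inj_on_subset) simp
  ultimately show ?thesis
    by (simp add: bij_betw_def)
qed

lemma card_orbit:
  assumes fin: "finite H" "finite \<Omega>"
    and comp: "\<And>g h. g \<in> H \<Longrightarrow> h \<in> H \<Longrightarrow> g \<circ> h \<in> H"
    and inverse: "\<And>g. g \<in> H \<Longrightarrow> \<exists>h\<in>H. h \<circ> g = id \<and> g \<circ> h = id"
    and into: "\<And>g. g \<in> H \<Longrightarrow> g x \<in> \<Omega>"
    and trans: "\<And>y. y \<in> \<Omega> \<Longrightarrow> \<exists>g\<in>H. g y = x"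
  shows "card H = card \<Omega> * card {g \<in> H. g x = x}"
proof (rule card_eq_fibres[where f = "\<lambda>g. g x"])
  fix y assume "y \<in> \<Omega>"
  then obtain k where k: "k \<in> H" "k y = x"
    using trans by blast
  then obtain l where l: "l \<in> H" "l \<circ> k = id" "k \<circ> l = id"
    using inverse by blast
  have lx: "l x = y"
    using k(2) l(2) by (metis comp_apply id_apply)
  have "bij_betw (\<lambda>g. k \<circ> g) {g \<in> H. g x = y} {g \<in> H. g x = x}"
  proof (rule bij_betw_byWitness[where f' = "\<lambda>g. l \<circ> g"])
    show "\<forall>g\<in>{g \<in> H. g x = y}. l \<circ> (k \<circ> g) = g" "\<forall>g\<in>{g \<in> H. g x = x}. k \<circ> (l \<circ> g) = g"
      using l(2,3) by (simp_all add: comp_assoc[symmetric])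
    show "(\<circ>) k ` {g \<in> H. g x = y} \<subseteq> {g \<in> H. g x = x}"
      using k comp by auto
    show "(\<circ>) l ` {g \<in> H. g x = x} \<subseteq> {g \<in> H. g x = y}"
      using l(1) lx comp by auto
  qed
  then show "card {g \<in> H. g x = y} = card {g \<in> H. g x = x}"
    by (rule bij_betw_same_card)
qed (use fin into in auto)

section \<open>Cube roots of unity in a finite field\<close>

lemma field_power_card_minus_1:
  fixes r :: "'f::{field, finite}"
  assumes "r \<noteq> 0"
  shows "r ^ (card (UNIV :: 'f set) - 1) = 1"
proof -
  have bij: "bij_betw (\<lambda>x. r * x) (- {0}) (- {0})"
    by (rule bij_betw_byWitness[where f' = "\<lambda>x. x / r"]) (use assms in auto)
  have "(\<Prod>x\<in>- {0 :: 'f}. x) = (\<Prod>x\<in>- {0}. r * x)"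
    by (rule prod.reindex_bij_betw[OF bij, symmetric])
  also have "\<dots> = r ^ card (- {0 :: 'f}) * (\<Prod>x\<in>- {0}. x)"
    by (simp add: prod.distrib)
  finally have "r ^ card (- {0 :: 'f}) = 1"
    by (simp add: prod_zero_iff)
  then show ?thesis
    by (simp add: Compl_eq_Diff_UNIV)
qed

lemma card_power_eq_1_le:
  fixes n :: nat
  assumes "n > 0"
  shows "card {x :: 'f::{field, finite}. x ^ n = 1} \<le> n"
proof -
  let ?p = "monom 1 n - 1 :: 'f poly"
  have "degree (monom 1 n :: 'f poly) = n"
    by (simp add: degree_monom_eq)
  then have "?p \<noteq> 0"
    using assms by auto
  then have "card {x. poly ?p x = 0} \<le> degree ?p"
    by (rule card_poly_roots_bound)
  also have "degree ?p \<le> n"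
    by (rule degree_diff_le) (simp_all add: degree_monom_eq)
  finally show ?thesis
    by (simp add: poly_monom)
qed

text \<open>If 3 does not divide the order \<open>n\<close> of the multiplicative group, a cube root of unity has
  exponents 3 and \<open>n\<close> and is trivial. If \<open>n = 3 k\<close>, some \<open>x \<noteq> 0\<close> is not among the at most \<open>k\<close> roots
  of \<open>x^k = 1\<close>, and \<open>x^k\<close> is a primitive cube root of unity.\<close>

lemma card_cube_roots_of_unity:
  "card {r :: 'f::{field, finite}. r ^ 3 = 1} = gcd 3 (card (UNIV :: 'f set) - 1)"
proof -
  define n where "n = card (UNIV :: 'f set) - 1"
  have "n > 0"
    using card_mono[of "UNIV :: 'f set" "{0, 1}"] by (simp add: n_def)
  have power_n: "r ^ n = 1" if "r \<noteq> 0" for r :: 'f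
    unfolding n_def using that by (rule field_power_card_minus_1)
  show ?thesis
  proof (cases "3 dvd n")
    case False
    have "r = 1" if r: "r ^ 3 = 1" for r :: 'f
    proof -
      have "r \<noteq> 0"
        using r by auto
      have "r ^ (n mod 3) = r ^ (3 * (n div 3)) * r ^ (n mod 3)"
        by (simp add: power_mult r)
      also have "\<dots> = r ^ n"
        by (simp flip: power_add)
      finally have m: "r ^ (n mod 3) = 1"
        using power_n[OF \<open>r \<noteq> 0\<close>] by simp
      have "n mod 3 = 1 \<or> n mod 3 = 2"
        using False by presburger
      then show "r = 1"
      proof
        assume "n mod 3 = 2"
        then have "r ^ 2 = 1"
          using m by simp
        then have "r ^ 3 = r"
          by (simp add: power3_eq_cube power2_eq_square)
        then show "r = 1"
          using r by simp
      qed (use m in simp)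
    qed
    then have "{r :: 'f. r ^ 3 = 1} = {1}"
      by auto
    moreover have "gcd 3 n = 1"
      using False prime_imp_coprime[of 3 n] by (simp add: coprime_iff_gcd_eq_1)
    ultimately show ?thesis
      by (simp add: n_def)
  next
    case True
    then obtain k where k: "n = 3 * k"
      by blast
    have "card {x :: 'f. x ^ k = 1} \<le> k"
      using k \<open>n > 0\<close> by (intro card_power_eq_1_le) simp
    also have "\<dots> < card (- {0 :: 'f})"
      using k \<open>n > 0\<close> by (simp add: Compl_eq_Diff_UNIV n_def)
    finally have "\<not> - {0 :: 'f} \<subseteq> {x. x ^ k = 1}"
      using card_mono[of "{x :: 'f. x ^ k = 1}" "- {0}"] by auto
    then obtain x :: 'f where x: "x \<noteq> 0" "x ^ k \<noteq> 1"
      by auto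
    define w where "w = x ^ k"
    have w3: "w ^ 3 = 1"
      using power_n[OF x(1)] by (simp add: w_def k power_mult[symmetric] mult.commute)
    have w1: "w \<noteq> 1"
      using x by (simp add: w_def)
    have "w \<noteq> 0"
      using w3 by auto
    have w2: "w ^ 2 \<noteq> 1"
      using w3 w1 by (auto simp: power3_eq_cube power2_eq_square)
    have w21: "w ^ 2 \<noteq> w"
      using w1 \<open>w \<noteq> 0\<close> by (simp add: power2_eq_square)
    have "(w ^ 2) ^ 3 = 1"
      using w3 by (metis power_commutes power_mult mult.commute power_one)
    then have "card {1, w, w ^ 2} \<le> card {r :: 'f. r ^ 3 = 1}"
      using w3 by (intro card_mono) auto
    moreover have "card {1, w, w ^ 2} = 3"
      using w1 w2 w21 by auto
    moreover have "card {r :: 'f. r ^ 3 = 1} \<le> 3"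
      by (rule card_power_eq_1_le) simp
    moreover have "gcd 3 n = 3"
      using True by (simp add: gcd_nat.absorb1)
    ultimately show ?thesis
      by (simp add: n_def)
  qed
qed

section \<open>Composition identities\<close>

context octonion_algebra
begin

abbreviation inn :: "'o \<Rightarrow> 'o \<Rightarrow> 'f" (\<open>\<langle>_,/ _\<rangle>\<close>) where
  "\<langle>x, y\<rangle> \<equiv> polar N x y"

definition cnj :: "'o \<Rightarrow> 'o" where
  "cnj x = T x *s \<e> - x"

lemma inn_simps:
  "\<langle>x + y, z\<rangle> = \<langle>x, z\<rangle> + \<langle>y, z\<rangle>" "\<langle>z, x + y\<rangle> = \<langle>z, x\<rangle> + \<langle>z, y\<rangle>"
  "\<langle>r *s x, z\<rangle> = r * \<langle>x, z\<rangle>" "\<langle>z, r *s x\<rangle> = r * \<langle>z, x\<rangle>"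
  "\<langle>- x, z\<rangle> = - \<langle>x, z\<rangle>" "\<langle>z, - x\<rangle> = - \<langle>z, x\<rangle>"
  "\<langle>x - y, z\<rangle> = \<langle>x, z\<rangle> - \<langle>y, z\<rangle>" "\<langle>z, x - y\<rangle> = \<langle>z, x\<rangle> - \<langle>z, y\<rangle>"
  "\<langle>0, z\<rangle> = 0" "\<langle>z, 0\<rangle> = 0"
proof -
  interpret l: Vector_Spaces.linear scale "(*)" "\<lambda>x. polar N x z" by (rule polar_left)
  interpret r: Vector_Spaces.linear scale "(*)" "\<lambda>x. polar N z x" by (rule polar_right)
  show "\<langle>x + y, z\<rangle> = \<langle>x, z\<rangle> + \<langle>y, z\<rangle>" "\<langle>z, x + y\<rangle> = \<langle>z, x\<rangle> + \<langle>z, y\<rangle>"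
    "\<langle>r *s x, z\<rangle> = r * \<langle>x, z\<rangle>" "\<langle>z, r *s x\<rangle> = r * \<langle>z, x\<rangle>"
    "\<langle>- x, z\<rangle> = - \<langle>x, z\<rangle>" "\<langle>z, - x\<rangle> = - \<langle>z, x\<rangle>"
    "\<langle>x - y, z\<rangle> = \<langle>x, z\<rangle> - \<langle>y, z\<rangle>" "\<langle>z, x - y\<rangle> = \<langle>z, x\<rangle> - \<langle>z, y\<rangle>"
    "\<langle>0, z\<rangle> = 0" "\<langle>z, 0\<rangle> = 0"
    by (fact l.add r.add l.scale r.scale l.neg r.neg l.diff r.diff l.zero r.zero)+
qed

lemma mult_simps:
  "(x + y) \<odot> z = x \<odot> z + y \<odot> z" "z \<odot> (x + y) = z \<odot> x + z \<odot> y"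
  "(r *s x) \<odot> z = r *s (x \<odot> z)" "z \<odot> (r *s x) = r *s (z \<odot> x)"
  "(- x) \<odot> z = - (x \<odot> z)" "z \<odot> (- x) = - (z \<odot> x)"
  "(x - y) \<odot> z = x \<odot> z - y \<odot> z" "z \<odot> (x - y) = z \<odot> x - z \<odot> y"
  "0 \<odot> z = 0" "z \<odot> 0 = 0"
proof -
  interpret l: Vector_Spaces.linear scale scale "\<lambda>x. x \<odot> z" by (rule mult_left)
  interpret r: Vector_Spaces.linear scale scale "\<lambda>x. z \<odot> x" by (rule mult_right)
  show "(x + y) \<odot> z = x \<odot> z + y \<odot> z" "z \<odot> (x + y) = z \<odot> x + z \<odot> y"
    "(r *s x) \<odot> z = r *s (x \<odot> z)" "z \<odot> (r *s x) = r *s (z \<odot> x)"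
    "(- x) \<odot> z = - (x \<odot> z)" "z \<odot> (- x) = - (z \<odot> x)"
    "(x - y) \<odot> z = x \<odot> z - y \<odot> z" "z \<odot> (x - y) = z \<odot> x - z \<odot> y"
    "0 \<odot> z = 0" "z \<odot> 0 = 0"
    by (fact l.add r.add l.scale r.scale l.neg r.neg l.diff r.diff l.zero r.zero)+
qed

lemma inn_commute: "\<langle>x, y\<rangle> = \<langle>y, x\<rangle>"
  by (simp add: polar_def add.commute algebra_simps)

lemma N_add: "N (x + y) = N x + N y + \<langle>x, y\<rangle>"
  by (simp add: polar_def)

lemma N_minus: "N (- x) = N x"
  using norm_scale[of "-1" x] by simp

lemma N_diff: "N (x - y) = N x + N y - \<langle>x, y\<rangle>"
  using N_add[of x "- y"] by (simp add: N_minus inn_simps)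

lemma inn_self: "\<langle>x, x\<rangle> = 2 * N x"
proof -
  have "x + x = 2 *s x"
    using scale_left_distrib[of 1 1 x] by simp
  then show ?thesis
    using norm_scale[of 2 x] by (simp add: polar_def)
qed

text \<open>Identities between octonions are proved below by comparing inner products with an arbitrary
  vector, which turns them into consequences of the polarised norm identity.\<close>

lemma inn_eqI: "(\<And>z. \<langle>x, z\<rangle> = \<langle>y, z\<rangle>) \<Longrightarrow> x = y"
  using polar_nondegenerate[of "x - y"] by (simp add: inn_simps)

lemma unit_nonzero: "\<e> \<noteq> 0"
proof
  assume "\<e> = 0"
  then have "x = 0" for x :: 'o
    using unit_left[of x] by (simp add: mult_simps)
  then have "dim (UNIV :: 'o set) = dim {0 :: 'o}"
    by (metis UNIV_eq_I singletonI)
  also have "\<dots> = 0"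
    using dim_unique[of "{}" "{0}" 0] by (simp add: span_empty independent_empty)
  finally show False
    using dim_eq_8 by simp
qed

lemma N_unit [simp]: "N \<e> = 1"
proof -
  have "N \<e> \<noteq> 0"
  proof
    assume "N \<e> = 0"
    then have "N x = 0" for x
      using norm_mult[of \<e> x] by (simp add: unit_left)
    then have "\<e> = 0"
      by (intro polar_nondegenerate) (simp add: polar_def)
    then show False
      using unit_nonzero by blast
  qed
  moreover have "N \<e> * N \<e> = N \<e>"
    using norm_mult[of \<e> \<e>] by (simp add: unit_left)
  ultimately show ?thesis by simp
qed

lemma T_unit: "T \<e> = 2"
  by (simp add: T_def inn_self)

lemma T_simps:
  "T (x + y) = T x + T y" "T (r *s x) = r * T x" "T (- x) = - T x" "T (x - y) = T x - T y" "T 0 = 0"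
  by (simp_all add: T_def inn_simps)

lemma cnj_simps:
  "cnj (x + y) = cnj x + cnj y" "cnj (r *s x) = r *s cnj x" "cnj (- x) = - cnj x"
  "cnj (x - y) = cnj x - cnj y" "cnj 0 = 0"
  by (simp_all add: cnj_def T_simps algebra_simps scale_left_distrib scale_right_diff_distrib
      scale_left_diff_distrib scale_right_distrib)

lemma cnj_unit [simp]: "cnj \<e> = \<e>"
proof -
  have "2 *s \<e> = \<e> + \<e>"
    using scale_left_distrib[of 1 1 \<e>] by simp
  then show ?thesis
    by (simp add: cnj_def T_unit)
qed

lemma T_cnj [simp]: "T (cnj x) = T x"
  by (simp add: cnj_def T_simps T_unit algebra_simps)

lemma cnj_cnj [simp]: "cnj (cnj x) = x"
  unfolding cnj_def [of "cnj x"] T_cnj by (simp add: cnj_def)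

lemma N_cnj [simp]: "N (cnj x) = N x"
  using inn_commute[of \<e> x] by (simp add: cnj_def N_diff norm_scale inn_simps T_def power2_eq_square)

lemma inn_cnj_cnj: "\<langle>cnj x, cnj y\<rangle> = \<langle>x, y\<rangle>"
  by (metis N_cnj cnj_simps(1) polar_def)

lemma inn_cnj: "\<langle>cnj x, y\<rangle> = \<langle>x, cnj y\<rangle>"
  by (metis inn_cnj_cnj cnj_cnj)

lemma inn_mult_left: "\<langle>x \<odot> y, x \<odot> z\<rangle> = N x * \<langle>y, z\<rangle>"
  by (simp add: polar_def norm_mult algebra_simps flip: mult_simps(2))

lemma inn_mult_right: "\<langle>x \<odot> z, y \<odot> z\<rangle> = \<langle>x, y\<rangle> * N z"
  by (simp add: polar_def norm_mult algebra_simps flip: mult_simps(1))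

lemma inn_mult_mult: "\<langle>x \<odot> y, z \<odot> w\<rangle> + \<langle>x \<odot> w, z \<odot> y\<rangle> = \<langle>x, z\<rangle> * \<langle>y, w\<rangle>"
  using inn_mult_right[of x "y + w" z] inn_mult_right[of x y z] inn_mult_right[of x w z]
  by (simp add: mult_simps inn_simps N_add inn_commute[of w y] algebra_simps)

lemma inn_left_adjoint: "\<langle>x \<odot> y, z\<rangle> = \<langle>y, cnj x \<odot> z\<rangle>"
  using inn_mult_mult[of x y \<e> z]
  by (simp add: unit_left cnj_def T_def mult_simps inn_simps inn_commute algebra_simps)

lemma inn_right_adjoint: "\<langle>x \<odot> y, z\<rangle> = \<langle>x, z \<odot> cnj y\<rangle>"
  using inn_mult_mult[of x y z \<e>]
  by (simp add: unit_right cnj_def T_def mult_simps inn_simps algebra_simps)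

lemma cnj_mult_cancel: "cnj x \<odot> (x \<odot> y) = N x *s y"
  by (rule inn_eqI) (simp add: inn_left_adjoint[of "cnj x"] inn_mult_left inn_simps)

lemma mult_cnj_cancel: "x \<odot> (cnj x \<odot> y) = N x *s y"
  using cnj_mult_cancel[of "cnj x"] by simp

lemma mult_cnj_cancel_right: "(y \<odot> x) \<odot> cnj x = N x *s y"
  by (rule inn_eqI) (simp add: inn_right_adjoint[of _ "cnj x"] inn_mult_right inn_simps)

lemma cnj_mult_cancel_right: "(y \<odot> cnj x) \<odot> x = N x *s y"
  using mult_cnj_cancel_right[of y "cnj x"] by simp

lemma mult_cnj: "x \<odot> cnj x = N x *s \<e>"
  using mult_cnj_cancel[of x \<e>] by (simp add: unit_right)

lemma cnj_mult: "cnj x \<odot> x = N x *s \<e>"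
  using mult_cnj[of "cnj x"] by simp

text \<open>The linearised alternative law. In an algebra that is not associative this identity and its mirror
  image are the main tools for moving factors past each other.\<close>

lemma mult_cnj_add: "x \<odot> (cnj y \<odot> z) + y \<odot> (cnj x \<odot> z) = \<langle>x, y\<rangle> *s z"
  using mult_cnj_cancel[of "x + y" z] mult_cnj_cancel[of x z] mult_cnj_cancel[of y z]
  by (simp add: mult_simps cnj_simps N_add scale_left_distrib algebra_simps)

lemma mult_cnj_add_right: "(z \<odot> cnj y) \<odot> x + (z \<odot> cnj x) \<odot> y = \<langle>x, y\<rangle> *s z"
  using cnj_mult_cancel_right[of z "x + y"] cnj_mult_cancel_right[of z x] cnj_mult_cancel_right[of z y]
  by (simp add: mult_simps cnj_simps N_add scale_left_distrib algebra_simps)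

lemma T_mult: "T (x \<odot> y) = \<langle>x, cnj y\<rangle>"
  unfolding T_def inn_right_adjoint[of x] by (simp add: unit_left)

lemma T_mult_commute: "T (x \<odot> y) = T (y \<odot> x)"
  by (metis T_mult inn_cnj inn_commute)

lemma T_mult_cycle: "T ((x \<odot> y) \<odot> z) = T ((y \<odot> z) \<odot> x)"
  using inn_left_adjoint[of x y "cnj z"] inn_right_adjoint[of y z "cnj x"]
  by (simp add: T_mult)

lemma T_mult_assoc: "T (x \<odot> (y \<odot> z)) = T ((x \<odot> y) \<odot> z)"
  using T_mult_commute[of x "y \<odot> z"] T_mult_cycle[of x y z] by simp

lemma cnj_mult_rev: "cnj (x \<odot> y) = cnj y \<odot> cnj x"
proof (rule inn_eqI)
  fix z
  have "\<langle>cnj y \<odot> cnj x, z\<rangle> = T ((y \<odot> z) \<odot> x)"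
    using inn_left_adjoint[of "cnj y" "cnj x" z] by (simp add: T_mult inn_commute)
  also have "\<dots> = T ((x \<odot> y) \<odot> z)"
    by (rule T_mult_cycle[of x y z, symmetric])
  finally show "\<langle>cnj (x \<odot> y), z\<rangle> = \<langle>cnj y \<odot> cnj x, z\<rangle>"
    by (simp add: T_mult inn_cnj)
qed

end

text \<open>The cardinality \<open>q\<close> is a parameter of the locale because a constant that stands for the
  cardinality of the type \<open>'f\<close> would need a type argument.\<close>

locale finite_octonion_algebra = octonion_algebra scale mult unit N
  for scale :: "'f::{field, finite} \<Rightarrow> 'o::ab_group_add \<Rightarrow> 'o" (infixr \<open>*s\<close> 75)
    and mult :: "'o \<Rightarrow> 'o \<Rightarrow> 'o" (infixl \<open>\<odot>\<close> 70)
    and unit :: 'o (\<open>\<e>\<close>)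
    and N :: "'o \<Rightarrow> 'f" +
  fixes q :: nat
  assumes card_field [simp]: "card (UNIV :: 'f set) = q"
begin

lemma q_gt_1: "q > 1"
  using card_mono[of "UNIV :: 'f set" "{0, 1}"] by simp

lemma card_span_independent:
  assumes "finite B" "independent B"
  shows "finite (span B) \<and> card (span B) = q ^ card B"
  using assms
proof (induction B rule: finite_induct)
  case (insert a B)
  then have IH: "finite (span B)" "card (span B) = q ^ card B" and a: "a \<notin> span B"
    by (auto simp: independent_insert)
  let ?f = "\<lambda>(r, x). r *s a + x"
  have eq: "span (insert a B) = ?f ` (UNIV \<times> span B)"
  proof
    show "span (insert a B) \<subseteq> ?f ` (UNIV \<times> span B)"
    proof
      fix x assume "x \<in> span (insert a B)"
      then obtain k where "x - k *s a \<in> span B"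
        by (auto simp: span_insert)
      then show "x \<in> ?f ` (UNIV \<times> span B)"
        by (intro image_eqI[of _ _ "(k, x - k *s a)"]) auto
    qed
    show "?f ` (UNIV \<times> span B) \<subseteq> span (insert a B)"
      by (clarsimp simp: span_insert) (metis add_diff_cancel_left')
  qed
  have "inj_on ?f (UNIV \<times> span B)"
  proof (rule inj_onI, clarify)
    fix r x s y assume x: "x \<in> span B" and y: "y \<in> span B" and e: "r *s a + x = s *s a + y"
    have "(r - s) *s a = y - x"
      using e by (simp add: scale_left_diff_distrib algebra_simps)
    then have "(r - s) *s a \<in> span B"
      using x y span_diff by metis
    then have "inverse (r - s) *s ((r - s) *s a) \<in> span B"
      by (rule span_scale)
    then have "r = s"
      using a by (cases "r = s") auto
    then show "r = s \<and> x = y"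
      using e by simp
  qed
  then have "card (span (insert a B)) = q * card (span B)"
    unfolding eq by (simp add: card_image card_cartesian_product)
  then show ?case
    using IH insert.hyps eq by simp
qed (simp add: span_empty)

lemma card_octonions: "finite (UNIV :: 'o set)" "card (UNIV :: 'o set) = q ^ 8"
proof -
  obtain B :: "'o set" where B: "independent B" "UNIV \<subseteq> span B" "card B = 8"
    using basis_exists[of UNIV] dim_eq_8 by metis
  then have "finite B" using card.infinite by fastforce
  from card_span_independent[OF this B(1)] B
  show "finite (UNIV :: 'o set)" "card (UNIV :: 'o set) = q ^ 8"
    by (auto simp: subset_antisym top.extremum_unique)
qed

lemma finite_octonions [simp, intro]: "finite (A :: 'o set)"
  using card_octonions(1) finite_subset subset_UNIV by blast

lemma card_functional_fibre:
  assumes diff: "\<And>x y. x \<in> A \<Longrightarrow> y \<in> A \<Longrightarrow> x - y \<in> A"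
    and scaled: "\<And>r x. x \<in> A \<Longrightarrow> r *s x \<in> A"
    and f: "\<And>x y. f (x - y) = f x - f y" "\<And>r x. f (r *s x) = r * (f x :: 'f)"
    and a: "a \<in> A" "f a \<noteq> 0"
  shows "q * card {x \<in> A. f x = t} = card A"
proof -
  have *: "card {x \<in> A. f x = t} = card {x \<in> A. f x = 0}" for t
  proof -
    define b where "b = (t / f a) *s a"
    have b: "b \<in> A" "f b = t"
      using a scaled f by (auto simp: b_def)
    have add: "f (x + b) = f x + f b" for x
      using f(1)[of "x + b" b] by (metis add_diff_cancel_right' diff_add_cancel)
    have "x + b \<in> A" if "x \<in> A" for x
      using diff[OF that diff[OF diff[OF b(1) b(1)] b(1)]] by simp
    then have "bij_betw (\<lambda>x. x - b) {x \<in> A. f x = t} {x \<in> A. f x = 0}"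
      using b diff f add by (intro bij_betw_byWitness[where f' = "\<lambda>x. x + b"]) auto
    then show ?thesis
      by (rule bij_betw_same_card)
  qed
  have "card A = q * card {x \<in> A. f x = 0}"
    using card_eq_fibres[of A UNIV f "card {x \<in> A. f x = 0}"] * by simp
  then show ?thesis
    using * by simp
qed

section \<open>Idempotents and the Peirce decomposition\<close>

lemma flexible: "(x \<odot> y) \<odot> x = x \<odot> (y \<odot> x)"
proof (rule inn_eqI)
  fix z
  have "\<langle>x \<odot> cnj x, z \<odot> y\<rangle> = \<langle>y \<odot> z, cnj x \<odot> x\<rangle>"
    using T_mult_commute[of z y] by (simp add: mult_cnj cnj_mult inn_simps T_def inn_commute)
  then have "\<langle>x \<odot> y, z \<odot> cnj x\<rangle> = \<langle>y \<odot> x, cnj x \<odot> z\<rangle>"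
    using inn_mult_mult[of x y z "cnj x"] inn_mult_mult[of y x "cnj x" z]
    by (metis add_right_cancel mult.commute)
  then show "\<langle>(x \<odot> y) \<odot> x, z\<rangle> = \<langle>x \<odot> (y \<odot> x), z\<rangle>"
    using inn_right_adjoint[of "x \<odot> y" x z] inn_left_adjoint[of x "y \<odot> x" z] by simp
qed

text \<open>If \<open>\<langle>x, z\<rangle> = 1\<close> and \<open>x \<odot> y = 0\<close>, the linearised alternative law reads \<open>y = cnj x \<odot> (z \<odot> y)\<close>.\<close>

lemma kernel_eq_range:
  assumes "N x = 0" "x \<noteq> 0"
  shows "{y. x \<odot> y = 0} = range (\<lambda>z. cnj x \<odot> z)"
proof
  show "range (\<lambda>z. cnj x \<odot> z) \<subseteq> {y. x \<odot> y = 0}"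
    using assms by (auto simp: mult_cnj_cancel)
  show "{y. x \<odot> y = 0} \<subseteq> range (\<lambda>z. cnj x \<odot> z)"
  proof clarify
    fix y assume "x \<odot> y = 0"
    obtain z where "\<langle>x, z\<rangle> \<noteq> 0"
      using assms(2) polar_nondegenerate by blast
    moreover have "cnj x \<odot> (z \<odot> y) = \<langle>x, z\<rangle> *s y"
      using mult_cnj_add[of "cnj x" "cnj z" y] \<open>x \<odot> y = 0\<close> by (simp add: mult_simps inn_cnj_cnj)
    ultimately have "cnj x \<odot> ((inverse \<langle>x, z\<rangle>) *s (z \<odot> y)) = y"
      by (simp add: mult_simps)
    then show "y \<in> range (\<lambda>z. cnj x \<odot> z)"
      by (metis rangeI)
  qed
qed

lemma card_kernel_range: "card (range (\<lambda>z. x \<odot> z)) * card {z. x \<odot> z = 0} = q ^ 8"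
  using card_additive[of UNIV "\<lambda>z. x \<odot> z"] by (simp add: mult_simps card_octonions)

text \<open>Since \<open>x \<odot> x = T x *s x - N x *s \<e>\<close>, these are the idempotents other than \<open>0\<close> and \<open>\<e>\<close>.\<close>

definition idem :: "'o \<Rightarrow> bool" where
  "idem p \<longleftrightarrow> N p = 0 \<and> T p = 1"

text \<open>One of the two off-diagonal Peirce spaces of an idempotent \<open>p\<close>; as \<open>cnj p = \<e> - p\<close>, the other one
  is \<open>peirce (cnj p)\<close>. They will turn out to be 3-dimensional, dual to each other under the trace form.\<close>

definition peirce :: "'o \<Rightarrow> 'o set" where
  "peirce p = {x. p \<odot> x = x \<and> x \<odot> p = 0}"

lemma idem_cnj: "idem p \<Longrightarrow> idem (cnj p)"
  by (simp add: idem_def)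

lemma idem_cnj_eq: "idem p \<Longrightarrow> cnj p = \<e> - p"
  by (simp add: idem_def cnj_def)

lemma idem_mult:
  assumes "idem p"
  shows "cnj p \<odot> (p \<odot> x) = 0" "p \<odot> (cnj p \<odot> x) = 0" "(x \<odot> p) \<odot> cnj p = 0" "(x \<odot> cnj p) \<odot> p = 0"
    "p \<odot> (p \<odot> x) = p \<odot> x" "(x \<odot> p) \<odot> p = x \<odot> p" "p \<odot> p = p" "cnj p \<odot> p = 0" "p \<odot> cnj p = 0"
    "cnj p \<odot> cnj p = cnj p"
proof -
  have N: "N p = 0" using assms by (simp add: idem_def)
  show *: "cnj p \<odot> (p \<odot> x) = 0" "p \<odot> (cnj p \<odot> x) = 0" "(x \<odot> p) \<odot> cnj p = 0" "(x \<odot> cnj p) \<odot> p = 0"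
    "cnj p \<odot> p = 0" "p \<odot> cnj p = 0"
    by (simp_all add: cnj_mult_cancel mult_cnj_cancel mult_cnj_cancel_right cnj_mult_cancel_right
        cnj_mult mult_cnj N)
  show "p \<odot> (p \<odot> x) = p \<odot> x"
    using *(1) by (simp add: idem_cnj_eq[OF assms] mult_simps unit_left)
  show "(x \<odot> p) \<odot> p = x \<odot> p"
    using *(3) by (simp add: idem_cnj_eq[OF assms] mult_simps unit_right)
  show "p \<odot> p = p" "cnj p \<odot> cnj p = cnj p"
    using *(5,6) by (simp_all add: idem_cnj_eq[OF assms] mult_simps unit_left unit_right)
qed

lemma peirceD:
  assumes p: "idem p" and x: "x \<in> peirce p"
  shows "p \<odot> x = x" "x \<odot> p = 0" "cnj p \<odot> x = 0" "x \<odot> cnj p = x" "T x = 0" "N x = 0" "cnj x = - x"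
    "\<langle>x, p\<rangle> = 0" "\<langle>x, cnj p\<rangle> = 0" "x \<odot> x = 0"
proof -
  show *: "p \<odot> x = x" "x \<odot> p = 0"
    using x by (auto simp: peirce_def)
  then show **: "cnj p \<odot> x = 0" "x \<odot> cnj p = x"
    by (simp_all add: idem_cnj_eq[OF p] mult_simps unit_left unit_right)
  show T: "T x = 0"
    using T_mult_commute[of p x] * by (simp add: T_simps)
  show N: "N x = 0"
    using norm_mult[of p x] * p by (simp add: idem_def)
  show c: "cnj x = - x"
    by (simp add: cnj_def T)
  show "x \<odot> x = 0"
    using cnj_mult[of x] c by (simp add: N mult_simps)
  show "\<langle>x, p\<rangle> = 0" "\<langle>x, cnj p\<rangle> = 0"
    using T_mult[of x "cnj p"] T_mult[of x p] * ** T by (simp_all add: T_simps)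
qed

lemma peirce_closed:
  "x \<in> peirce p \<Longrightarrow> y \<in> peirce p \<Longrightarrow> x + y \<in> peirce p"
  "x \<in> peirce p \<Longrightarrow> y \<in> peirce p \<Longrightarrow> x - y \<in> peirce p"
  "x \<in> peirce p \<Longrightarrow> r *s x \<in> peirce p" "0 \<in> peirce p" "x \<in> peirce p \<Longrightarrow> - x \<in> peirce p"
  by (simp_all add: peirce_def mult_simps)

lemma peirce_inn: "idem p \<Longrightarrow> x \<in> peirce p \<Longrightarrow> y \<in> peirce p \<Longrightarrow> \<langle>x, y\<rangle> = 0"
  using peirceD(6) peirce_closed(1) by (simp add: polar_def)

lemma peirce_mult_anticommute:
  assumes "idem p" "x \<in> peirce p" "y \<in> peirce p"
  shows "y \<odot> x = - (x \<odot> y)"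
proof -
  have "(x + y) \<odot> (x + y) = 0"
    using assms peirceD(10) peirce_closed(1) by blast
  then show ?thesis
    using peirceD(10)[OF assms(1,2)] peirceD(10)[OF assms(1,3)]
    by (simp add: mult_simps eq_neg_iff_add_eq_0)
qed

lemma peirce_mult:
  assumes p: "idem p" and x: "x \<in> peirce p" and y: "y \<in> peirce p"
  shows "x \<odot> y \<in> peirce (cnj p)"
proof -
  note X = peirceD[OF p x] and Y = peirceD[OF p y]
  have "p \<odot> (x \<odot> y) = 0"
    using mult_cnj_add[of p "cnj x" y] X Y by (simp add: mult_simps cnj_simps inn_simps inn_commute)
  moreover have "(x \<odot> y) \<odot> cnj p = 0"
    using mult_cnj_add_right[of x "cnj y" "cnj p"] X Y by (simp add: mult_simps cnj_simps inn_simps inn_commute)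
  ultimately show ?thesis
    by (simp add: peirce_def idem_cnj_eq[OF p] mult_simps unit_left)
qed

lemma idem_corner:
  assumes p: "idem p" and x: "p \<odot> x = x" "x \<odot> p = x"
  shows "x = T x *s p"
proof -
  have "x \<odot> cnj p = 0"
    using x by (simp add: idem_cnj_eq[OF p] mult_simps unit_right)
  then have "\<langle>p, x\<rangle> = 0"
    using T_mult[of x "cnj p"] by (simp add: T_simps inn_commute)
  then have "p \<odot> cnj x + x \<odot> cnj p = 0"
    using mult_cnj_add[of p x \<e>] by (simp add: unit_right)
  then have "p \<odot> cnj x = 0"
    using \<open>x \<odot> cnj p = 0\<close> by simp
  then show ?thesis
    using x by (simp add: cnj_def mult_simps unit_right)
qed

lemma peirce_mult_opposite:
  assumes p: "idem p" and x: "x \<in> peirce p" and w: "w \<in> peirce (cnj p)"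
  shows "x \<odot> w = T (x \<odot> w) *s p"
proof (rule idem_corner[OF p])
  note X = peirceD[OF p x] and W = peirceD[OF idem_cnj[OF p] w]
  show "p \<odot> (x \<odot> w) = x \<odot> w"
    using mult_cnj_add[of p "cnj x" w] X W by (simp add: mult_simps cnj_simps inn_simps inn_commute)
  show "(x \<odot> w) \<odot> p = x \<odot> w"
    using mult_cnj_add_right[of x "cnj w" p] X W by (simp add: mult_simps cnj_simps inn_simps inn_commute)
qed

lemma peirce_projection:
  assumes p: "idem p"
  shows "(p \<odot> z) \<odot> cnj p \<in> peirce p"
proof -
  have "p \<odot> (p \<odot> z \<odot> cnj p) = p \<odot> z \<odot> cnj p"
    using flexible[of p "p \<odot> z"] flexible[of p z]
    by (simp add: idem_cnj_eq[OF p] mult_simps unit_right idem_mult[OF p])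
  then show ?thesis
    by (simp add: peirce_def idem_mult[OF p])
qed

lemma idem_corner_projection:
  assumes p: "idem p"
  shows "(p \<odot> z) \<odot> p = T ((p \<odot> z) \<odot> p) *s p"
  by (rule idem_corner[OF p]) (simp_all add: idem_mult[OF p] flexible)

definition peirce_sum :: "'o \<Rightarrow> 'f \<times> 'f \<times> 'o \<times> 'o \<Rightarrow> 'o" where
  "peirce_sum p = (\<lambda>(a, b, x, w). a *s p + b *s cnj p + x + w)"

lemma peirce_sum_inj:
  assumes p: "idem p"
  shows "inj_on (peirce_sum p) (UNIV \<times> UNIV \<times> peirce p \<times> peirce (cnj p))"
proof (rule inj_onI)
  fix s t
  assume s: "s \<in> UNIV \<times> UNIV \<times> peirce p \<times> peirce (cnj p)" and t: "t \<in> UNIV \<times> UNIV \<times> peirce p \<times> peirce (cnj p)"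
    and eq: "peirce_sum p s = peirce_sum p t"
  obtain a b x w a' b' x' w' where st: "s = (a, b, x, w)" "t = (a', b', x', w')"
    by (cases s, cases t) auto
  have x: "x \<in> peirce p" and w: "w \<in> peirce (cnj p)" and x': "x' \<in> peirce p" and w': "w' \<in> peirce (cnj p)"
    using s t st by auto
  have mult: "p \<odot> peirce_sum p (a, b, x, w) \<odot> p = a *s p" "p \<odot> peirce_sum p (a, b, x, w) \<odot> cnj p = x"
    "cnj p \<odot> peirce_sum p (a, b, x, w) \<odot> cnj p = b *s cnj p" "cnj p \<odot> peirce_sum p (a, b, x, w) \<odot> p = w"
    if "x \<in> peirce p" "w \<in> peirce (cnj p)" for a b x w
    using peirceD[OF p that(1)] peirceD[OF idem_cnj[OF p] that(2)]
    by (simp_all add: peirce_sum_def mult_simps idem_mult[OF p])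
  have "p \<noteq> 0" "cnj p \<noteq> 0"
    using p idem_cnj[OF p] T_simps(5) zero_neq_one unfolding idem_def by metis+
  then show "s = t"
    using mult[OF x w, of a b] mult[OF x' w', of a' b'] eq st by auto
qed

lemma peirce_sum_surj:
  assumes p: "idem p"
  obtains a b x w where "x \<in> peirce p" "w \<in> peirce (cnj p)" "z = peirce_sum p (a, b, x, w)"
proof
  show "(p \<odot> z) \<odot> cnj p \<in> peirce p" "(cnj p \<odot> z) \<odot> p \<in> peirce (cnj p)"
    using peirce_projection[OF p] peirce_projection[OF idem_cnj[OF p]] by simp_all
  have "z = (p \<odot> z) \<odot> p + (cnj p \<odot> z) \<odot> cnj p + (p \<odot> z) \<odot> cnj p + (cnj p \<odot> z) \<odot> p"
    by (simp add: idem_cnj_eq[OF p] mult_simps unit_left unit_right)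
  then show "z = peirce_sum p (T ((p \<odot> z) \<odot> p), T ((cnj p \<odot> z) \<odot> cnj p), (p \<odot> z) \<odot> cnj p, (cnj p \<odot> z) \<odot> p)"
    unfolding peirce_sum_def prod.case
    using idem_corner_projection[OF p, of z] idem_corner_projection[OF idem_cnj[OF p], of z] by simp
qed

lemma card_peirce_product:
  assumes p: "idem p"
  shows "card (peirce p) * card (peirce (cnj p)) = q ^ 6"
proof -
  have "peirce_sum p ` (UNIV \<times> UNIV \<times> peirce p \<times> peirce (cnj p)) = UNIV"
  proof (intro UNIV_eq_I[symmetric])
    fix z
    show "z \<in> peirce_sum p ` (UNIV \<times> UNIV \<times> peirce p \<times> peirce (cnj p))"
      by (rule peirce_sum_surj[OF p, of z]) (auto intro!: imageI)
  qed
  then have "q ^ 8 = q * (q * (card (peirce p) * card (peirce (cnj p))))"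
    using card_image[OF peirce_sum_inj[OF p]] by (simp add: card_octonions card_cartesian_product)
  then show ?thesis
    using q_gt_1 by (simp add: eval_nat_numeral)
qed

lemma peirce_pairing:
  assumes p: "idem p" and x: "x \<in> peirce p" "x \<noteq> 0"
  obtains w where "w \<in> peirce (cnj p)" "T (x \<odot> w) = 1"
proof -
  obtain z where z: "\<langle>x, z\<rangle> \<noteq> 0"
    using x(2) polar_nondegenerate by blast
  obtain a b u w where u: "u \<in> peirce p" and w: "w \<in> peirce (cnj p)"
    and zz: "z = peirce_sum p (a, b, u, w)"
    by (rule peirce_sum_surj[OF p, of z])
  have "\<langle>x, z\<rangle> = \<langle>x, w\<rangle>"
    using peirceD[OF p x(1)] peirce_inn[OF p x(1) u] by (simp add: zz peirce_sum_def inn_simps)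
  then have t: "T (x \<odot> w) \<noteq> 0"
    using z peirceD(7)[OF idem_cnj[OF p] w] by (simp add: T_mult inn_simps)
  show ?thesis
    by (rule that[of "inverse (T (x \<odot> w)) *s w"]) (use t w in \<open>auto simp: peirce_closed mult_simps T_simps\<close>)
qed

text \<open>Here \<open>cnj x = - x\<close>, so left multiplication by \<open>x\<close> has equal kernel and range.\<close>

lemma card_kernel_nilpotent:
  assumes "N x = 0" "x \<noteq> 0" "T x = 0"
  shows "card {y. x \<odot> y = 0} = q ^ 4"
proof -
  have "cnj x = - x"
    using assms by (simp add: cnj_def)
  then have "{y. x \<odot> y = 0} = range (\<lambda>z. - (x \<odot> z))"
    using kernel_eq_range[OF assms(1,2)] by (simp add: mult_simps)
  also have "\<dots> = range (\<lambda>z. x \<odot> z)"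
    by (auto simp: image_iff) (metis mult_simps(6) minus_minus)+
  finally have "card {y. x \<odot> y = 0} ^ 2 = (q ^ 4) ^ 2"
    using card_kernel_range[of x] by (simp add: power2_eq_square flip: power_add)
  then show ?thesis
    by (rule power_eq_imp_eq_base) simp_all
qed

text \<open>The first equation evaluates the kernel of left multiplication by \<open>x\<close> on the whole algebra, which has
  \<open>q^4\<close> elements, in Peirce components. For the bound, left multiplication by \<open>x\<close> maps \<open>peirce p\<close> into
  the hyperplane of \<open>peirce (cnj p)\<close> that is orthogonal to \<open>x\<close> under the trace pairing.\<close>

lemma card_peirce_kernel:
  assumes p: "idem p" and x: "x \<in> peirce p" "x \<noteq> 0"
  shows "card {y \<in> peirce p. x \<odot> y = 0} * card (peirce (cnj p)) = q ^ 4"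
    and "card (peirce p) \<le> q ^ 3"
proof -
  note X = peirceD[OF p x(1)]
  let ?K = "{y \<in> peirce p. x \<odot> y = 0}" and ?W = "{w \<in> peirce (cnj p). T (x \<odot> w) = 0}"
  obtain w1 where w1: "w1 \<in> peirce (cnj p)" "T (x \<odot> w1) = 1"
    using peirce_pairing[OF p x] .
  have W: "q * card ?W = card (peirce (cnj p))"
    by (rule card_functional_fibre[where a = w1]) (use w1 in \<open>auto simp: peirce_closed mult_simps T_simps\<close>)
  have mult: "x \<odot> peirce_sum p (a, b, y, w) = b *s x + x \<odot> y + T (x \<odot> w) *s p"
    if "y \<in> peirce p" "w \<in> peirce (cnj p)" for a b y w
    using X peirce_mult_opposite[OF p x(1) that(2)] by (simp add: peirce_sum_def mult_simps)
  \<comment> \<open>In Peirce components \<open>(a, b, y, w)\<close> the vector \<open>x \<odot> z\<close> has the components \<open>(T (x \<odot> w), 0, b *s x, x \<odot> y)\<close>.\<close>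
  have "{z. x \<odot> z = 0} = peirce_sum p ` (UNIV \<times> {0} \<times> ?K \<times> ?W)"
  proof
    show "peirce_sum p ` (UNIV \<times> {0} \<times> ?K \<times> ?W) \<subseteq> {z. x \<odot> z = 0}"
      by (auto simp: mult)
    show "{z. x \<odot> z = 0} \<subseteq> peirce_sum p ` (UNIV \<times> {0} \<times> ?K \<times> ?W)"
    proof clarify
      fix z assume z: "x \<odot> z = 0"
      obtain a b y w where y: "y \<in> peirce p" and w: "w \<in> peirce (cnj p)"
        and zz: "z = peirce_sum p (a, b, y, w)"
        by (rule peirce_sum_surj[OF p, of z])
      have "peirce_sum p (T (x \<odot> w), 0, b *s x, x \<odot> y) = x \<odot> z"
        using mult[OF y w, of a b] by (simp add: zz peirce_sum_def algebra_simps)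
      also have "\<dots> = peirce_sum p (0, 0, 0, 0)"
        by (simp add: z peirce_sum_def)
      finally have "(T (x \<odot> w), 0 :: 'f, b *s x, x \<odot> y) = (0, 0, 0, 0)"
        using peirce_mult[OF p x(1) y] x(1) 
        by (intro inj_onD[OF peirce_sum_inj[OF p]]) (auto simp: peirce_closed)
      then show "z \<in> peirce_sum p ` (UNIV \<times> {0} \<times> ?K \<times> ?W)"
        using x(2) y w by (auto simp: zz)
    qed
  qed
  moreover have "inj_on (peirce_sum p) (UNIV \<times> {0} \<times> ?K \<times> ?W)"
    by (rule inj_on_subset[OF peirce_sum_inj[OF p]]) auto
  ultimately have "card {z. x \<odot> z = 0} = card ((UNIV :: 'f set) \<times> {0 :: 'f} \<times> ?K \<times> ?W)"
    by (simp only: card_image)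
  then show K: "card ?K * card (peirce (cnj p)) = q ^ 4"
    using card_kernel_nilpotent[OF X(6) x(2) X(5)] W by (simp add: card_cartesian_product ac_simps)
  have "(\<lambda>y. x \<odot> y) ` peirce p \<subseteq> ?W"
    using peirce_mult[OF p x(1)] X(10)
    by (auto simp: T_mult_assoc T_simps mult_simps)
  then have "card ((\<lambda>y. x \<odot> y) ` peirce p) \<le> card ?W"
    by (intro card_mono) auto
  moreover have "card (peirce p) = card ((\<lambda>y. x \<odot> y) ` peirce p) * card ?K"
    by (rule card_additive) (auto simp: peirce_closed mult_simps)
  ultimately have "q * card (peirce p) \<le> q * (card ?W * card ?K)"
    by simp
  also have "\<dots> = q ^ 4"
    unfolding K[symmetric] W[symmetric] by (simp only: mult_ac)
  finally show "card (peirce p) \<le> q ^ 3"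
    using q_gt_1 by (simp add: eval_nat_numeral)
qed

text \<open>Both Peirce spaces have at most \<open>q^3\<close> elements, and the product of their cardinalities is \<open>q^6\<close>.\<close>

lemma card_peirce:
  assumes p: "idem p"
  shows "card (peirce p) = q ^ 3"
proof -
  have ex: "\<exists>x. x \<in> peirce (cnj p) \<and> x \<noteq> 0" if p: "idem p" and x: "x \<in> peirce p" "x \<noteq> 0" for p x
    using peirce_pairing[OF that] by (metis mult_zero(2) T_zero zero_neq_one)
  have "\<exists>x. x \<in> peirce p \<and> x \<noteq> 0"
  proof (rule ccontr)
    assume "\<nexists>x. x \<in> peirce p \<and> x \<noteq> 0"
    moreover from this have "\<nexists>x. x \<in> peirce (cnj p) \<and> x \<noteq> 0"
      using ex[OF idem_cnj[OF p]] by auto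
    ultimately have "peirce p = {0}" "peirce (cnj p) = {0}"
      using peirce_closed(4) by blast+
    then show False
      using card_peirce_product[OF p] one_less_power[OF q_gt_1, of 6] by simp
  qed
  then obtain x y where x: "x \<in> peirce p" "x \<noteq> 0" and y: "y \<in> peirce (cnj p)" "y \<noteq> 0"
    using ex[OF p] by blast
  have le: "card (peirce p) \<le> q ^ 3" "card (peirce (cnj p)) \<le> q ^ 3"
    using card_peirce_kernel(2)[OF p x] card_peirce_kernel(2)[OF idem_cnj[OF p] y] by auto
  show ?thesis
  proof (rule ccontr)
    assume "card (peirce p) \<noteq> q ^ 3"
    then have "card (peirce p) < q ^ 3"
      using le by simp
    then have "card (peirce p) * card (peirce (cnj p)) < q ^ 3 * q ^ 3"
      using le(2) q_gt_1 by (intro mult_less_le_imp_less) (auto simp: card_gt_0_iff intro: peirce_closed)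
    then show False
      using card_peirce_product[OF p] by (simp flip: power_add)
  qed
qed

text \<open>A quadratic form in three variables over a finite field is isotropic. The variables are the
  coefficients of \<open>\<e>\<close> and of two further vectors \<open>v\<close>, \<open>w\<close> with \<open>\<e>\<close>, \<open>v\<close>, \<open>w\<close> mutually orthogonal;
  in characteristic 2 also \<open>\<e>\<close> is orthogonal to itself, so that independence is ensured by
  counting and not by orthogonality.\<close>

lemma isotropic_exists: "\<exists>x. x \<noteq> 0 \<and> N x = 0"
proof -
  have large: "q ^ 6 \<le> card {x. \<langle>x, \<e>\<rangle> = 0 \<and> \<langle>x, w\<rangle> = 0}" for w
  proof -
    let ?A = "{x \<in> UNIV. \<langle>x, \<e>\<rangle> = 0}"
    have "q ^ 8 \<le> q * card ?A"
      using card_functional_zero[of UNIV "\<lambda>x. \<langle>x, \<e>\<rangle>"] by (simp add: card_octonions inn_simps)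
    also have "card ?A \<le> q * card {x \<in> ?A. \<langle>x, w\<rangle> = 0}"
      using card_functional_zero[of ?A "\<lambda>x. \<langle>x, w\<rangle>"] by (simp add: inn_simps)
    finally have "q ^ 8 \<le> q * (q * card {x \<in> ?A. \<langle>x, w\<rangle> = 0})"
      by simp
    then show ?thesis
      using q_gt_1 by (simp add: eval_nat_numeral)
  qed
  have small: "card (range (\<lambda>(r, s). r *s \<e> + s *s w)) < q ^ 6" for w
  proof -
    have "card (range (\<lambda>(r, s). r *s \<e> + s *s w)) \<le> card (UNIV :: ('f \<times> 'f) set)"
      by (rule card_image_le) simp
    also have "\<dots> = q ^ 2"
      by (simp add: card_cartesian_product power2_eq_square flip: UNIV_Times_UNIV)
    also have "\<dots> < q ^ 6"
      using q_gt_1 by (intro power_strict_increasing) auto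
    finally show ?thesis .
  qed
  have ex: "\<exists>x. \<langle>x, \<e>\<rangle> = 0 \<and> \<langle>x, w\<rangle> = 0 \<and> x \<notin> range (\<lambda>(r, s). r *s \<e> + s *s w)" for w
  proof (rule ccontr)
    assume "\<not> ?thesis"
    then have "{x. \<langle>x, \<e>\<rangle> = 0 \<and> \<langle>x, w\<rangle> = 0} \<subseteq> range (\<lambda>(r, s). r *s \<e> + s *s w)"
      by blast
    then have "card {x. \<langle>x, \<e>\<rangle> = 0 \<and> \<langle>x, w\<rangle> = 0} \<le> card (range (\<lambda>(r, s). r *s \<e> + s *s w))"
      by (intro card_mono) auto
    then show False
      using large[of w] small[of w] by linarith
  qed
  obtain w where w: "\<langle>w, \<e>\<rangle> = 0" "w \<notin> range (\<lambda>(r, s). r *s \<e> + s *s 0)"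
    using ex[of 0] by blast
  then have "w \<noteq> 0"
    by (metis (mono_tags, lifting) case_prod_conv rangeI scale_zero_left scale_zero_right add_0)
  obtain v where v: "\<langle>v, \<e>\<rangle> = 0" "\<langle>v, w\<rangle> = 0" "v \<notin> range (\<lambda>(r, s). r *s \<e> + s *s w)"
    using ex[of w] by blast
  show ?thesis
  proof (cases "N w = 0")
    case True
    then show ?thesis using \<open>w \<noteq> 0\<close> by blast
  next
    case False
    \<comment> \<open>Solve \<open>r^2 = - N v - s^2 * N w\<close>: both sides take more than half of all values.\<close>
    let ?S = "range (\<lambda>r :: 'f. r ^ 2)"
    let ?g = "\<lambda>x. - N v - x * N w"
    have "card (?g ` ?S) = card ?S"
      using False by (intro card_image) (auto simp: inj_on_def)
    have "?S \<inter> ?g ` ?S \<noteq> {}"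
    proof
      assume "?S \<inter> ?g ` ?S = {}"
      then have "card ?S + card (?g ` ?S) = card (?S \<union> ?g ` ?S)"
        by (intro card_Un_disjoint[symmetric]) auto
      also have "\<dots> \<le> card (UNIV :: 'f set)"
        by (intro card_mono) auto
      finally show False
        using card_squares[where 'f = 'f] \<open>card (?g ` ?S) = card ?S\<close> by linarith
    qed
    then obtain r s where rs: "r ^ 2 = - N v - s ^ 2 * N w"
      by blast
    have "N (v + (r *s \<e> + s *s w)) = 0"
      using rs v w by (simp add: N_add inn_simps norm_scale inn_commute[of \<e> w])
    moreover have "v + (r *s \<e> + s *s w) \<noteq> 0"
    proof
      assume "v + (r *s \<e> + s *s w) = 0"
      then have "v = (- r) *s \<e> + (- s) *s w"
        by (simp add: add_eq_0_iff2)
      then show False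
        using v(3) by (metis (mono_tags, lifting) case_prod_conv rangeI)
    qed
    ultimately show ?thesis by blast
  qed
qed

text \<open>The trace of \<open>x \<odot> cnj y\<close> is \<open>\<langle>x, y\<rangle>\<close>, while its norm vanishes with that of \<open>x\<close>.\<close>

lemma idem_exists: "\<exists>p. idem p"
proof -
  obtain x where x: "x \<noteq> 0" "N x = 0"
    using isotropic_exists by blast
  then obtain y where y: "\<langle>x, y\<rangle> \<noteq> 0"
    using polar_nondegenerate by blast
  have "idem (x \<odot> cnj (inverse \<langle>x, y\<rangle> *s y))"
    using x y by (simp add: idem_def norm_mult T_mult inn_simps)
  then show ?thesis ..
qed

lemma N_surj: "\<exists>x. N x = t"
proof -
  obtain p where p: "idem p"
    using idem_exists by blast
  then have "N (p + t *s cnj p) = t"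
    using T_mult[of p p] by (simp add: N_add norm_scale inn_simps idem_mult idem_def)
  then show ?thesis ..
qed

text \<open>If the trace of \<open>x\<close> is not 0, then \<open>x\<close> is a multiple of an idempotent \<open>p\<close> and the kernel is
  the sum of \<open>peirce (cnj p)\<close> and the line through \<open>cnj p\<close>.\<close>

lemma card_kernel_isotropic:
  assumes "N x = 0" "x \<noteq> 0"
  shows "card {y. x \<odot> y = 0} = q ^ 4"
proof (cases "T x = 0")
  case False
  define p where "p = inverse (T x) *s x"
  have p: "idem p"
    using assms False by (simp add: idem_def p_def norm_scale T_simps)
  have "{y. x \<odot> y = 0} = {y. p \<odot> y = 0}"
    using False by (simp add: p_def mult_simps)
  also have "\<dots> = peirce_sum p ` ({0} \<times> UNIV \<times> {0} \<times> peirce (cnj p))"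
  proof
    have mult: "p \<odot> peirce_sum p (a, b, y, w) = peirce_sum p (a, 0, y, 0)"
      if "y \<in> peirce p" "w \<in> peirce (cnj p)" for a b y w
      using peirceD[OF p that(1)] peirceD[OF idem_cnj[OF p] that(2)]
      by (simp add: peirce_sum_def mult_simps idem_mult[OF p])
    show "peirce_sum p ` ({0} \<times> UNIV \<times> {0} \<times> peirce (cnj p)) \<subseteq> {y. p \<odot> y = 0}"
      using peirce_closed(4) by (auto simp: mult) (simp add: peirce_sum_def)
    show "{y. p \<odot> y = 0} \<subseteq> peirce_sum p ` ({0} \<times> UNIV \<times> {0} \<times> peirce (cnj p))"
    proof clarify
      fix z assume z: "p \<odot> z = 0"
      obtain a b y w where y: "y \<in> peirce p" and w: "w \<in> peirce (cnj p)"
        and zz: "z = peirce_sum p (a, b, y, w)"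
        by (rule peirce_sum_surj[OF p, of z])
      have "peirce_sum p (a, 0, y, 0) = peirce_sum p (0, 0, 0, 0)"
        using z mult[OF y w] zz by (simp add: peirce_sum_def)
      then have "(a, 0 :: 'f, y, 0 :: 'o) = (0, 0, 0, 0)"
        using y by (intro inj_onD[OF peirce_sum_inj[OF p]]) (auto simp: peirce_closed)
      then show "z \<in> peirce_sum p ` ({0} \<times> UNIV \<times> {0} \<times> peirce (cnj p))"
        using w by (auto simp: zz)
    qed
  qed
  finally have "{y. x \<odot> y = 0} = peirce_sum p ` ({0} \<times> UNIV \<times> {0} \<times> peirce (cnj p))" .
  moreover have "inj_on (peirce_sum p) ({0} \<times> UNIV \<times> {0} \<times> peirce (cnj p))"
    by (rule inj_on_subset[OF peirce_sum_inj[OF p]]) (auto simp: peirce_closed)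
  ultimately have "card {y. x \<odot> y = 0} = q * card (peirce (cnj p))"
    by (simp add: card_image card_cartesian_product)
  then show ?thesis
    by (simp add: card_peirce[OF idem_cnj[OF p]] flip: power_Suc)
qed (use assms card_kernel_nilpotent in auto)

lemma card_kernel_isotropic_right:
  assumes "N x = 0" "x \<noteq> 0"
  shows "card {y. y \<odot> x = 0} = q ^ 4"
proof -
  have iff: "y \<odot> x = 0 \<longleftrightarrow> cnj x \<odot> cnj y = 0" for y
    by (metis cnj_mult_rev cnj_cnj cnj_simps(5))
  have "cnj x \<noteq> 0"
    using assms(2) by (metis cnj_cnj cnj_simps(5))
  have "bij_betw cnj {y. y \<odot> x = 0} {y. cnj x \<odot> y = 0}"
    by (rule bij_betw_byWitness[where f' = cnj]) (auto simp: iff)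
  then show ?thesis
    using card_kernel_isotropic[of "cnj x"] assms(1) \<open>cnj x \<noteq> 0\<close> by (simp add: bij_betw_same_card)
qed

section \<open>Frames and Zorn coordinates\<close>

text \<open>The form \<open>T ((u \<odot> v) \<odot> w)\<close> is alternating on the 3-dimensional Peirce space, so a frame consists of an
  idempotent and a unimodular basis of its Peirce space.\<close>

definition frame :: "'o \<Rightarrow> 'o \<Rightarrow> 'o \<Rightarrow> 'o \<Rightarrow> bool" where
  "frame p u v w \<longleftrightarrow> idem p \<and> u \<in> peirce p \<and> v \<in> peirce p \<and> w \<in> peirce p \<and> T ((u \<odot> v) \<odot> w) = 1"

lemma card_frames_idem:
  assumes p: "idem p"
  shows "card {(u, v, w). frame p u v w} = (q ^ 3 - 1) * ((q ^ 3 - q) * q ^ 2)"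
proof -
  have W: "card {w \<in> peirce p. T (x \<odot> w) = 1} = q ^ 2" if x: "x \<in> peirce (cnj p)" "x \<noteq> 0" for x
  proof -
    obtain w where "w \<in> peirce p" "T (x \<odot> w) = 1"
      using peirce_pairing[OF idem_cnj[OF p] x] by auto
    then have "q * card {w \<in> peirce p. T (x \<odot> w) = 1} = q ^ 3"
      using card_functional_fibre[of "peirce p" "\<lambda>w. T (x \<odot> w)" w 1]
      by (simp add: peirce_closed mult_simps T_simps card_peirce[OF p])
    then show ?thesis
      using q_gt_1 by (simp add: eval_nat_numeral)
  qed
  have K: "card {v \<in> peirce p. u \<odot> v \<noteq> 0} = q ^ 3 - q" if u: "u \<in> peirce p" "u \<noteq> 0" for u
  proof -
    have "card {v \<in> peirce p. u \<odot> v = 0} * q ^ 3 = q * q ^ 3"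
      using card_peirce_kernel(1)[OF p u] card_peirce[OF idem_cnj[OF p]] by (simp flip: power_Suc)
    then have "card {v \<in> peirce p. u \<odot> v = 0} = q"
      using q_gt_1 by simp
    moreover have "{v \<in> peirce p. u \<odot> v \<noteq> 0} = peirce p - {v \<in> peirce p. u \<odot> v = 0}"
      by blast
    ultimately show ?thesis
      by (simp add: card_Diff_subset card_peirce[OF p])
  qed
  have "{(u, v, w). frame p u v w} =
    (SIGMA u:peirce p - {0}. SIGMA v:{v \<in> peirce p. u \<odot> v \<noteq> 0}. {w \<in> peirce p. T ((u \<odot> v) \<odot> w) = 1})"
    using p by (auto simp: frame_def mult_simps T_simps)
  also have "card \<dots> = card (peirce p - {0}) * ((q ^ 3 - q) * q ^ 2)"
  proof (rule card_Sigma_const)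
    fix u assume "u \<in> peirce p - {0}"
    then have u: "u \<in> peirce p" "u \<noteq> 0" by auto
    show "finite (SIGMA v:{v \<in> peirce p. u \<odot> v \<noteq> 0}. {w \<in> peirce p. T ((u \<odot> v) \<odot> w) = 1})"
      by (intro finite_SigmaI) auto
    show "card (SIGMA v:{v \<in> peirce p. u \<odot> v \<noteq> 0}. {w \<in> peirce p. T ((u \<odot> v) \<odot> w) = 1}) =
      (q ^ 3 - q) * q ^ 2"
    proof (subst card_Sigma_const[where k = "q ^ 2"])
      show "card {w \<in> peirce p. T ((u \<odot> v) \<odot> w) = 1} = q ^ 2" if "v \<in> {v \<in> peirce p. u \<odot> v \<noteq> 0}" for v
        using that by (intro W peirce_mult[OF p u(1)]) auto
    qed (simp_all add: K[OF u])
  qed auto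
  also have "\<dots> = (q ^ 3 - 1) * ((q ^ 3 - q) * q ^ 2)"
    by (simp add: card_Diff_singleton peirce_closed card_peirce[OF p])
  finally show ?thesis .
qed

lemma frame_exists: "\<exists>p u v w. frame p u v w"
proof -
  obtain p where p: "idem p"
    using idem_exists by blast
  have "1 < q ^ 3" "q ^ 1 < q ^ 3"
    using q_gt_1 one_less_power[OF q_gt_1, of 3] power_strict_increasing[of 1 3 q] by auto
  then have "card {(u, v, w). frame p u v w} \<noteq> 0"
    using q_gt_1 by (simp add: card_frames_idem[OF p])
  then have "{(u, v, w). frame p u v w} \<noteq> {}"
    by (metis card.empty)
  then show ?thesis
    by auto
qed

lemma frame_cycle: "frame p u v w \<Longrightarrow> frame p v w u"
  unfolding frame_def by (metis T_mult_cycle)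

lemma T_triple_zero:
  assumes p: "idem p" and x: "x \<in> peirce p" and y: "y \<in> peirce p"
  shows "T (x \<odot> (x \<odot> y)) = 0" "T (x \<odot> (y \<odot> x)) = 0" "T ((x \<odot> y) \<odot> x) = 0" "T ((y \<odot> x) \<odot> x) = 0"
proof -
  show *: "T (x \<odot> (x \<odot> y)) = 0"
    using peirceD(10)[OF p x] by (simp add: T_mult_assoc mult_simps T_simps)
  then show **: "T (x \<odot> (y \<odot> x)) = 0"
    using peirce_mult_anticommute[OF p x y] by (simp add: mult_simps T_simps)
  from * ** show "T ((x \<odot> y) \<odot> x) = 0" "T ((y \<odot> x) \<odot> x) = 0"
    using T_mult_commute[of "x \<odot> y" x] T_mult_commute[of "y \<odot> x" x] by simp_all
qed

lemma frame_trace: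
  assumes f: "frame p u v w"
  shows "T (u \<odot> (v \<odot> w)) = 1" "T ((v \<odot> w) \<odot> u) = 1"
  using f T_mult_assoc[of u v w] T_mult_commute[of u "v \<odot> w"] by (auto simp: frame_def)

text \<open>In Zorn's vector matrices this is the rule that the cross product of two cross products of basis
  vectors is again a basis vector, up to sign.\<close>

lemma frame_mult_opposite:
  assumes f: "frame p u v w"
  shows "(v \<odot> w) \<odot> (w \<odot> u) = - w"
proof -
  have p: "idem p" and u: "u \<in> peirce p" and v: "v \<in> peirce p" and w: "w \<in> peirce p"
    using f by (auto simp: frame_def)
  let ?U = "v \<odot> w"
  have U: "?U \<in> peirce (cnj p)"
    by (rule peirce_mult[OF p v w])
  have Uu: "?U \<odot> u = cnj p"
    using peirce_mult_opposite[OF idem_cnj[OF p] U, of u] u frame_trace(2)[OF f] by (metis cnj_cnj scale_one)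
  have "\<langle>?U, w\<rangle> = 0"
    using T_mult[of ?U w] T_triple_zero[OF p w v] peirceD(7)[OF p w] by (simp add: inn_simps)
  then have "?U \<odot> (w \<odot> u) + w = 0"
    using mult_cnj_add[of ?U "cnj w" u] peirceD[OF p w] peirceD(7)[OF idem_cnj[OF p] U] Uu
    by (simp add: mult_simps inn_simps cnj_simps)
  then show ?thesis
    by (simp add: eq_neg_iff_add_eq_0)
qed

type_synonym 'a zorn_coords = "((('a \<times> 'a) \<times> 'a \<times> 'a) \<times> 'a \<times> 'a) \<times> 'a \<times> 'a"

text \<open>Zorn's vector matrices with diagonal \<open>(a, b)\<close> and off-diagonal vectors \<open>(x, y, z)\<close> and
  \<open>(x', y', z')\<close>. The coordinates are grouped as \<open>(a, b)\<close>, \<open>(x, x')\<close>, \<open>(y, y')\<close>, \<open>(z, z')\<close>: the norm is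
  \<open>a b - x x' - y y' - z z'\<close>, one hyperbolic plane for each pair, and the nesting to the left
  is the one in which \<open>card_hyperbolic_extension\<close> adds these planes.\<close>

definition zorn :: "'o \<Rightarrow> 'o \<Rightarrow> 'o \<Rightarrow> 'o \<Rightarrow> 'f zorn_coords \<Rightarrow> 'o" where
  "zorn p u v w = (\<lambda>((((a, b), x, x'), y, y'), z, z').
     a *s p + b *s cnj p + x *s u + y *s v + z *s w
       + x' *s (v \<odot> w) + y' *s (w \<odot> u) + z' *s (u \<odot> v))"

definition zorn_norm :: "'f zorn_coords \<Rightarrow> 'f" where
  "zorn_norm = (\<lambda>((((a, b), x, x'), y, y'), z, z'). a * b - x * x' - y * y' - z * z')"

definition zorn_mult :: "'f zorn_coords \<Rightarrow> 'f zorn_coords \<Rightarrow> 'f zorn_coords" where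
  "zorn_mult = (\<lambda>((((a, b), x, x'), y, y'), z, z') ((((c, d), r, r'), s, s'), t, t').
     ((((a * c + x * r' + y * s' + z * t', b * d + x' * r + y' * s + z' * t),
        a * r + x * d - (y' * t' - z' * s'), b * r' + x' * c + (y * t - z * s)),
        a * s + y * d - (z' * r' - x' * t'), b * s' + y' * c + (z * r - x * t)),
        a * t + z * d - (x' * s' - y' * r'), b * t' + z' * c + (x * s - y * r)))"

lemma zorn_table:
  assumes f: "frame p u v w"
  defines "U \<equiv> v \<odot> w" and "V \<equiv> w \<odot> u" and "W \<equiv> u \<odot> v"
  shows "p \<odot> p = p" "p \<odot> cnj p = 0" "cnj p \<odot> p = 0" "cnj p \<odot> cnj p = cnj p"
    "p \<odot> u = u" "p \<odot> v = v" "p \<odot> w = w" "u \<odot> p = 0" "v \<odot> p = 0" "w \<odot> p = 0"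
    "cnj p \<odot> u = 0" "cnj p \<odot> v = 0" "cnj p \<odot> w = 0" "u \<odot> cnj p = u" "v \<odot> cnj p = v" "w \<odot> cnj p = w"
    "p \<odot> U = 0" "p \<odot> V = 0" "p \<odot> W = 0" "U \<odot> p = U" "V \<odot> p = V" "W \<odot> p = W"
    "cnj p \<odot> U = U" "cnj p \<odot> V = V" "cnj p \<odot> W = W" "U \<odot> cnj p = 0" "V \<odot> cnj p = 0" "W \<odot> cnj p = 0"
    "u \<odot> u = 0" "v \<odot> v = 0" "w \<odot> w = 0" "U \<odot> U = 0" "V \<odot> V = 0" "W \<odot> W = 0"
    "w \<odot> v = - U" "u \<odot> w = - V" "v \<odot> u = - W"
    "V \<odot> W = - u" "W \<odot> V = u" "W \<odot> U = - v" "U \<odot> W = v" "U \<odot> V = - w" "V \<odot> U = w"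
    "u \<odot> U = p" "v \<odot> V = p" "w \<odot> W = p" "U \<odot> u = cnj p" "V \<odot> v = cnj p" "W \<odot> w = cnj p"
    "u \<odot> V = 0" "u \<odot> W = 0" "v \<odot> U = 0" "v \<odot> W = 0" "w \<odot> U = 0" "w \<odot> V = 0"
    "V \<odot> u = 0" "W \<odot> u = 0" "U \<odot> v = 0" "W \<odot> v = 0" "U \<odot> w = 0" "V \<odot> w = 0"
proof -
  have p: "idem p" and u: "u \<in> peirce p" and v: "v \<in> peirce p" and w: "w \<in> peirce p"
    using f by (auto simp: frame_def)
  note p' = idem_cnj[OF p]
  have U: "U \<in> peirce (cnj p)" and V: "V \<in> peirce (cnj p)" and W: "W \<in> peirce (cnj p)"
    using peirce_mult[OF p] u v w by (auto simp: U_def V_def W_def)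
  show "p \<odot> p = p" "p \<odot> cnj p = 0" "cnj p \<odot> p = 0" "cnj p \<odot> cnj p = cnj p"
    by (simp_all add: idem_mult[OF p])
  show "p \<odot> u = u" "p \<odot> v = v" "p \<odot> w = w" "u \<odot> p = 0" "v \<odot> p = 0" "w \<odot> p = 0"
    "cnj p \<odot> u = 0" "cnj p \<odot> v = 0" "cnj p \<odot> w = 0" "u \<odot> cnj p = u" "v \<odot> cnj p = v" "w \<odot> cnj p = w"
    "u \<odot> u = 0" "v \<odot> v = 0" "w \<odot> w = 0"
    using peirceD[OF p u] peirceD[OF p v] peirceD[OF p w] by simp_all
  show "p \<odot> U = 0" "p \<odot> V = 0" "p \<odot> W = 0" "U \<odot> p = U" "V \<odot> p = V" "W \<odot> p = W"
    "cnj p \<odot> U = U" "cnj p \<odot> V = V" "cnj p \<odot> W = W" "U \<odot> cnj p = 0" "V \<odot> cnj p = 0" "W \<odot> cnj p = 0"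
    "U \<odot> U = 0" "V \<odot> V = 0" "W \<odot> W = 0"
    using peirceD[OF p' U] peirceD[OF p' V] peirceD[OF p' W] by simp_all
  show "w \<odot> v = - U" "u \<odot> w = - V" "v \<odot> u = - W"
    unfolding U_def V_def W_def by (rule peirce_mult_anticommute[OF p]; fact)+
  show *: "V \<odot> W = - u" "W \<odot> U = - v" "U \<odot> V = - w"
    unfolding U_def V_def W_def
    using frame_mult_opposite f frame_cycle[OF f] frame_cycle[OF frame_cycle[OF f]] by auto
  show "W \<odot> V = u" "U \<odot> W = v" "V \<odot> U = w"
    using peirce_mult_anticommute[OF p' V W] peirce_mult_anticommute[OF p' W U]
      peirce_mult_anticommute[OF p' U V] * by simp_all
  note f' = frame_cycle[OF f]
  note f'' = frame_cycle[OF f']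
  show "u \<odot> U = p"
    using frame_trace(1)[OF f] by (subst peirce_mult_opposite[OF p u U]) (simp add: U_def)
  show "U \<odot> u = cnj p"
    using frame_trace(2)[OF f] u by (subst peirce_mult_opposite[OF p' U]) (simp_all add: U_def)
  show "v \<odot> V = p"
    using frame_trace(1)[OF f'] by (subst peirce_mult_opposite[OF p v V]) (simp add: V_def)
  show "V \<odot> v = cnj p"
    using frame_trace(2)[OF f'] v by (subst peirce_mult_opposite[OF p' V]) (simp_all add: V_def)
  show "w \<odot> W = p"
    using frame_trace(1)[OF f''] by (subst peirce_mult_opposite[OF p w W]) (simp add: W_def)
  show "W \<odot> w = cnj p"
    using frame_trace(2)[OF f''] w by (subst peirce_mult_opposite[OF p' W]) (simp_all add: W_def)
  show "u \<odot> V = 0"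
    using u v w by (subst peirce_mult_opposite[OF p u V]) (simp add: V_def T_triple_zero[OF p])
  show "V \<odot> u = 0"
    using u v w by (subst peirce_mult_opposite[OF p' V]) (simp_all add: V_def T_triple_zero[OF p])
  show "u \<odot> W = 0"
    using u v w by (subst peirce_mult_opposite[OF p u W]) (simp add: W_def T_triple_zero[OF p])
  show "W \<odot> u = 0"
    using u v w by (subst peirce_mult_opposite[OF p' W]) (simp_all add: W_def T_triple_zero[OF p])
  show "v \<odot> U = 0"
    using u v w by (subst peirce_mult_opposite[OF p v U]) (simp add: U_def T_triple_zero[OF p])
  show "U \<odot> v = 0"
    using u v w by (subst peirce_mult_opposite[OF p' U]) (simp_all add: U_def T_triple_zero[OF p])
  show "v \<odot> W = 0"
    using u v w by (subst peirce_mult_opposite[OF p v W]) (simp add: W_def T_triple_zero[OF p])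
  show "W \<odot> v = 0"
    using u v w by (subst peirce_mult_opposite[OF p' W]) (simp_all add: W_def T_triple_zero[OF p])
  show "w \<odot> U = 0"
    using u v w by (subst peirce_mult_opposite[OF p w U]) (simp add: U_def T_triple_zero[OF p])
  show "U \<odot> w = 0"
    using u v w by (subst peirce_mult_opposite[OF p' U]) (simp_all add: U_def T_triple_zero[OF p])
  show "w \<odot> V = 0"
    using u v w by (subst peirce_mult_opposite[OF p w V]) (simp add: V_def T_triple_zero[OF p])
  show "V \<odot> w = 0"
    using u v w by (subst peirce_mult_opposite[OF p' V]) (simp_all add: V_def T_triple_zero[OF p])
qed

lemma zorn_mult:
  assumes f: "frame p u v w"
  shows "zorn p u v w c \<odot> zorn p u v w d = zorn p u v w (zorn_mult c d)"
proof -
  define U V W where "U = v \<odot> w" and "V = w \<odot> u" and "W = u \<odot> v"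
  obtain a b x x' y y' z z' where c: "c = ((((a, b), x, x'), y, y'), z, z')"
    by (cases c) auto
  obtain e g r r' s s' t t' where d: "d = ((((e, g), r, r'), s, s'), t, t')"
    by (cases d) auto
  note tab = zorn_table[OF f, folded U_def V_def W_def]
  have 1: "zorn p u v w c = a *s p + b *s cnj p + x *s u + y *s v + z *s w + x' *s U + y' *s V + z' *s W"
    by (simp add: c zorn_def U_def V_def W_def)
  have 2: "zorn p u v w d = e *s p + g *s cnj p + r *s u + s *s v + t *s w + r' *s U + s' *s V + t' *s W"
    by (simp add: d zorn_def U_def V_def W_def)
  have 3: "zorn p u v w (zorn_mult c d) = 
    (a * e + x * r' + y * s' + z * t') *s p + (b * g + x' * r + y' * s + z' * t) *s cnj p
    + (a * r + x * g - (y' * t' - z' * s')) *s u + (a * s + y * g - (z' * r' - x' * t')) *s v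
    + (a * t + z * g - (x' * s' - y' * r')) *s w + (b * r' + x' * e + (y * t - z * s)) *s U
    + (b * s' + y' * e + (z * r - x * t)) *s V + (b * t' + z' * e + (x * s - y * r)) *s W"
    unfolding c d zorn_def zorn_mult_def U_def V_def W_def by (simp only: prod.case)
  show ?thesis
    unfolding 1 2 3
    by (simp only: mult_simps,
        simp only: tab U_def[symmetric] V_def[symmetric] W_def[symmetric],
        simp only: scale_zero_right add_0_left add_0_right scale_scale scale_minus_right minus_zero,
        simp only: scale_scale scale_minus_right scale_left_distrib scale_right_distrib diff_conv_add_uminus minus_add_distrib scale_minus_left minus_minus mult.commute,
        simp only: add_ac)
qed

lemma zorn_inn:
  assumes f: "frame p u v w"
  defines "U \<equiv> v \<odot> w" and "V \<equiv> w \<odot> u" and "W \<equiv> u \<odot> v"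
  shows "N p = 0" "N (cnj p) = 0" "N u = 0" "N v = 0" "N w = 0" "N U = 0" "N V = 0" "N W = 0"
    "\<langle>p, cnj p\<rangle> = 1" "\<langle>p, u\<rangle> = 0" "\<langle>p, v\<rangle> = 0" "\<langle>p, w\<rangle> = 0" "\<langle>p, U\<rangle> = 0" "\<langle>p, V\<rangle> = 0" "\<langle>p, W\<rangle> = 0"
    "\<langle>cnj p, u\<rangle> = 0" "\<langle>cnj p, v\<rangle> = 0" "\<langle>cnj p, w\<rangle> = 0" "\<langle>cnj p, U\<rangle> = 0" "\<langle>cnj p, V\<rangle> = 0" "\<langle>cnj p, W\<rangle> = 0"
    "\<langle>u, v\<rangle> = 0" "\<langle>u, w\<rangle> = 0" "\<langle>v, w\<rangle> = 0" "\<langle>U, V\<rangle> = 0" "\<langle>U, W\<rangle> = 0" "\<langle>V, W\<rangle> = 0"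
    "\<langle>u, U\<rangle> = - 1" "\<langle>v, V\<rangle> = - 1" "\<langle>w, W\<rangle> = - 1"
    "\<langle>u, V\<rangle> = 0" "\<langle>u, W\<rangle> = 0" "\<langle>v, U\<rangle> = 0" "\<langle>v, W\<rangle> = 0" "\<langle>w, U\<rangle> = 0" "\<langle>w, V\<rangle> = 0"
proof -
  have p: "idem p" and u: "u \<in> peirce p" and v: "v \<in> peirce p" and w: "w \<in> peirce p"
    using f by (auto simp: frame_def)
  note p' = idem_cnj[OF p]
  have U: "U \<in> peirce (cnj p)" and V: "V \<in> peirce (cnj p)" and W: "W \<in> peirce (cnj p)"
    using peirce_mult[OF p] u v w by (auto simp: U_def V_def W_def)
  note tab = zorn_table[OF f, folded U_def V_def W_def]
  show "N p = 0" "N (cnj p) = 0" "N u = 0" "N v = 0" "N w = 0" "N U = 0" "N V = 0" "N W = 0"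
    using p u v w U V W peirceD(6)[OF p] peirceD(6)[OF p'] by (simp_all add: idem_def)
  show "\<langle>p, cnj p\<rangle> = 1"
    using T_mult[of p p] p by (simp add: idem_mult[OF p] idem_def)
  show "\<langle>p, u\<rangle> = 0" "\<langle>p, v\<rangle> = 0" "\<langle>p, w\<rangle> = 0" "\<langle>p, U\<rangle> = 0" "\<langle>p, V\<rangle> = 0" "\<langle>p, W\<rangle> = 0"
    "\<langle>cnj p, u\<rangle> = 0" "\<langle>cnj p, v\<rangle> = 0" "\<langle>cnj p, w\<rangle> = 0" "\<langle>cnj p, U\<rangle> = 0" "\<langle>cnj p, V\<rangle> = 0" "\<langle>cnj p, W\<rangle> = 0"
    using peirceD(8,9)[OF p] peirceD(8,9)[OF p'] u v w U V W by (auto simp: inn_commute[of p] inn_commute[of "cnj p"])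
  show "\<langle>u, v\<rangle> = 0" "\<langle>u, w\<rangle> = 0" "\<langle>v, w\<rangle> = 0" "\<langle>U, V\<rangle> = 0" "\<langle>U, W\<rangle> = 0" "\<langle>V, W\<rangle> = 0"
    using peirce_inn[OF p] peirce_inn[OF p'] u v w U V W by auto
  have inn: "\<langle>x, y\<rangle> = - T (x \<odot> y)" if "y \<in> peirce (cnj p)" for x y
    using peirceD(7)[OF p' that] by (simp add: T_mult inn_simps)
  show "\<langle>u, U\<rangle> = - 1" "\<langle>v, V\<rangle> = - 1" "\<langle>w, W\<rangle> = - 1"
    "\<langle>u, V\<rangle> = 0" "\<langle>u, W\<rangle> = 0" "\<langle>v, U\<rangle> = 0" "\<langle>v, W\<rangle> = 0" "\<langle>w, U\<rangle> = 0" "\<langle>w, V\<rangle> = 0"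
    using p by (simp_all add: inn[OF U] inn[OF V] inn[OF W] tab T_simps idem_def)
qed

lemma N_zorn:
  assumes f: "frame p u v w"
  shows "N (zorn p u v w c) = zorn_norm c"
proof -
  obtain a b x x' y y' z z' where c: "c = ((((a, b), x, x'), y, y'), z, z')"
    by (cases c) auto
  show ?thesis
    unfolding zorn_def zorn_norm_def c prod.case
    by (simp add: N_add inn_simps norm_scale zorn_inn[OF f])
qed

text \<open>The basis vectors form a hyperbolic basis, so inner products with them recover the coordinates.
  Surjectivity follows by counting.\<close>

lemma zorn_bij:
  assumes f: "frame p u v w"
  shows "bij (zorn p u v w)"
proof -
  note inn = zorn_inn[OF f]
  define C where "C z = ((((\<langle>z, cnj p\<rangle>, \<langle>z, p\<rangle>), - \<langle>z, v \<odot> w\<rangle>, - \<langle>z, u\<rangle>), - \<langle>z, w \<odot> u\<rangle>, - \<langle>z, v\<rangle>),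
    - \<langle>z, u \<odot> v\<rangle>, - \<langle>z, w\<rangle>)" for z
  have swap: "\<langle>cnj p, p\<rangle> = 1" "\<langle>v \<odot> w, u\<rangle> = - 1" "\<langle>w \<odot> u, v\<rangle> = - 1" "\<langle>u \<odot> v, w\<rangle> = - 1"
    "\<langle>x, p\<rangle> = \<langle>p, x\<rangle>" "\<langle>u, cnj p\<rangle> = 0" "\<langle>v, cnj p\<rangle> = 0" "\<langle>w, cnj p\<rangle> = 0"
    "\<langle>v \<odot> w, cnj p\<rangle> = 0" "\<langle>w \<odot> u, cnj p\<rangle> = 0" "\<langle>u \<odot> v, cnj p\<rangle> = 0"
    "\<langle>v, u\<rangle> = 0" "\<langle>w, u\<rangle> = 0" "\<langle>w, v\<rangle> = 0"
    "\<langle>w \<odot> u, v \<odot> w\<rangle> = 0" "\<langle>u \<odot> v, v \<odot> w\<rangle> = 0" "\<langle>u \<odot> v, w \<odot> u\<rangle> = 0"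
    "\<langle>w \<odot> u, u\<rangle> = 0" "\<langle>u \<odot> v, u\<rangle> = 0" "\<langle>v \<odot> w, v\<rangle> = 0" "\<langle>u \<odot> v, v\<rangle> = 0" "\<langle>v \<odot> w, w\<rangle> = 0" "\<langle>w \<odot> u, w\<rangle> = 0" for x
    using inn by (simp_all add: inn_commute)
  have "C (zorn p u v w c) = c" for c
    unfolding C_def zorn_def
    by (cases c) (auto simp: inn_simps inn swap inn_self)
  then have inj: "inj (zorn p u v w)"
    by (metis injI)
  have "card (UNIV :: 'f zorn_coords set) = q ^ 8"
    by (simp add: card_cartesian_product eval_nat_numeral flip: UNIV_Times_UNIV)
  then have "card (range (zorn p u v w)) = card (UNIV :: 'o set)"
    by (simp add: card_image[OF inj] card_octonions)
  then have "surj (zorn p u v w)"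
    by (intro card_subset_eq) auto
  with inj show ?thesis
    by (simp add: bij_def)
qed

lemma zorn_linear: "zorn p u v w (c + d) = zorn p u v w c + zorn p u v w d"
  by (cases c; cases d) (auto simp: zorn_def scale_left_distrib algebra_simps)

lemma linear_scale_iff:
  "Vector_Spaces.linear scale scale h \<longleftrightarrow> (\<forall>x y. h (x + y) = h x + h y) \<and> (\<forall>r x. h (r *s x) = r *s h x)"
  by (simp add: Vector_Spaces.linear_iff vector_space_axioms)

lemma zorn_scale:
  "zorn p u v w ((((r * a, r * b), r * x, r * x'), r * y, r * y'), r * z, r * z') =
    r *s zorn p u v w ((((a, b), x, x'), y, y'), z, z')"
  by (simp add: zorn_def scale_right_distrib)

lemma T_zorn:
  assumes f: "frame p u v w"
  shows "T (zorn p u v w ((((a, b), x, x'), y, y'), z, z')) = a + b"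
proof -
  have p: "idem p" and u: "u \<in> peirce p" and v: "v \<in> peirce p" and w: "w \<in> peirce p"
    using f by (auto simp: frame_def)
  show ?thesis
    using p peirceD(5)[OF p] peirceD(5)[OF idem_cnj[OF p]] peirce_mult[OF p] u v w
    by (simp add: zorn_def T_simps idem_def)
qed

lemma card_hyperbolic_extension_int:
  fixes f :: "'a \<Rightarrow> 'f"
  assumes "finite S"
  shows "int (card {c \<in> S \<times> UNIV. (case c of (s, a, b) \<Rightarrow> f s - a * b) = t}) =
    int (card S) * (int q - 1) + int q * int (card {s \<in> S. f s = t})"
proof -
  have "{c \<in> S \<times> UNIV. (case c of (s, a, b) \<Rightarrow> f s - a * b) = t} =
    {(s, a, b). s \<in> S \<and> f s - a * b = t}"
    by auto
  then show ?thesis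
    using card_hyperbolic_extension[OF assms, of f t] q_gt_1 by (simp add: of_nat_diff)
qed

text \<open>The restriction of the diagonal to \<open>S\<close> serves to count norms (\<open>S\<close> is everything) and
  idempotents (\<open>S\<close> is the line \<open>a + b = 1\<close>) at the same time.\<close>

lemma card_zorn_norm:
  fixes S :: "('f \<times> 'f) set"
  shows "int (card {c \<in> ((S \<times> UNIV) \<times> UNIV) \<times> UNIV. zorn_norm c = t}) =
    int (card S) * (int q - 1) * (int q ^ 4 + int q ^ 3 + int q ^ 2)
      + int q ^ 3 * int (card {(a, b). (a, b) \<in> S \<and> a * b = t})"
proof -
  define f1 f2 f3 where "f1 = (\<lambda>(a :: 'f, b). a * b)" and "f2 = (\<lambda>(s, a, b). f1 s - a * b)"
    and "f3 = (\<lambda>(s, a, b). f2 s - a * b)"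
  have pairs: "card (UNIV :: ('f \<times> 'f) set) = q ^ 2"
    by (simp add: card_cartesian_product power2_eq_square flip: UNIV_Times_UNIV)
  have fin: "finite (S \<times> (UNIV :: ('f \<times> 'f) set))" "finite ((S \<times> (UNIV :: ('f \<times> 'f) set)) \<times> (UNIV :: ('f \<times> 'f) set))"
    by (auto simp: finite_subset[OF subset_UNIV])
  have "{c \<in> ((S \<times> UNIV) \<times> UNIV) \<times> UNIV. zorn_norm c = t} =
    {c \<in> ((S \<times> UNIV) \<times> UNIV) \<times> UNIV. (case c of (s, a, b) \<Rightarrow> f3 s - a * b) = t}"
    by (auto simp: zorn_norm_def f3_def f2_def f1_def)
  moreover have "{c \<in> (S \<times> UNIV) \<times> UNIV. (case c of (s, a, b) \<Rightarrow> f2 s - a * b) = t} =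
    {c \<in> (S \<times> UNIV) \<times> UNIV. f3 c = t}"
    by (auto simp: f3_def)
  moreover have "{c \<in> S \<times> UNIV. (case c of (s, a, b) \<Rightarrow> f1 s - a * b) = t} = {c \<in> S \<times> UNIV. f2 c = t}"
    by (auto simp: f2_def)
  moreover have "{s \<in> S. f1 s = t} = {(a, b). (a, b) \<in> S \<and> a * b = t}"
    by (auto simp: f1_def)
  ultimately show ?thesis
    using card_hyperbolic_extension_int[OF fin(2), of f3 t] card_hyperbolic_extension_int[OF fin(1), of f2 t]
      card_hyperbolic_extension_int[of S f1 t]
    by (simp add: card_cartesian_product pairs finite_subset[OF subset_UNIV])
      (simp add: algebra_simps eval_nat_numeral)
qed

lemma card_norm_fibre:
  "int (card {x. N x = t}) = (if t = 0 then int q ^ 7 + int q ^ 4 - int q ^ 3 else int q ^ 7 - int q ^ 3)"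
proof -
  obtain p u v w where f: "frame p u v w"
    using frame_exists by blast
  have "bij_betw (zorn p u v w) {c. zorn_norm c = t} {x. N x = t}"
    by (rule bij_betw_Collect[OF zorn_bij[OF f]]) (simp add: N_zorn[OF f])
  then have "int (card {x. N x = t}) = int (card {c. zorn_norm c = t})"
    by (simp add: bij_betw_same_card)
  also have "\<dots> = int (q * q) * (int q - 1) * (int q ^ 4 + int q ^ 3 + int q ^ 2)
      + int q ^ 3 * int (card {(a, b). a * b = t})"
    using card_zorn_norm[of UNIV t] card_cartesian_product[of "UNIV :: 'f set" "UNIV :: 'f set"] by simp
  also have "\<dots> = (if t = 0 then int q ^ 7 + int q ^ 4 - int q ^ 3 else int q ^ 7 - int q ^ 3)"
    using q_gt_1 by (simp add: card_hyperbola of_nat_diff) (simp add: algebra_simps eval_nat_numeral)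
  finally show ?thesis .
qed

lemma card_idem: "int (card {p. idem p}) = int q ^ 6 + int q ^ 3"
proof -
  obtain p u v w where f: "frame p u v w"
    using frame_exists by blast
  let ?S = "{(a, b :: 'f). a + b = 1}"
  have "bij_betw (zorn p u v w) {c. c \<in> ((?S \<times> UNIV) \<times> UNIV) \<times> UNIV \<and> zorn_norm c = 0} {x. idem x}"
    by (rule bij_betw_Collect[OF zorn_bij[OF f]]) (auto simp: idem_def N_zorn[OF f] T_zorn[OF f])
  then have "int (card {x. idem x}) = int (card {c \<in> ((?S \<times> UNIV) \<times> UNIV) \<times> UNIV. zorn_norm c = 0})"
    by (simp add: bij_betw_same_card)
  also have "\<dots> = int (card ?S) * (int q - 1) * (int q ^ 4 + int q ^ 3 + int q ^ 2)
      + int q ^ 3 * int (card {(a, b). (a, b) \<in> ?S \<and> a * b = 0})"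
    by (rule card_zorn_norm)
  also have "?S = (\<lambda>a. (a, 1 - a)) ` UNIV"
    by (auto simp: image_iff algebra_simps)
  also have "card \<dots> = q"
    by (subst card_image) (auto simp: inj_on_def)
  also have "{(a, b). (a, b) \<in> (\<lambda>a. (a, 1 - a)) ` (UNIV :: 'f set) \<and> a * b = 0} = {(0, 1), (1, 0)}"
    by auto
  finally show ?thesis
    by (simp add: algebra_simps eval_nat_numeral)
qed

definition frame_count :: nat where
  "frame_count = (q ^ 6 + q ^ 3) * ((q ^ 3 - 1) * ((q ^ 3 - q) * q ^ 2))"

lemma card_frames: "card {(p, u, v, w). frame p u v w} = frame_count"
proof -
  have "{(p, u, v, w). frame p u v w} = (SIGMA p:{p. idem p}. {(u, v, w). frame p u v w})"
    by (auto simp: frame_def)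
  also have "card \<dots> = card {p. idem p} * ((q ^ 3 - 1) * ((q ^ 3 - q) * q ^ 2))"
  proof (rule card_Sigma_const)
    fix p assume "p \<in> {p. idem p}"
    then show "card {(u, v, w). frame p u v w} = (q ^ 3 - 1) * ((q ^ 3 - q) * q ^ 2)"
      by (intro card_frames_idem) simp
    show "finite {(u, v, w). frame p u v w}"
      by (rule finite_subset[OF subset_UNIV], intro finite_Prod_UNIV finite_octonions)
  qed (rule finite_octonions)
  also have "card {p. idem p} = q ^ 6 + q ^ 3"
  proof -
    have "int (card {p. idem p}) = int (q ^ 6 + q ^ 3)"
      using card_idem by simp
    then show ?thesis
      by (simp only: of_nat_eq_iff)
  qed
  finally show ?thesis
    by (simp only: frame_count_def)
qed

section \<open>Isomorphisms and isotopies of octonion algebras\<close>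

definition isometry :: "('o \<Rightarrow> 'o) \<Rightarrow> bool" where
  "isometry h \<longleftrightarrow> (\<forall>x y. h (x + y) = h x + h y) \<and> (\<forall>r x. h (r *s x) = r *s h x) \<and> (\<forall>x. N (h x) = N x)"

lemma isometryD:
  assumes "isometry h"
  shows "h (x + y) = h x + h y" "h (r *s x) = r *s h x" "N (h x) = N x" "\<langle>h x, h y\<rangle> = \<langle>x, y\<rangle>" "bij h"
    "h (- x) = - h x" "h (x - y) = h x - h y" "h 0 = 0"
proof -
  show *: "h (x + y) = h x + h y" "h (r *s x) = r *s h x" "N (h x) = N x" for x y r
    using assms by (auto simp: isometry_def)
  show inn: "\<langle>h x, h y\<rangle> = \<langle>x, y\<rangle>" for x y
    by (simp add: polar_def * flip: *(1))
  have m: "h (- x) = - h x" for x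
    using *(2)[of "- 1" x] by simp
  then show "h (- x) = - h x" .
  show d: "h (x - y) = h x - h y" for x y
    using *(1)[of x "- y"] m by simp
  show "h 0 = 0"
    using d[of 0 0] by simp
  have "inj h"
  proof (rule injI)
    fix x y assume "h x = h y"
    then show "x = y"
      by (intro inn_eqI) (metis inn)
  qed
  then show "bij h"
    using finite_UNIV_inj_surj[of h] finite_octonions by (auto simp: bij_def)
qed

text \<open>The target is an octonion algebra on the same space and with the same norm; this is the case
  needed for isotopes.\<close>

definition isos :: "('o \<Rightarrow> 'o \<Rightarrow> 'o) \<Rightarrow> ('o \<Rightarrow> 'o) set" where
  "isos mult' = {h. isometry h \<and> (\<forall>x y. h (x \<odot> y) = mult' (h x) (h y))}"

lemma iso_unit:
  assumes "octonion_algebra scale mult' unit' N" "h \<in> isos mult'"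
  shows "h \<e> = unit'"
proof -
  interpret B: octonion_algebra scale mult' unit' N by fact
  have "bij h" and h: "h (x \<odot> y) = mult' (h x) (h y)" for x y
    using assms(2) isometryD by (auto simp: isos_def)
  then obtain z where "unit' = h z"
    by (metis bij_pointE)
  then have "mult' (h \<e>) unit' = unit'"
    using h[of \<e> z] by (simp add: unit_left)
  then show ?thesis
    by (simp add: B.unit_right)
qed

text \<open>Mapping an isomorphism to the image of a fixed frame is a bijection onto the frames of the target,
  since all frames have the same multiplication table.\<close>

lemma card_isos:
  assumes oct: "octonion_algebra scale mult' unit' N"
  shows "card (isos mult') = frame_count"
proof -
  interpret B: octonion_algebra scale mult' unit' N by fact
  interpret B: finite_octonion_algebra scale mult' unit' N q
    by unfold_locales simp
  obtain p u v w where f: "frame p u v w"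
    using frame_exists by blast
  define Z where "Z = zorn p u v w"
  have Z: "bij Z" "N (Z c) = zorn_norm c" "Z c \<odot> Z d = Z (zorn_mult c d)" "Z (c + d) = Z c + Z d" for c d
    by (simp_all add: Z_def zorn_bij[OF f] N_zorn[OF f] zorn_mult[OF f] zorn_linear)
  have inv: "inv_into UNIV Z (Z c) = c" "Z (inv_into UNIV Z x) = x" for c x
    using Z(1) by (simp_all add: bij_is_inj bij_is_surj surj_f_inv_f)
  have inv_Z: "inv_into UNIV Z (x + y) = inv_into UNIV Z x + inv_into UNIV Z y" "inv_into UNIV Z (x \<odot> y) = zorn_mult (inv_into UNIV Z x) (inv_into UNIV Z y)"
    "zorn_norm (inv_into UNIV Z x) = N x" for x y
    by (metis inv Z(4), metis inv Z(3), metis inv(2) Z(2))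
  have frame_val: "p = Z ((((1, 0), 0, 0), 0, 0), 0, 0)" "u = Z ((((0, 0), 1, 0), 0, 0), 0, 0)"
    "v = Z ((((0, 0), 0, 0), 1, 0), 0, 0)" "w = Z ((((0, 0), 0, 0), 0, 0), 1, 0)"
    by (simp_all add: Z_def zorn_def)
  define \<Phi> where "\<Phi> h = (h p, h u, h v, h w)" for h :: "'o \<Rightarrow> 'o"
  define \<Psi> where "\<Psi> = (\<lambda>(p', u', v', w') x. B.zorn p' u' v' w' (inv_into UNIV Z x))"
  have "bij_betw \<Phi> (isos mult') {(p, u, v, w). B.frame p u v w}"
  proof (rule bij_betw_byWitness[where f' = \<Psi>])
    have iso: "h (cnj x) = B.cnj (h x) \<and> B.T (h x) = T x" if "h \<in> isos mult'" for h x
    proof -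
      have h: "isometry h" and e: "h \<e> = unit'"
        using that iso_unit[OF oct] by (auto simp: isos_def)
      have "B.T (h x) = T x"
        by (metis B.T_def T_def e isometryD(4)[OF h])
      then show ?thesis
        by (simp add: B.cnj_def cnj_def isometryD[OF h] e)
    qed
    show "\<forall>h\<in>isos mult'. \<Psi> (\<Phi> h) = h"
    proof
      fix h assume h: "h \<in> isos mult'"
      then have i: "isometry h" and m: "h (x \<odot> y) = mult' (h x) (h y)" for x y
        by (auto simp: isos_def)
      have "B.zorn (h p) (h u) (h v) (h w) c = h (Z c)" for c
        by (cases c) (auto simp: B.zorn_def zorn_def Z_def isometryD[OF i] m iso[OF h])
      then show "\<Psi> (\<Phi> h) = h"
        by (simp add: \<Psi>_def \<Phi>_def inv fun_eq_iff)
    qed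
    show "\<forall>t\<in>{(p, u, v, w). B.frame p u v w}. \<Phi> (\<Psi> t) = t"
      by (auto simp: \<Psi>_def \<Phi>_def frame_val inv) (auto simp: B.zorn_def)
    show "\<Phi> ` isos mult' \<subseteq> {(p, u, v, w). B.frame p u v w}"
    proof clarify
      fix h p' u' v' w' assume h: "h \<in> isos mult'" and eq: "(p', u', v', w') = \<Phi> h"
      then have i: "isometry h" and m: "mult' (h x) (h y) = h (x \<odot> y)" for x y
        by (auto simp: isos_def)
      have "B.frame (h p) (h u) (h v) (h w)"
        using f iso[OF h]
        by (auto simp: B.frame_def frame_def B.idem_def idem_def B.peirce_def peirce_def isometryD[OF i] m)
      then show "B.frame p' u' v' w'"
        using eq by (simp add: \<Phi>_def)
    qed
    show "\<Psi> ` {(p, u, v, w). B.frame p u v w} \<subseteq> isos mult'"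
    proof clarify
      fix p' u' v' w' assume f': "B.frame p' u' v' w'"
      \<comment> \<open>Zorn coordinates have no scalar multiplication, so linearity is checked through the coordinates.\<close>
      have scale: "inv_into UNIV Z (r *s x) = (case inv_into UNIV Z x of ((((a, b), c, c'), y, y'), z, z') \<Rightarrow>
        ((((r * a, r * b), r * c, r * c'), r * y, r * y'), r * z, r * z'))" for r x
      proof -
        obtain a b c c' y y' z z' where c: "inv_into UNIV Z x = ((((a, b), c, c'), y, y'), z, z')"
          by (cases "inv_into UNIV Z x") auto
        then have "r *s x = Z ((((r * a, r * b), r * c, r * c'), r * y, r * y'), r * z, r * z')"
          using inv(2)[of x] by (simp add: Z_def zorn_scale)
        then show ?thesis
          using c by (simp add: inv)
      qed
      have "\<Psi> (p', u', v', w') (r *s x) = r *s \<Psi> (p', u', v', w') x" for r x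
        by (auto simp: \<Psi>_def scale B.zorn_scale split: prod.split)
      then show "\<Psi> (p', u', v', w') \<in> isos mult'"
        by (auto simp: isos_def isometry_def \<Psi>_def inv_Z B.zorn_linear B.zorn_mult[OF f'] B.N_zorn[OF f'])
    qed
  qed
  then have "card (isos mult') = card {(p, u, v, w). B.frame p u v w}"
    by (rule bij_betw_same_card)
  then show ?thesis
    by (simp only: B.card_frames B.frame_count_def frame_count_def)
qed

text \<open>Kaplansky's construction: two elements of norm 1 are used to shift the unit of a composition algebra.\<close>

lemma isotope:
  assumes u: "N u = 1" and v: "N v = 1"
  shows "octonion_algebra scale (\<lambda>x y. (x \<odot> cnj v) \<odot> (cnj u \<odot> y)) (u \<odot> v) N"
proof (intro octonion_algebra.intro octonion_algebra_axioms.intro)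
  show "vector_space (*s)" by (rule vector_space_axioms)
  show "dim (UNIV :: 'o set) = 8" by (rule dim_eq_8)
  show "N (r *s x) = r\<^sup>2 * N x" for r x by (rule norm_scale)
  show "Vector_Spaces.linear (*s) (*) (\<lambda>x. polar N x y)" for y by (rule polar_left)
  show "Vector_Spaces.linear (*s) (*) (\<lambda>y. polar N x y)" for x by (rule polar_right)
  show "(\<And>y. polar N x y = 0) \<Longrightarrow> x = 0" for x by (rule polar_nondegenerate)
  fix x y
  show "Vector_Spaces.linear (*s) (*s) (\<lambda>x. (x \<odot> cnj v) \<odot> (cnj u \<odot> y))"
    "Vector_Spaces.linear (*s) (*s) (\<lambda>y. (x \<odot> cnj v) \<odot> (cnj u \<odot> y))"
    by (simp_all add: linear_scale_iff mult_simps)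
  show "(u \<odot> v \<odot> cnj v) \<odot> (cnj u \<odot> x) = x" "(x \<odot> cnj v) \<odot> (cnj u \<odot> (u \<odot> v)) = x"
    using u v by (simp_all add: mult_cnj_cancel_right mult_cnj_cancel cnj_mult_cancel cnj_mult_cancel_right)
  show "N ((x \<odot> cnj v) \<odot> (cnj u \<odot> y)) = N x * N y"
    using u v by (simp add: norm_mult)
qed

definition isotopies :: "(('o \<Rightarrow> 'o) \<times> ('o \<Rightarrow> 'o) \<times> ('o \<Rightarrow> 'o)) set" where
  "isotopies = {(f, g, h). isometry f \<and> isometry g \<and> isometry h \<and> (\<forall>x y. f x \<odot> g y = h (x \<odot> y))}"

lemma finite_octonion_maps [simp, intro]: "finite (A :: ('o \<Rightarrow> 'o) set)"
proof -
  have "finite (UNIV \<rightarrow>\<^sub>E UNIV :: ('o \<Rightarrow> 'o) set)"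
    by (rule finite_PiE) auto
  then show ?thesis
    by (simp add: finite_subset[OF subset_UNIV])
qed

text \<open>Setting \<open>y = \<e>\<close> and \<open>x = \<e>\<close> in \<open>f x \<odot> g y = h (x \<odot> y)\<close> expresses \<open>f\<close> and \<open>g\<close> by \<open>h\<close>, and the equation
  becomes the multiplicativity of \<open>h\<close> with respect to the isotope.\<close>

lemma card_isotopies_fibre:
  assumes u: "N u = 1" and v: "N v = 1"
  shows "card {s \<in> isotopies. (case s of (f, g, h) \<Rightarrow> (f \<e>, g \<e>)) = (u, v)} = frame_count"
proof -
  let ?m = "\<lambda>x y. (x \<odot> cnj v) \<odot> (cnj u \<odot> y)"
  let ?F = "{s \<in> isotopies. (case s of (f, g, h) \<Rightarrow> (f \<e>, g \<e>)) = (u, v)}"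
  have "bij_betw (\<lambda>(f, g, h). h) ?F (isos ?m)"
  proof (rule bij_betw_byWitness[where f' = "\<lambda>h. (\<lambda>x. h x \<odot> cnj v, \<lambda>y. cnj u \<odot> h y, h)"])
    have comp: "h x \<odot> cnj v = f x" "cnj u \<odot> h y = g y"
      if "(f, g, h) \<in> isotopies" "f \<e> = u" "g \<e> = v" for f g h x y
    proof -
      have "f x \<odot> v = h x" "u \<odot> g y = h y"
        using that unit_left unit_right by (auto simp: isotopies_def)
      then show "h x \<odot> cnj v = f x" "cnj u \<odot> h y = g y"
        using mult_cnj_cancel_right[of "f x" v] cnj_mult_cancel[of u "g y"] u v by simp_all
    qed
    then show "\<forall>s\<in>?F. (\<lambda>h. (\<lambda>x. h x \<odot> cnj v, \<lambda>y. cnj u \<odot> h y, h)) ((\<lambda>(f, g, h). h) s) = s"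
      by auto
    show "(\<lambda>(f, g, h). h) ` ?F \<subseteq> isos ?m"
    proof (rule image_subsetI)
      fix s assume "s \<in> ?F"
      then obtain f g h where fgh: "s = (f, g, h)" and s: "(f, g, h) \<in> isotopies" "f \<e> = u" "g \<e> = v"
        by (cases s) auto
      then show "(case s of (f, g, h) \<Rightarrow> h) \<in> isos ?m"
        using comp[OF s] by (simp add: isos_def isotopies_def)
    qed
    show "(\<lambda>h. (\<lambda>x. h x \<odot> cnj v, \<lambda>y. cnj u \<odot> h y, h)) ` isos ?m \<subseteq> ?F"
    proof (rule image_subsetI)
      fix h assume h: "h \<in> isos ?m"
      then have i: "isometry h" and m: "h (x \<odot> y) = ?m (h x) (h y)" for x y
        by (auto simp: isos_def)
      have e: "h \<e> = u \<odot> v"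
        by (rule iso_unit[OF isotope[OF u v] h])
      have "isometry (\<lambda>x. h x \<odot> cnj v)" "isometry (\<lambda>y. cnj u \<odot> h y)"
        using u v by (simp_all add: isometry_def isometryD[OF i] mult_simps norm_mult)
      moreover have "h \<e> \<odot> cnj v = u" "cnj u \<odot> h \<e> = v"
        using u v by (simp_all add: e mult_cnj_cancel_right cnj_mult_cancel)
      ultimately show "(\<lambda>x. h x \<odot> cnj v, \<lambda>y. cnj u \<odot> h y, h) \<in> ?F"
        using i m by (simp add: isotopies_def)
    qed
  qed auto
  then have "card ?F = card (isos ?m)"
    by (rule bij_betw_same_card)
  then show ?thesis
    by (simp only: card_isos[OF isotope[OF u v]])
qed

lemma card_isotopies: "int (card isotopies) = (int q ^ 7 - int q ^ 3) ^ 2 * int frame_count"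
proof -
  have "card isotopies = card ({u. N u = 1} \<times> {v. N v = 1}) * frame_count"
  proof (rule card_eq_fibres[where f = "\<lambda>(f, g, h). (f \<e>, g \<e>)"])
    show "finite isotopies"
      by (rule finite_subset[OF subset_UNIV], intro finite_Prod_UNIV finite_octonion_maps)
    show "(\<lambda>(f, g, h). (f \<e>, g \<e>)) ` isotopies \<subseteq> {u. N u = 1} \<times> {v. N v = 1}"
      by (auto simp: isotopies_def isometry_def)
  qed (use card_isotopies_fibre in auto)
  then show ?thesis
    using card_norm_fibre[of 1] by (simp add: card_cartesian_product power2_eq_square)
qed

section \<open>Transvections of the Albert space\<close>

abbreviation G :: "(('f, 'o) albert \<Rightarrow> ('f, 'o) albert) set" where
  "G \<equiv> carrier SE6"

lemma G_iff:
  "g \<in> G \<longleftrightarrow> (\<forall>x y. g (x + y) = g x + g y) \<and> (\<forall>r x. g (albert_scale r x) = albert_scale r (g x)) \<and>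
    (\<forall>x. \<Delta> (g x) = \<Delta> x)"
  unfolding SE6_def by (simp add: Vector_Spaces.linear_iff vector_space_albert del: split_paired_All)

lemma G_comp: "g \<in> G \<Longrightarrow> h \<in> G \<Longrightarrow> g \<circ> h \<in> G"
  unfolding G_iff by (simp del: split_paired_All)

lemma G_id: "id \<in> G"
  unfolding G_iff by (simp del: split_paired_All)

lemma G_inverse:
  assumes "g \<in> G"
  shows "\<exists>h\<in>G. h \<circ> g = id \<and> g \<circ> h = id"
proof -
  interpret S: group SE6 by (rule group_SE6)
  show ?thesis
    using S.inv_closed[OF assms] S.l_inv[OF assms] S.r_inv[OF assms] by (auto simp: SE6_def)
qed

lemma G_bij: "g \<in> G \<Longrightarrow> bij g"
  using G_inverse o_bij by blast

lemma G_zero: "g \<in> G \<Longrightarrow> g 0 = 0"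
  unfolding G_iff by (metis add_cancel_left_left)

lemma finite_albert [simp, intro]: "finite (A :: ('f, 'o) albert set)"
  by (rule finite_subset[OF subset_UNIV], intro finite_Prod_UNIV finite finite_octonions)

lemma finite_albert_maps [simp, intro]: "finite (A :: (('f, 'o) albert \<Rightarrow> ('f, 'o) albert) set)"
proof -
  have "finite (UNIV \<rightarrow>\<^sub>E UNIV :: (('f, 'o) albert \<Rightarrow> ('f, 'o) albert) set)"
    by (rule finite_PiE) auto
  then show ?thesis
    by (simp add: finite_subset[OF subset_UNIV])
qed

text \<open>The six components of the adjoint \<open>x\<^sup>#\<close> vanish, where the determinant \<open>\<Delta>\<close> is the cubic norm whose
  partial derivatives are the components of \<open>x\<^sup>#\<close>. The zero vector satisfies this as well.\<close>

definition white :: "('f, 'o) albert \<Rightarrow> bool" where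
  "white = (\<lambda>(a, b, c, A, B, C). b * c = N A \<and> c * a = N B \<and> a * b = N C \<and>
     A \<odot> B = c *s cnj C \<and> B \<odot> C = a *s cnj A \<and> C \<odot> A = b *s cnj B)"

text \<open>Later \<open>white_invariant\<close> shows that this is all of \<open>G\<close>. Its proof needs the transvections and the
  fact, verified on them directly, that they preserve whiteness.\<close>

definition G0 :: "(('f, 'o) albert \<Rightarrow> ('f, 'o) albert) set" where
  "G0 = {g \<in> G. \<forall>x. white (g x) \<longleftrightarrow> white x}"

lemma G0_comp: "g \<in> G0 \<Longrightarrow> h \<in> G0 \<Longrightarrow> g \<circ> h \<in> G0"
  unfolding G0_def using G_comp by (simp del: split_paired_All)

lemma G0_id: "id \<in> G0"
  unfolding G0_def using G_id by (simp del: split_paired_All)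

lemma G0_G: "g \<in> G0 \<Longrightarrow> g \<in> G"
  by (simp add: G0_def)

definition rotation :: "('f, 'o) albert \<Rightarrow> ('f, 'o) albert" where
  "rotation = (\<lambda>(a, b, c, A, B, C). (b, c, a, B, C, A))"

definition reflection :: "('f, 'o) albert \<Rightarrow> ('f, 'o) albert" where
  "reflection = (\<lambda>(a, b, c, A, B, C). (b, a, c, cnj B, cnj A, cnj C))"

text \<open>Regard \<open>(a, b, c, A, B, C)\<close> as the Hermitian matrix with diagonal \<open>a, b, c\<close> and entries \<open>C\<close>, \<open>A\<close>, \<open>B\<close>
  and their conjugates off the diagonal. This is the congruence that adds an octonion multiple of the
  first row and column to the second. The other transvections arise from it by permuting the diagonal.\<close>

definition transvection :: "'o \<Rightarrow> ('f, 'o) albert \<Rightarrow> ('f, 'o) albert" where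
  "transvection X = (\<lambda>(a, b, c, A, B, C).
     (a, b + \<langle>C, X\<rangle> + a * N X, c, A + cnj (B \<odot> X), B, C + a *s X))"

lemma rotation_G0: "rotation \<in> G0"
proof -
  have "rotation \<in> G"
    unfolding G_iff rotation_def albert_scale_def \<Delta>_def
    by (auto simp: algebra_simps intro: T_mult_cycle[symmetric])
  then show ?thesis
    by (auto simp: G0_def rotation_def white_def ac_simps)
qed

lemma reflection_G0: "reflection \<in> G0"
proof -
  have "T ((cnj B \<odot> cnj A) \<odot> cnj C) = T ((A \<odot> B) \<odot> C)" for A B C
  proof -
    have "(cnj B \<odot> cnj A) \<odot> cnj C = cnj (C \<odot> (A \<odot> B))"
      by (simp add: cnj_mult_rev)
    then show ?thesis
      by (simp add: T_mult_commute[of C])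
  qed
  then have "reflection \<in> G"
    unfolding G_iff reflection_def albert_scale_def \<Delta>_def
    by (auto simp: cnj_simps algebra_simps)
  moreover have "white (reflection x) \<longleftrightarrow> white x" for x
  proof -
    obtain a b c A B C where x: "x = (a, b, c, A, B, C)"
      by (cases x) auto
    have "cnj B \<odot> cnj A = c *s C \<longleftrightarrow> A \<odot> B = c *s cnj C" for A B C :: 'o and c
      by (metis cnj_cnj cnj_mult_rev cnj_simps(2))
    then show ?thesis
      by (auto simp: x reflection_def white_def ac_simps)
  qed
  ultimately show ?thesis
    by (simp add: G0_def del: split_paired_All)
qed

lemma transvection_cancel: "transvection (- X) (transvection X x) = x"
proof -
  obtain a b c A B C where x: "x = (a, b, c, A, B, C)"
    by (cases x) auto
  show ?thesis
    by (simp add: x transvection_def inn_simps inn_self N_minus mult_simps cnj_simps algebra_simps)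
qed

lemma transvection_white:
  assumes "white x"
  shows "white (transvection X x)"
proof -
  obtain a b c A B C where x: "x = (a, b, c, A, B, C)"
    by (cases x) auto
  have w: "b * c = N A" "c * a = N B" "a * b = N C" "A \<odot> B = c *s cnj C" "B \<odot> C = a *s cnj A" "C \<odot> A = b *s cnj B"
    using assms by (auto simp: x white_def)
  have "c * \<langle>C, X\<rangle> = T ((A \<odot> B) \<odot> X)"
    by (simp add: w T_mult inn_simps inn_cnj_cnj)
  then have 1: "\<langle>A, cnj (B \<odot> X)\<rangle> = c * \<langle>C, X\<rangle>"
    using T_mult_assoc[of A B X] T_mult[of A "B \<odot> X"] by simp
  have 2: "cnj (B \<odot> X) \<odot> B = N B *s cnj X"
    by (simp add: cnj_mult_rev cnj_mult_cancel_right)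
  have a: "a *s A = cnj C \<odot> cnj B"
    by (metis cnj_cnj cnj_mult_rev cnj_simps(2) w(5))
  have "C \<odot> cnj (B \<odot> X) + X \<odot> (a *s A) = \<langle>C, X\<rangle> *s cnj B"
    using mult_cnj_add[of C X "cnj B"] by (simp add: a cnj_mult_rev)
  then have 3: "C \<odot> cnj (B \<odot> X) + a *s (X \<odot> A) = \<langle>C, X\<rangle> *s cnj B"
    by (simp add: mult_simps)
  have 4: "X \<odot> cnj (B \<odot> X) = N X *s cnj B"
    by (simp add: cnj_mult_rev mult_cnj_cancel)
  have "(C + a *s X) \<odot> (A + cnj (B \<odot> X)) =
    C \<odot> A + (C \<odot> cnj (B \<odot> X) + a *s (X \<odot> A)) + a *s (X \<odot> cnj (B \<odot> X))"
    by (simp add: mult_simps algebra_simps)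
  also have "\<dots> = (b + \<langle>C, X\<rangle> + a * N X) *s cnj B"
    by (simp add: 3 4 w scale_left_distrib)
  finally have 5: "(C + a *s X) \<odot> (A + cnj (B \<odot> X)) = (b + \<langle>C, X\<rangle> + a * N X) *s cnj B" .
  have 6: "(b + \<langle>C, X\<rangle> + a * N X) * c = N (A + cnj (B \<odot> X))"
    by (simp add: N_add 1 norm_mult w(1,2)[symmetric] algebra_simps)
  have 7: "a * (b + \<langle>C, X\<rangle> + a * N X) = N (C + a *s X)"
    by (simp add: N_add w(3)[symmetric] norm_scale inn_simps power2_eq_square algebra_simps)
  have 8: "(A + cnj (B \<odot> X)) \<odot> B = c *s cnj (C + a *s X)"
    by (simp add: mult_simps 2 w(4) w(2)[symmetric] cnj_simps scale_right_distrib)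
  have 9: "B \<odot> (C + a *s X) = a *s cnj (A + cnj (B \<odot> X))"
    by (simp add: mult_simps cnj_simps w(5) scale_right_distrib)
  show ?thesis
    using 5 6 7 8 9 w(2) by (simp add: x transvection_def white_def)
qed

lemma transvection_G0: "transvection X \<in> G0"
proof -
  have "\<Delta> (transvection X x) = \<Delta> x" for x
  proof -
    obtain a b c A B C where x: "x = (a, b, c, A, B, C)"
      by (cases x) auto
    define Y where "Y = cnj (B \<odot> X)"
    have 1: "T ((A \<odot> B) \<odot> X) = \<langle>A, Y\<rangle>"
      using T_mult_assoc[of A B X] T_mult[of A "B \<odot> X"] by (simp add: Y_def)
    have 2: "Y \<odot> B = N B *s cnj X"
      by (simp add: Y_def cnj_mult_rev cnj_mult_cancel_right)
    have 3: "T (cnj X \<odot> C) = \<langle>C, X\<rangle>"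
      using T_mult_commute[of "cnj X" C] by (simp add: T_mult)
    have 4: "T (cnj X \<odot> X) = 2 * N X"
      by (simp add: cnj_mult T_simps T_unit)
    have 5: "N Y = N B * N X"
      by (simp add: Y_def norm_mult)
    show ?thesis
      unfolding x transvection_def \<Delta>_def prod.case Y_def[symmetric]
      by (simp add: N_add norm_scale mult_simps T_simps inn_simps 1 2 3 4 5)
        (simp add: algebra_simps power2_eq_square)
  qed
  moreover have "transvection X (x + y) = transvection X x + transvection X y" for x y
    by (cases x; cases y) (simp add: transvection_def inn_simps mult_simps cnj_simps scale_left_distrib algebra_simps)
  moreover have "transvection X (albert_scale r x) = albert_scale r (transvection X x)" for r x
    by (cases x) (simp add: transvection_def albert_scale_def inn_simps mult_simps cnj_simps algebra_simps)
  ultimately have "transvection X \<in> G"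
    unfolding G_iff by blast
  moreover have "white (transvection X x) \<longleftrightarrow> white x" for x
    using transvection_white[of x X] transvection_white[of "transvection X x" "- X"]
    by (auto simp: transvection_cancel)
  ultimately show ?thesis
    by (simp add: G0_def del: split_paired_All)
qed

definition lower_transvection :: "'o \<Rightarrow> ('f, 'o) albert \<Rightarrow> ('f, 'o) albert" where
  "lower_transvection X = (\<lambda>(a, b, c, A, B, C).
     (a + \<langle>C, X\<rangle> + b * N X, b, c, A, B + cnj (X \<odot> A), C + b *s X))"

lemma lower_transvection_G0: "lower_transvection X \<in> G0"
proof -
  have "lower_transvection X = reflection \<circ> (transvection (cnj X) \<circ> reflection)"
    by (auto simp: transvection_def lower_transvection_def reflection_def inn_cnj_cnj cnj_simps cnj_mult_rev)
  then show ?thesis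
    by (simp add: G0_comp reflection_G0 transvection_G0)
qed

definition e1 :: "('f, 'o) albert" where "e1 = (1, 0, 0, 0, 0, 0)"
definition e2 :: "('f, 'o) albert" where "e2 = (0, 1, 0, 0, 0, 0)"
definition e3 :: "('f, 'o) albert" where "e3 = (0, 0, 1, 0, 0, 0)"
lemmas e_defs = e1_def e2_def e3_def

section \<open>White vectors\<close>

text \<open>The set \<open>S\<close> of vectors to be fixed keeps track of the stabiliser in which the moves take place.\<close>

definition reach :: "('f, 'o) albert set \<Rightarrow> ('f, 'o) albert \<Rightarrow> ('f, 'o) albert \<Rightarrow> bool" where
  "reach S x y \<longleftrightarrow> (\<exists>g\<in>G0. (\<forall>s\<in>S. g s = s) \<and> g x = y)"

lemma reach_trans:
  assumes "reach S x y" "reach S y z"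
  shows "reach S x z"
proof -
  obtain g h where "g \<in> G0" "\<forall>s\<in>S. g s = s" "g x = y" "h \<in> G0" "\<forall>s\<in>S. h s = s" "h y = z"
    using assms unfolding reach_def by auto
  then show ?thesis
    unfolding reach_def by (intro bexI[of _ "h \<circ> g"]) (simp_all add: G0_comp)
qed

lemma reachI: "g \<in> G0 \<Longrightarrow> (\<And>s. s \<in> S \<Longrightarrow> g s = s) \<Longrightarrow> g x = y \<Longrightarrow> reach S x y"
  unfolding reach_def by blast

lemma reach_refl: "reach S x x"
  by (rule reachI[OF G0_id]) simp_all

lemma reachI2:
  assumes "S \<subseteq> {u, v}" "g \<in> G0" "g u = u" "g v = v" "g x = y"
  shows "reach S x y"
  by (rule reachI[OF assms(2) _ assms(5)]) (use assms(1,3,4) in blast)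

lemma reach_ab:
  assumes "S \<subseteq> {e2, e3}"
  shows "reach S (a, b, c, A, B, C) (a, b + \<langle>C, X\<rangle> + a * N X, c, A + cnj (B \<odot> X), B, C + a *s X)"
  by (rule reachI2[OF assms transvection_G0[of X]])
    (simp_all add: transvection_def lower_transvection_def rotation_def e_defs inn_simps mult_simps cnj_simps)

lemma reach_bc:
  assumes "S \<subseteq> {e1, e3}"
  shows "reach S (a, b, c, A, B, C) (a, b, c + \<langle>A, X\<rangle> + b * N X, A + b *s X, B + cnj (C \<odot> X), C)"
  by (rule reachI2[OF assms G0_comp[OF G0_comp[OF rotation_G0 rotation_G0] G0_comp[OF transvection_G0[of X] rotation_G0]]])
    (simp_all add: transvection_def lower_transvection_def rotation_def e_defs inn_simps mult_simps cnj_simps)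

lemma reach_ca:
  assumes "S \<subseteq> {e1, e2}"
  shows "reach S (a, b, c, A, B, C) (a + \<langle>B, X\<rangle> + c * N X, b, c, A, B + c *s X, C + cnj (A \<odot> X))"
  by (rule reachI2[OF assms G0_comp[OF rotation_G0 G0_comp[OF transvection_G0[of X] G0_comp[OF rotation_G0 rotation_G0]]]])
    (simp_all add: transvection_def lower_transvection_def rotation_def e_defs inn_simps mult_simps cnj_simps)

lemma reach_ba:
  assumes "S \<subseteq> {e1, e3}"
  shows "reach S (a, b, c, A, B, C) (a + \<langle>C, X\<rangle> + b * N X, b, c, A, B + cnj (X \<odot> A), C + b *s X)"
  by (rule reachI2[OF assms lower_transvection_G0[of X]])
    (simp_all add: transvection_def lower_transvection_def rotation_def e_defs inn_simps mult_simps cnj_simps)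

lemma reach_cb:
  assumes "S \<subseteq> {e1, e2}"
  shows "reach S (a, b, c, A, B, C) (a, b + \<langle>A, X\<rangle> + c * N X, c, A + c *s X, B, C + cnj (X \<odot> B))"
  by (rule reachI2[OF assms G0_comp[OF G0_comp[OF rotation_G0 rotation_G0] G0_comp[OF lower_transvection_G0[of X] rotation_G0]]])
    (simp_all add: transvection_def lower_transvection_def rotation_def e_defs inn_simps mult_simps cnj_simps)

lemma reach_ac:
  assumes "S \<subseteq> {e2, e3}"
  shows "reach S (a, b, c, A, B, C) (a, b, c + \<langle>B, X\<rangle> + a * N X, A + cnj (X \<odot> C), B + a *s X, C)"
  by (rule reachI2[OF assms G0_comp[OF rotation_G0 G0_comp[OF lower_transvection_G0[of X] G0_comp[OF rotation_G0 rotation_G0]]]])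
    (simp_all add: transvection_def lower_transvection_def rotation_def e_defs inn_simps mult_simps cnj_simps)

lemma reach_rotation: "reach {} (a, b, c, A, B, C) (b, c, a, B, C, A)"
  by (rule reachI[OF rotation_G0]) (simp_all add: rotation_def)

lemma reach_first_nonzero:
  assumes "x \<noteq> 0"
  shows "\<exists>a b c A B C. reach {} x (a, b, c, A, B, C) \<and> a \<noteq> 0"
proof -
  obtain a b c A B C where x: "x = (a, b, c, A, B, C)"
    by (cases x) auto
  have rot: "\<exists>a b c A B C. reach {} x (a, b, c, A, B, C) \<and> a \<noteq> 0"
    if "reach {} x (a, b, c, A, B, C)" "a \<noteq> 0 \<or> b \<noteq> 0 \<or> c \<noteq> 0" for a b c A B C
    using that reach_trans reach_rotation by meson
  have oct: "\<exists>a b c A B C. reach {} x (a, b, c, A, B, C) \<and> a \<noteq> 0"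
    if r: "reach {} x (0, 0, 0, A, B, C)" and C: "C \<noteq> 0" for A B C
  proof -
    obtain X where "\<langle>C, X\<rangle> \<noteq> 0"
      using polar_nondegenerate C by blast
    then show ?thesis
      using rot[OF reach_trans[OF r reach_ab[OF empty_subsetI, of _ _ _ _ _ _ X]]] by simp
  qed
  show ?thesis
  proof (cases "a = 0 \<and> b = 0 \<and> c = 0")
    case False
    then show ?thesis
      using rot[of a b c A B C] reach_refl x by auto
  next
    case True
    have r: "reach {} x (0, 0, 0, A, B, C)" "reach {} x (0, 0, 0, B, C, A)" "reach {} x (0, 0, 0, C, A, B)"
      using True x reach_refl reach_rotation reach_trans by metis+
    have "A \<noteq> 0 \<or> B \<noteq> 0 \<or> C \<noteq> 0"
      using True assms x by (simp add: zero_prod_def)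
    then show ?thesis
      using oct[OF r(1)] oct[OF r(2)] oct[OF r(3)] by blast
  qed
qed

text \<open>Gaussian elimination for Hermitian matrices, with the first diagonal entry as pivot.\<close>

lemma reach_diagonal:
  assumes "x \<noteq> 0"
  shows "\<exists>a b c. reach {} x (a, b, c, 0, 0, 0) \<and> a \<noteq> 0"
proof -
  obtain a b c A B C where 1: "reach {} x (a, b, c, A, B, C)" and a: "a \<noteq> 0"
    using reach_first_nonzero[OF assms] by blast
  obtain b' A' where 2: "reach {} x (a, b', c, A', B, 0)"
    using reach_trans[OF 1 reach_ab[OF empty_subsetI, of _ _ _ _ _ _ "(- inverse a) *s C"]] a by auto
  obtain c' where 3: "reach {} x (a, b', c', A', 0, 0)"
    using reach_trans[OF 2 reach_ac[OF empty_subsetI, of _ _ _ _ _ _ "(- inverse a) *s B"]] a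
    by (auto simp: mult_simps cnj_simps)
  have c: ?thesis if r: "reach {} x (a, b, c, A, 0, 0)" and c: "c \<noteq> 0" for b c A
    using reach_trans[OF r reach_cb[OF empty_subsetI, of _ _ _ _ _ _ "(- inverse c) *s A"]] a c
    by (auto simp: mult_simps cnj_simps)
  show ?thesis
  proof (cases "b' = 0")
    case False
    then show ?thesis
      using reach_trans[OF 3 reach_bc[OF empty_subsetI, of _ _ _ _ _ _ "(- inverse b') *s A'"]] a
      by (auto simp: mult_simps cnj_simps)
  next
    case b: True
    show ?thesis
    proof (cases "A' = 0")
      case True
      then show ?thesis using 3 a by blast
    next
      case False
      then obtain X where X: "\<langle>A', X\<rangle> \<noteq> 0"
        using polar_nondegenerate by blast
      show ?thesis
      proof (cases "c' = 0")
        case True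
        then show ?thesis
          using c[of 0 "\<langle>A', X\<rangle>" A'] reach_trans[OF 3 reach_bc[OF empty_subsetI, of _ _ _ _ _ _ X]] X b
          by (simp add: mult_simps cnj_simps)
      qed (use c[OF 3] in auto)
    qed
  qed
qed

text \<open>The full polarisation of \<open>\<Delta>\<close>. It is defined from the values of \<open>\<Delta>\<close> alone, hence is invariant
  under \<open>G\<close> over every field, including the field with two elements.\<close>

definition D :: "('f, 'o) albert \<Rightarrow> ('f, 'o) albert \<Rightarrow> ('f, 'o) albert \<Rightarrow> 'f" where
  "D x y z = \<Delta> (x + y + z) - \<Delta> (x + y) - \<Delta> (x + z) - \<Delta> (y + z) + \<Delta> x + \<Delta> y + \<Delta> z"

lemma D_diagonal:
  "D (x1, x2, x3, 0, 0, 0) (a, b, c, A, B, C) (a', b', c', A', B', C') =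
    x1 * (b * c' + c * b' - \<langle>A, A'\<rangle>) + x2 * (c * a' + a * c' - \<langle>B, B'\<rangle>) + x3 * (a * b' + b * a' - \<langle>C, C'\<rangle>)"
  by (simp add: D_def \<Delta>_def N_add N_zero mult_simps T_simps) (simp add: algebra_simps)

definition radical :: "('f, 'o) albert \<Rightarrow> ('f, 'o) albert set" where
  "radical x = {y. \<forall>z. D x y z = 0}"

lemma D_invariant: "g \<in> G \<Longrightarrow> D (g x) (g y) (g z) = D x y z"
  unfolding G_iff D_def by metis

lemma radical_invariant:
  assumes g: "g \<in> G"
  shows "g y \<in> radical (g x) \<longleftrightarrow> y \<in> radical x"
proof -
  have "(\<forall>z. D (g x) (g y) z = 0) \<longleftrightarrow> (\<forall>z. D (g x) (g y) (g z) = 0)"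
    using G_bij[OF g] by (metis bij_pointE)
  then show ?thesis
    by (simp add: radical_def D_invariant[OF g] del: split_paired_All)
qed

lemma card_radical_invariant:
  assumes g: "g \<in> G"
  shows "card (radical (g x)) = card (radical x)"
proof -
  have "bij_betw g {y. y \<in> radical x} {y. y \<in> radical (g x)}"
    by (rule bij_betw_Collect[OF G_bij[OF g]]) (simp add: radical_invariant[OF g])
  then show ?thesis
    using bij_betw_same_card by fastforce
qed

lemma radical_axis:
  assumes "t \<noteq> 0"
  shows "radical (t, 0, 0, 0, 0, 0) = {(a, b, c, A, B, C). b = 0 \<and> c = 0 \<and> A = 0}"
    "radical (0, t, 0, 0, 0, 0) = {(a, b, c, A, B, C). c = 0 \<and> a = 0 \<and> B = 0}"
    "radical (0, 0, t, 0, 0, 0) = {(a, b, c, A, B, C). a = 0 \<and> b = 0 \<and> C = 0}"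
proof -
  have *: "(\<forall>b' c' A'. b * c' + c * b' - \<langle>A, A'\<rangle> = 0) \<longleftrightarrow> b = 0 \<and> c = 0 \<and> A = 0" for b c A
  proof
    assume h: "\<forall>b' c' A'. b * c' + c * b' - \<langle>A, A'\<rangle> = 0"
    have "b = 0" "c = 0"
      using h[rule_format, of 0 1 0] h[rule_format, of 1 0 0] by (simp_all add: inn_simps)
    moreover have "A = 0"
      by (rule polar_nondegenerate) (use h[rule_format, of 0 0] in simp)
    ultimately show "b = 0 \<and> c = 0 \<and> A = 0" by blast
  qed (simp add: inn_simps)
  have **: "(\<forall>b' c' A'. b * b' + c * c' - \<langle>A, A'\<rangle> = 0) \<longleftrightarrow> b = 0 \<and> c = 0 \<and> A = 0" for b c A
    using *[of c b A] by (simp add: add.commute conj_commute conj_left_commute)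
  show "radical (t, 0, 0, 0, 0, 0) = {(a, b, c, A, B, C). b = 0 \<and> c = 0 \<and> A = 0}"
    using assms *[simplified] by (auto simp: radical_def D_diagonal inn_simps)
  show "radical (0, t, 0, 0, 0, 0) = {(a, b, c, A, B, C). c = 0 \<and> a = 0 \<and> B = 0}"
    using assms **[simplified] by (auto simp: radical_def D_diagonal inn_simps)
  show "radical (0, 0, t, 0, 0, 0) = {(a, b, c, A, B, C). a = 0 \<and> b = 0 \<and> C = 0}"
    using assms *[simplified] by (auto simp: radical_def D_diagonal inn_simps)
qed

lemma card_radical_axis:
  assumes "t \<noteq> 0"
  shows "card (radical (t, 0, 0, 0, 0, 0)) = q ^ 17"
proof -
  have "radical (t, 0, 0, 0, 0, 0) = UNIV \<times> {0} \<times> {0} \<times> {0} \<times> UNIV \<times> UNIV"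
    unfolding radical_axis(1)[OF assms] by auto
  moreover have "card (UNIV \<times> UNIV :: ('o \<times> 'o) set) = q ^ 16"
    by (simp only: card_cartesian_product card_octonions flip: power_add) simp
  ultimately show ?thesis
    by (simp add: card_cartesian_product flip: power_Suc)
qed

lemma card_radical_diagonal:
  assumes "a \<noteq> 0" "b \<noteq> 0 \<or> c \<noteq> 0"
  shows "card (radical (a, b, c, 0, 0, 0)) < q ^ 17"
proof -
  have zero: "A = 0 \<and> (b \<noteq> 0 \<longrightarrow> B = 0) \<and> (c \<noteq> 0 \<longrightarrow> C = 0)" if "(x, y, z, A, B, C) \<in> radical (a, b, c, 0, 0, 0)" for x y z A B C
  proof -
    have D: "D (a, b, c, 0, 0, 0) (x, y, z, A, B, C) w = 0" for w
      using that by (simp add: radical_def del: split_paired_All)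
    have "\<langle>A, Z\<rangle> = 0" "b \<noteq> 0 \<longrightarrow> \<langle>B, Z\<rangle> = 0" "c \<noteq> 0 \<longrightarrow> \<langle>C, Z\<rangle> = 0" for Z
      using D[of "(0, 0, 0, Z, 0, 0)"] D[of "(0, 0, 0, 0, Z, 0)"] D[of "(0, 0, 0, 0, 0, Z)"] assms(1)
      by (auto simp: D_diagonal inn_simps)
    then show ?thesis
      using polar_nondegenerate by blast
  qed
  have le: "card S \<le> q ^ 11" if "S \<subseteq> UNIV \<times> UNIV \<times> UNIV \<times> {0} \<times> {0} \<times> UNIV \<or>
    S \<subseteq> UNIV \<times> UNIV \<times> UNIV \<times> {0} \<times> UNIV \<times> {0}" for S :: "('f, 'o) albert set"
  proof -
    have "card (UNIV \<times> UNIV \<times> UNIV \<times> {0} \<times> {0} \<times> UNIV :: ('f, 'o) albert set) = q ^ 11"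
      "card (UNIV \<times> UNIV \<times> UNIV \<times> {0} \<times> UNIV \<times> {0} :: ('f, 'o) albert set) = q ^ 11"
      by (simp_all add: card_cartesian_product card_octonions flip: power_add power_Suc)
    then show ?thesis
      using that card_mono finite_albert by metis
  qed
  have "card (radical (a, b, c, 0, 0, 0)) \<le> q ^ 11"
    by (rule le) (use assms(2) zero in fastforce)
  also have "\<dots> < q ^ 17"
    using q_gt_1 by (intro power_strict_increasing) auto
  finally show ?thesis .
qed

text \<open>Both sides are invariant under the transvections, so the vector may be taken to be diagonal. If only one
  diagonal entry is non-zero, the radical consists of a line and two octonion coordinates; otherwise at
  most one octonion coordinate survives.\<close>

lemma white_iff_radical:
  assumes "x \<noteq> 0"
  shows "white x \<longleftrightarrow> card (radical x) = q ^ 17"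
proof -
  obtain g a b c where g: "g \<in> G0" "g x = (a, b, c, 0, 0, 0)" and a: "a \<noteq> 0"
    using reach_diagonal[OF assms] unfolding reach_def by blast
  have "white x \<longleftrightarrow> white (a, b, c, 0, 0, 0)"
    using g by (simp add: G0_def del: split_paired_All split: prod.split) metis
  moreover have "card (radical x) = card (radical (a, b, c, 0, 0, 0))"
    using card_radical_invariant[OF G0_G[OF g(1)], of x] g(2) by simp
  moreover have "white (a, b, c, 0, 0, 0) \<longleftrightarrow> b = 0 \<and> c = 0"
    using a by (auto simp: white_def N_zero mult_simps cnj_simps)
  ultimately show ?thesis
    using card_radical_axis[OF a] card_radical_diagonal[OF a, of b c] by auto
qed

lemma white_invariant:
  assumes g: "g \<in> G"
  shows "white (g x) \<longleftrightarrow> white x"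
proof (cases "x = 0")
  case False
  then have "g x \<noteq> 0"
    using G_bij[OF g] G_zero[OF g] by (metis bij_pointE)
  then show ?thesis
    using False white_iff_radical card_radical_invariant[OF g] by simp
qed (simp add: G_zero[OF g])

section \<open>Transitivity\<close>

lemma reach_white: "reach S x y \<Longrightarrow> white x \<Longrightarrow> white y"
  unfolding reach_def G0_def by blast

lemma reach_e1:
  assumes w: "white x" and x: "x \<noteq> 0"
  shows "reach {} x e1"
proof -
  obtain a b c where r: "reach {} x (a, b, c, 0, 0, 0)" and a: "a \<noteq> 0"
    using reach_diagonal[OF x] by blast
  then have bc: "b = 0" "c = 0"
    using reach_white[OF r w] by (auto simp: white_def N_zero)
  obtain X where X: "N X = inverse a"
    using N_surj by blast
  have "reach {} x (a, 1, 0, 0, 0, a *s X)"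
    using reach_trans[OF r reach_ab[OF empty_subsetI, of a b c 0 0 0 X]] a bc X
    by (simp add: inn_simps mult_simps cnj_simps)
  \<comment> \<open>Now that the second diagonal entry is 1, it serves as the pivot that clears the first one.\<close>
  note reach_trans[OF this reach_ba[OF empty_subsetI, of a 1 0 0 0 "a *s X" "- (a *s X)"]]
  moreover have "N (- (a *s X)) = a"
    using X a by (simp add: N_minus norm_scale power2_eq_square)
  moreover have "\<langle>a *s X, - (a *s X)\<rangle> = - (a + a)"
    using X a by (simp add: inn_simps inn_self norm_scale power2_eq_square)
  ultimately have "reach {} x (0, 1, 0, 0, 0, 0)"
    by (simp add: mult_simps cnj_simps)
  from reach_trans[OF this reach_rotation] show ?thesis
    by (simp add: e1_def)
qed

lemma reach_clear_A:
  assumes r: "reach {e1} y (a, b, c, A, B, C)" and w: "white y" and b: "b \<noteq> 0"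
  shows "reach {e1} y (a, b, 0, 0, 0, C)"
proof -
  obtain c' B' where r': "reach {e1} y (a, b, c', 0, B', C)"
    using reach_trans[OF r reach_bc[of "{e1}" a b c A B C "(- inverse b) *s A"]] b by auto
  have "b * c' = 0" "b *s cnj B' = 0"
    using reach_white[OF r' w] by (auto simp: white_def N_zero mult_simps)
  then have "c' = 0" "cnj B' = 0"
    using b by auto
  then have "B' = 0"
    by (metis cnj_cnj cnj_simps(5))
  then show ?thesis
    using r' \<open>c' = 0\<close> by simp
qed

lemma reach_b_1:
  assumes r: "reach {e1} y (a, b, c, A, B, C)" and w: "white y" and c: "c \<noteq> 0"
  shows "\<exists>B C. reach {e1} y (a, inverse c, c, \<e>, B, C)"
proof -
  obtain b' C' where r': "reach {e1} y (a, b', c, \<e>, B, C')"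
    using reach_trans[OF r reach_cb[of "{e1}" a b c A B C "inverse c *s (\<e> - A)"]] c
    by (auto simp: scale_right_diff_distrib)
  have "b' * c = 1"
    using reach_white[OF r' w] by (auto simp: white_def)
  then have "b' = inverse c"
    using c by (simp add: field_simps)
  then show ?thesis
    using r' by blast
qed

text \<open>Only the coordinates \<open>(b, c, A)\<close>, a vector of the 10-dimensional quadratic space with form
  \<open>b c - N A\<close>, have to be moved to \<open>(1, 0, 0)\<close>; whiteness then forces
  \<open>B = 0\<close> and \<open>a = N C\<close>, and a last transvection clears \<open>C\<close>.\<close>

lemma reach_e2:
  assumes w: "white y" and y: "y \<notin> radical e1"
  shows "reach {e1} y e2"
proof -
  obtain a b c A B C where y': "y = (a, b, c, A, B, C)"
    by (cases y) auto
  have nz: "\<not> (b = 0 \<and> c = 0 \<and> A = 0)"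
    using y radical_axis(1)[of 1] by (auto simp: y' e1_def)
  have r: "reach {e1} y (a, b, c, A, B, C)"
    using reach_refl by (simp add: y')
  have "\<exists>a b c A B C. reach {e1} y (a, b, c, A, B, C) \<and> b \<noteq> 0"
  proof (cases "c = 0")
    case False
    then show ?thesis
      using reach_b_1[OF r w False] by (metis inverse_nonzero_iff_nonzero)
  next
    case c: True
    show ?thesis
    proof (cases "b = 0")
      case True
      then obtain X where "\<langle>A, X\<rangle> \<noteq> 0"
        using nz c polar_nondegenerate by blast
      moreover have "reach {e1} y (a, \<langle>A, X\<rangle>, 0, A, B, C + cnj (X \<odot> B))"
        using reach_trans[OF r reach_cb[of "{e1}" a b c A B C X]] True c by simp
      ultimately show ?thesis
        by blast
    qed (use r in blast)
  qed
  then obtain a b c A B C where r: "reach {e1} y (a, b, c, A, B, C)" and b: "b \<noteq> 0"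
    by blast
  obtain X where X: "N X = inverse b"
    using N_surj by blast
  have "reach {e1} y (a, b, 0, 0, 0, C)"
    by (rule reach_clear_A[OF r w b])
  from reach_trans[OF this reach_bc[of "{e1}" a b 0 0 0 C X]]
  have "\<exists>A B. reach {e1} y (a, b, 1, A, B, C)"
    using b X by (auto simp: inn_simps)
  then obtain A B where "reach {e1} y (a, b, 1, A, B, C)"
    by blast
  \<comment> \<open>As \<open>b c = N A\<close> for white vectors, making \<open>A = \<e>\<close> and \<open>c = 1\<close> forces \<open>b = 1\<close>.\<close>
  then obtain B C where "reach {e1} y (a, 1, 1, \<e>, B, C)"
    using reach_b_1[OF _ w, of a b 1 A B C] by auto
  then have r: "reach {e1} y (a, 1, 0, 0, 0, C)"
    by (rule reach_clear_A[OF _ w]) simp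
  have "N C = a"
    using reach_white[OF r w] by (auto simp: white_def)
  then show ?thesis
    using reach_trans[OF r reach_ba[of "{e1}" a 1 0 0 0 C "- C"]]
    by (simp add: inn_simps inn_self N_minus mult_simps cnj_simps e2_def)
qed

lemma reach_e3:
  assumes w: "white (a, b, 1, A, B, C)"
  shows "reach {e1, e2} (a, b, 1, A, B, C) e3"
proof -
  let ?z = "(a, b, 1, A, B, C)"
  obtain b' C' where r: "reach {e1, e2} ?z (a, b', 1, 0, B, C')"
    using reach_cb[of "{e1, e2}" a b 1 A B C "- A"] by auto
  have "b' = 0" "cnj C' = 0"
    using reach_white[OF r w] by (auto simp: white_def N_zero mult_simps)
  then have C': "b' = 0" "C' = 0"
    by (simp, metis cnj_cnj cnj_simps(5))
  have "reach {e1, e2} ?z (a + \<langle>B, - B\<rangle> + N (- B), 0, 1, 0, 0, 0)"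
    using reach_trans[OF r reach_ca[of "{e1, e2}" a b' 1 0 B C' "- B"]] C'
    by (simp add: mult_simps cnj_simps)
  moreover from this have "a + \<langle>B, - B\<rangle> + N (- B) = 0"
    using reach_white[OF _ w] by (fastforce simp: white_def N_zero)
  ultimately show ?thesis
    by (simp add: e3_def)
qed

section \<open>Counting white vectors\<close>

text \<open>The pairs \<open>(B, C)\<close> that occur in white vectors whose first coordinate is 0.\<close>

definition annihilating :: "('o \<times> 'o) set" where
  "annihilating = {(B, C). N B = 0 \<and> N C = 0 \<and> B \<odot> C = 0}"

lemma N_kernel: "B \<odot> C = 0 \<Longrightarrow> B \<noteq> 0 \<Longrightarrow> N C = 0"
proof -
  assume "B \<odot> C = 0" "B \<noteq> 0"
  then have "N C *s B = 0"
    using mult_cnj_cancel_right[of B C] by (simp add: mult_simps)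
  then show "N C = 0"
    using \<open>B \<noteq> 0\<close> by simp
qed

lemma N_kernel_left: "C \<odot> B = 0 \<Longrightarrow> B \<noteq> 0 \<Longrightarrow> N C = 0"
proof -
  assume "C \<odot> B = 0" "B \<noteq> 0"
  then have "N C *s B = 0"
    using cnj_mult_cancel[of C B] by (simp add: mult_simps)
  then show "N C = 0"
    using \<open>B \<noteq> 0\<close> by simp
qed

lemma card_annihilating: "int (card annihilating) = int q ^ 11 + int q ^ 8 - int q ^ 3"
proof -
  let ?Z = "{B. N B = 0}" and ?K = "\<lambda>B. {C. N C = 0 \<and> B \<odot> C = 0}"
  have Z: "int (card ?Z) = int q ^ 7 + int q ^ 4 - int q ^ 3"
    using card_norm_fibre[of 0] by simp
  have "annihilating = (SIGMA B:?Z. ?K B)"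
    by (auto simp: annihilating_def)
  also have "card \<dots> = (\<Sum>B\<in>?Z. card (?K B))"
    by (intro card_SigmaI) auto
  also have "\<dots> = card (?K 0) + (\<Sum>B\<in>?Z - {0}. card (?K B))"
    by (rule sum.remove) (auto simp: N_zero)
  also have "(\<Sum>B\<in>?Z - {0}. card (?K B)) = (\<Sum>B\<in>?Z - {0}. q ^ 4)"
  proof (rule sum.cong)
    fix B assume B: "B \<in> ?Z - {0}"
    then have "?K B = {C. B \<odot> C = 0}"
      using N_kernel by auto
    then show "card (?K B) = q ^ 4"
      using B card_kernel_isotropic by auto
  qed simp
  also have "\<dots> = (card ?Z - 1) * q ^ 4"
    by (simp add: card_Diff_singleton N_zero)
  also have "?K 0 = ?Z"
    by (auto simp: mult_simps)
  finally have "card annihilating = card ?Z + (card ?Z - 1) * q ^ 4" .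
  moreover have "card ?Z \<ge> 1"
    using card_mono[of ?Z "{0}"] by (simp add: N_zero)
  ultimately have "int (card annihilating) = int (card ?Z) + (int (card ?Z) - 1) * int q ^ 4"
    by (simp add: of_nat_diff)
  then show ?thesis
    unfolding Z by (simp add: algebra_simps eval_nat_numeral)
qed

definition white_fibre :: "'o \<Rightarrow> 'o \<Rightarrow> ('f \<times> 'f \<times> 'o) set" where
  "white_fibre B C = {(b, c, A). b * c = N A \<and> A \<odot> B = c *s cnj C \<and> C \<odot> A = b *s cnj B}"

text \<open>If \<open>B \<noteq> 0\<close>, write \<open>C = cnj B \<odot> X\<close>. The equation for \<open>A \<odot> B\<close> says that
  \<open>A = c *s cnj X + K\<close> with \<open>K \<odot> B = 0\<close>, and the other two equations amount to \<open>b = c * N X + \<langle>cnj X, K\<rangle>\<close>.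
  So \<open>c\<close> and \<open>K\<close> are free, which leaves \<open>q * q^4\<close> choices.\<close>

lemma card_white_fibre:
  assumes S: "(B, C) \<in> annihilating" and nz: "(B, C) \<noteq> (0, 0)"
  shows "card (white_fibre B C) = q ^ 5"
proof (cases "B = 0")
  case True
  then have C: "C \<noteq> 0" "N C = 0"
    using nz S by (auto simp: annihilating_def)
  then have "cnj C \<noteq> 0"
    by (metis cnj_cnj cnj_simps(5))
  then have "white_fibre B C = UNIV \<times> {0} \<times> {A. C \<odot> A = 0}"
    using True N_kernel[OF _ C(1)] by (auto simp: white_fibre_def mult_simps cnj_simps)
  then show ?thesis
    using card_kernel_isotropic[OF C(2,1)] by (simp add: card_cartesian_product flip: power_Suc)
next
  case B: False
  then have NB: "N B = 0" and BC: "B \<odot> C = 0"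
    using S by (auto simp: annihilating_def)
  then obtain X where C: "C = cnj B \<odot> X"
    using kernel_eq_range[OF NB B] by blast
  have cB: "cnj B \<noteq> 0"
    using B by (metis cnj_cnj cnj_simps(5))
  let ?g = "\<lambda>(c, K). (c * N X + \<langle>cnj X, K\<rangle>, c, c *s cnj X + K)"
  have CK: "C \<odot> (c *s cnj X + K) = (c * N X + \<langle>cnj X, K\<rangle>) *s cnj B" if K: "K \<odot> B = 0" for c K
  proof -
    have "cnj B \<odot> cnj K = 0"
      using K by (metis cnj_mult_rev cnj_simps(5))
    then have "C \<odot> K = \<langle>cnj X, K\<rangle> *s cnj B"
      using mult_cnj_add_right[of "cnj B" "cnj X" K] by (simp add: C mult_simps inn_commute[of K])
    then show ?thesis
      by (simp add: mult_simps C mult_cnj_cancel_right scale_left_distrib)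
  qed
  have KB: "(c *s cnj X + K) \<odot> B = c *s cnj C + K \<odot> B" for c K
    by (simp add: C cnj_mult_rev mult_simps)
  have "bij_betw ?g (UNIV \<times> {K. K \<odot> B = 0}) (white_fibre B C)"
  proof (rule bij_betw_byWitness[where f' = "\<lambda>(b, c, A). (c, A - c *s cnj X)"])
    show "?g ` (UNIV \<times> {K. K \<odot> B = 0}) \<subseteq> white_fibre B C"
    proof clarify
      fix c K assume K: "K \<odot> B = 0"
      have "N (c *s cnj X + K) = (c * N X + \<langle>cnj X, K\<rangle>) * c"
        using N_kernel_left[OF K B] by (simp add: N_add norm_scale inn_simps inn_commute[of K] power2_eq_square algebra_simps)
      then show "(c * N X + \<langle>cnj X, K\<rangle>, c, c *s cnj X + K) \<in> white_fibre B C"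
        using CK[OF K] KB K by (simp add: white_fibre_def)
    qed
    show "(\<lambda>(b, c, A). (c, A - c *s cnj X)) ` white_fibre B C \<subseteq> UNIV \<times> {K. K \<odot> B = 0}"
      by (auto simp: white_fibre_def C cnj_mult_rev mult_simps)
    show "\<forall>s\<in>white_fibre B C. ?g ((\<lambda>(b, c, A). (c, A - c *s cnj X)) s) = s"
    proof
      fix s assume "s \<in> white_fibre B C"
      moreover obtain b c A where bcA: "s = (b, c, A)"
        by (cases s) auto
      ultimately have s: "(b, c, A) \<in> white_fibre B C"
        by simp
      then have "(A - c *s cnj X) \<odot> B = 0"
        by (auto simp: white_fibre_def C cnj_mult_rev mult_simps)
      from CK[OF this, of c] have "C \<odot> A = (c * N X + \<langle>cnj X, A - c *s cnj X\<rangle>) *s cnj B"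
        by simp
      then have "b *s cnj B = (c * N X + \<langle>cnj X, A - c *s cnj X\<rangle>) *s cnj B"
        using s by (auto simp: white_fibre_def)
      then show "?g ((\<lambda>(b, c, A). (c, A - c *s cnj X)) s) = s"
        using cB by (auto simp: bcA)
    qed
  qed auto
  then have "card (white_fibre B C) = card ((UNIV :: 'f set) \<times> {K. K \<odot> B = 0})"
    by (rule bij_betw_same_card[symmetric])
  then show ?thesis
    using card_kernel_isotropic_right[OF NB B] by (simp add: card_cartesian_product flip: power_Suc)
qed

lemma card_white_fibre_0: "int (card (white_fibre 0 0)) = int q ^ 9 + int q ^ 5 - int q ^ 4"
proof -
  have "bij_betw (\<lambda>(A, b, c). (b, c, A)) {s \<in> UNIV \<times> UNIV. (case s of (A, b, c) \<Rightarrow> N A - b * c) = 0} (white_fibre 0 0)"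
    by (rule bij_betw_byWitness[where f' = "\<lambda>(b, c, A). (A, b, c)"])
      (auto simp: white_fibre_def mult_simps cnj_simps)
  then have "card (white_fibre 0 0) = card {s \<in> UNIV \<times> UNIV. (case s of (A, b, c) \<Rightarrow> N A - b * c) = 0}"
    by (rule bij_betw_same_card[symmetric])
  then have "int (card (white_fibre 0 0)) = int (q ^ 8) * (int q - 1) + int q * int (card {A. N A = 0})"
    using card_hyperbolic_extension_int[of UNIV N 0] by (simp only: card_octonions finite_octonions) simp
  then show ?thesis
    using card_norm_fibre[of 0] by (simp add: algebra_simps eval_nat_numeral)
qed

lemma card_white_first_zero:
  "int (card {x. white x \<and> fst x = 0}) =
    int q ^ 9 + int q ^ 5 - int q ^ 4 + (int (card annihilating) - 1) * int q ^ 5"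
proof -
  have "bij_betw (\<lambda>((B, C), (b, c, A)). (0, b, c, A, B, C))
    (SIGMA s:annihilating. white_fibre (fst s) (snd s)) {x. white x \<and> fst x = 0}"
    by (rule bij_betw_byWitness[where f' = "\<lambda>(a, b, c, A, B, C). ((B, C), (b, c, A))"])
      (auto simp: white_def white_fibre_def annihilating_def)
  then have "card {x. white x \<and> fst x = 0} = card (SIGMA s:annihilating. white_fibre (fst s) (snd s))"
    by (rule bij_betw_same_card[symmetric])
  also have fin: "finite annihilating" "finite (white_fibre B C)" for B C
    by (rule finite_subset[OF subset_UNIV], intro finite_Prod_UNIV finite finite_octonions)+
  have "card (SIGMA s:annihilating. white_fibre (fst s) (snd s)) =
    (\<Sum>s\<in>annihilating. card (white_fibre (fst s) (snd s)))"
    using fin by (intro card_SigmaI) auto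
  also have "\<dots> = card (white_fibre 0 0) + (\<Sum>s\<in>annihilating - {(0, 0)}. card (white_fibre (fst s) (snd s)))"
    by (subst sum.remove[OF fin(1), of "(0, 0)"]) (auto simp: annihilating_def N_zero mult_simps)
  also have "(\<Sum>s\<in>annihilating - {(0, 0)}. card (white_fibre (fst s) (snd s))) =
    (\<Sum>s\<in>annihilating - {(0, 0)}. q ^ 5)"
    by (rule sum.cong) (auto intro!: card_white_fibre)
  also have "\<dots> = (card annihilating - 1) * q ^ 5"
    by (simp add: card_Diff_singleton annihilating_def N_zero mult_simps)
  finally have "card {x. white x \<and> fst x = 0} = card (white_fibre 0 0) + (card annihilating - 1) * q ^ 5" .
  moreover have "card annihilating \<ge> 1"
    using card_mono[OF fin(1), of "{(0, 0)}"] by (simp add: annihilating_def N_zero mult_simps)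
  ultimately show ?thesis
    by (simp add: of_nat_diff card_white_fibre_0)
qed

text \<open>If the first coordinate is not 0, the coordinates \<open>B\<close> and \<open>C\<close> determine a white vector and are arbitrary.\<close>

lemma card_white_first:
  assumes "t \<noteq> 0"
  shows "card {x. white x \<and> fst x = t} = q ^ 16"
proof -
  let ?g = "\<lambda>(B, C). (t, N C / t, N B / t, inverse t *s cnj (B \<odot> C), B, C)"
  have "bij_betw ?g UNIV {x. white x \<and> fst x = t}"
  proof (rule bij_betw_byWitness[where f' = "\<lambda>(a, b, c, A, B, C). (B, C)"])
    have "(cnj C \<odot> cnj B) \<odot> B = N B *s cnj C" "C \<odot> (cnj C \<odot> cnj B) = N C *s cnj B" for B C
      by (simp_all add: cnj_mult_cancel_right mult_cnj_cancel)
    then show "?g ` UNIV \<subseteq> {x. white x \<and> fst x = t}"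
      using assms by (auto simp: white_def norm_scale norm_mult cnj_mult_rev mult_simps cnj_simps
          field_simps power2_eq_square)
    show "\<forall>x\<in>{x. white x \<and> fst x = t}. ?g ((\<lambda>(a, b, c, A, B, C). (B, C)) x) = x"
    proof
      fix x assume x: "x \<in> {x. white x \<and> fst x = t}"
      obtain a b c A B C where abc: "x = (a, b, c, A, B, C)"
        by (cases x) auto
      then have a: "a = t" and w: "c * t = N B" "t * b = N C" "B \<odot> C = t *s cnj A"
        using x by (auto simp: white_def)
      have "inverse t *s cnj (B \<odot> C) = A"
        using assms by (simp add: w cnj_simps)
      moreover have "N C / t = b" "N B / t = c"
        using assms by (simp_all flip: w(1,2))
      ultimately show "?g ((\<lambda>(a, b, c, A, B, C). (B, C)) x) = x"
        by (simp add: abc a)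
    qed
  qed auto
  then have "card {x. white x \<and> fst x = t} = card (UNIV :: ('o \<times> 'o) set)"
    by (rule bij_betw_same_card[symmetric])
  also have "\<dots> = card (UNIV \<times> UNIV :: ('o \<times> 'o) set)"
    by simp
  also have "\<dots> = q ^ 16"
    by (simp only: card_cartesian_product card_octonions flip: power_add) simp
  finally show ?thesis .
qed

lemma card_white: "int (card {x. white x}) = int q ^ 17 + int q ^ 13 + int q ^ 9 - int q ^ 8 - int q ^ 4"
proof -
  have "{x. white x} = (\<Union>t. {x. white x \<and> fst x = t})"
    by auto
  also have "card \<dots> = (\<Sum>t\<in>UNIV. card {x. white x \<and> fst x = t})"
    by (rule card_UN_disjoint) auto
  also have "\<dots> = card {x. white x \<and> fst x = 0} + (\<Sum>t\<in>UNIV - {0}. card {x. white x \<and> fst x = t})"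
    by (rule sum.remove) auto
  also have "(\<Sum>t\<in>UNIV - {0}. card {x. white x \<and> fst x = t}) = (\<Sum>t\<in>UNIV - {0 :: 'f}. q ^ 16)"
    by (rule sum.cong) (auto intro: card_white_first)
  also have "\<dots> = (q - 1) * q ^ 16"
    by (simp add: card_Diff_singleton)
  finally have "int (card {x. white x}) = int (card {x. white x \<and> fst x = 0}) + (int q - 1) * int q ^ 16"
    using q_gt_1 by (simp add: of_nat_diff)
  then show ?thesis
    unfolding card_white_first_zero card_annihilating by (simp add: algebra_simps eval_nat_numeral)
qed

lemma card_white_radical: "card {x. white x \<and> x \<in> radical e1} = q * card annihilating"
proof -
  have "bij_betw (\<lambda>(a, B, C). (a, 0, 0, 0, B, C)) (UNIV \<times> annihilating) {x. white x \<and> x \<in> radical e1}"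
    by (rule bij_betw_byWitness[where f' = "\<lambda>(a, b, c, A, B, C). (a, B, C)"])
      (auto simp: white_def annihilating_def e1_def radical_axis N_zero mult_simps cnj_simps)
  then have "card {x. white x \<and> x \<in> radical e1} = card ((UNIV :: 'f set) \<times> annihilating)"
    by (rule bij_betw_same_card[symmetric])
  then show ?thesis
    by (simp add: card_cartesian_product)
qed

lemma white_e1: "white e1"
  by (simp add: e1_def white_def N_zero mult_simps cnj_simps)

lemma e_nonzero: "e1 \<noteq> 0" "e2 \<noteq> 0" "e3 \<noteq> 0"
  by (simp_all add: e_defs zero_prod_def)

lemma rotation_e: "rotation e1 = e3" "rotation e2 = e1" "rotation e3 = e2"
  by (simp_all add: e_defs rotation_def)

lemma white_e: "white e2" "white e3"
  using white_e1 rotation_e white_invariant[OF G0_G[OF rotation_G0]] by metis+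

lemma D_e:
  "D e1 e2 (a, b, c, A, B, C) = c" "D e2 e3 (a, b, c, A, B, C) = a" "D e3 e1 (a, b, c, A, B, C) = b"
  by (simp_all add: e_defs D_diagonal inn_simps)

lemma reach_G: "reach S x y \<Longrightarrow> \<exists>g\<in>G. (\<forall>s\<in>S. g s = s) \<and> g x = y"
  unfolding reach_def using G0_G by blast

section \<open>The stabiliser of the three diagonal white vectors\<close>

lemma diagonal_decomposition:
  "(a, b, c, A, B, C) = albert_scale a e1 + albert_scale b e2 + albert_scale c e3
    + (0, 0, 0, A, 0, 0) + (0, 0, 0, 0, B, 0) + (0, 0, 0, 0, 0, C)"
  by (simp add: e_defs albert_scale_def)

text \<open>The third coordinate is conjugated twice because \<open>\<Delta>\<close> involves
  \<open>T ((A \<odot> B) \<odot> C) = \<langle>A \<odot> B, cnj C\<rangle>\<close>, which an isotopy \<open>(f, g, h)\<close> preserves if \<open>h\<close> acts on \<open>cnj C\<close>.\<close>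

definition blocks :: "('o \<Rightarrow> 'o) \<times> ('o \<Rightarrow> 'o) \<times> ('o \<Rightarrow> 'o) \<Rightarrow> ('f, 'o) albert \<Rightarrow> ('f, 'o) albert" where
  "blocks = (\<lambda>(f, g, h) (a, b, c, A, B, C). (a, b, c, f A, g B, cnj (h (cnj C))))"

lemma blocks_isotopy:
  assumes "s \<in> isotopies"
  shows "blocks s \<in> {g \<in> G. g e1 = e1 \<and> g e2 = e2 \<and> g e3 = e3}"
proof -
  obtain f g h where s: "s = (f, g, h)"
    by (cases s) auto
  have f: "isometry f" and g: "isometry g" and h: "isometry h" and m: "f x \<odot> g y = h (x \<odot> y)" for x y
    using assms by (auto simp: s isotopies_def)
  note simps = isometryD(1-3,8)[OF f] isometryD(1-3,8)[OF g] isometryD(1-3,8)[OF h]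
  have "T ((f A \<odot> g B) \<odot> cnj (h (cnj C))) = T ((A \<odot> B) \<odot> C)" for A B C
    by (simp add: m T_mult isometryD(4)[OF h])
  then have "blocks s \<in> G"
    unfolding G_iff s blocks_def by (auto simp: albert_scale_def \<Delta>_def simps cnj_simps)
  moreover have "blocks s e1 = e1" "blocks s e2 = e2" "blocks s e3 = e3"
    by (simp_all add: s blocks_def e_defs simps cnj_simps)
  ultimately show ?thesis
    by simp
qed

lemma blocks_inj: "inj_on blocks isotopies"
proof (rule inj_onI)
  fix s t assume eq: "blocks s = blocks t"
  obtain f g h f' g' h' where st: "s = (f, g, h)" "t = (f', g', h')"
    by (cases s; cases t) auto
  have e: "blocks s (0, 0, 0, X, X, cnj X) = blocks t (0, 0, 0, X, X, cnj X)" for X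
    by (simp add: eq)
  have "f X = f' X" "g X = g' X" "cnj (h X) = cnj (h' X)" for X
    using e[of X] by (simp_all add: st blocks_def)
  then have "f X = f' X" "g X = g' X" "h X = h' X" for X
    by (simp_all, metis cnj_cnj)
  then show "s = t"
    by (simp add: st fun_eq_iff)
qed

text \<open>The diagonal coordinates are values of \<open>D\<close> at pairs of the fixed vectors, and each octonion coordinate
  is the intersection of two of the radicals of \<open>e1\<close>, \<open>e2\<close>, \<open>e3\<close> with the vectors of diagonal 0. So
  every element that fixes \<open>e1\<close>, \<open>e2\<close> and \<open>e3\<close> preserves all six coordinates.\<close>

lemma blocks_surj:
  assumes g: "g \<in> G" and e: "g e1 = e1" "g e2 = e2" "g e3 = e3"
  shows "\<exists>s\<in>isotopies. g = blocks s"
proof -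
  have add: "g (x + y) = g x + g y" and scale: "g (albert_scale r x) = albert_scale r (g x)"
    and det: "\<Delta> (g x) = \<Delta> x" for x y r
    using g unfolding G_iff by blast+
  have coord: "D e1 e2 (g x) = D e1 e2 x" "D e2 e3 (g x) = D e2 e3 x" "D e3 e1 (g x) = D e3 e1 x" for x
    using D_invariant[OF g] e by metis+
  have rad: "x \<in> radical e1 \<Longrightarrow> g x \<in> radical e1" "x \<in> radical e2 \<Longrightarrow> g x \<in> radical e2"
    "x \<in> radical e3 \<Longrightarrow> g x \<in> radical e3" for x
    using radical_invariant[OF g] e by metis+
  note axis = radical_axis[of 1, folded e_defs, simplified]
  have "\<exists>X. g (0, 0, 0, A, 0, 0) = (0, 0, 0, X, 0, 0)" for A
    using coord[of "(0, 0, 0, A, 0, 0)"] rad(2,3)[of "(0, 0, 0, A, 0, 0)"]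
    by (cases "g (0, 0, 0, A, 0, 0)") (auto simp: D_e axis)
  then obtain f where f: "g (0, 0, 0, A, 0, 0) = (0, 0, 0, f A, 0, 0)" for A
    by metis
  have "\<exists>X. g (0, 0, 0, 0, A, 0) = (0, 0, 0, 0, X, 0)" for A
    using coord[of "(0, 0, 0, 0, A, 0)"] rad(1,3)[of "(0, 0, 0, 0, A, 0)"]
    by (cases "g (0, 0, 0, 0, A, 0)") (auto simp: D_e axis)
  then obtain f2 where f2: "g (0, 0, 0, 0, A, 0) = (0, 0, 0, 0, f2 A, 0)" for A
    by metis
  have "\<exists>X. g (0, 0, 0, 0, 0, A) = (0, 0, 0, 0, 0, X)" for A
    using coord[of "(0, 0, 0, 0, 0, A)"] rad(1,2)[of "(0, 0, 0, 0, 0, A)"]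
    by (cases "g (0, 0, 0, 0, 0, A)") (auto simp: D_e axis)
  then obtain f3 where f3: "g (0, 0, 0, 0, 0, A) = (0, 0, 0, 0, 0, f3 A)" for A
    by metis
  have val: "g (a, b, c, A, B, C) = (a, b, c, f A, f2 B, f3 C)" for a b c A B C
    by (subst diagonal_decomposition, simp only: add scale e f f2 f3)
      (simp add: e_defs albert_scale_def)
  have lin: "f (x + y) = f x + f y" "f2 (x + y) = f2 x + f2 y" "f3 (x + y) = f3 x + f3 y" for x y
    using add[of "(0, 0, 0, x, x, x)" "(0, 0, 0, y, y, y)"] by (simp_all add: val)
  have scl: "f (r *s x) = r *s f x" "f2 (r *s x) = r *s f2 x" "f3 (r *s x) = r *s f3 x" for r x
    using scale[of r "(0, 0, 0, x, x, x)"] by (simp_all add: val albert_scale_def)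
  have zero: "f 0 = 0" "f2 0 = 0" "f3 0 = 0"
    using scl[of 0 0] by simp_all
  have N: "N (f x) = N x" "N (f2 x) = N x" "N (f3 x) = N x" for x
    using det[of "(1, 0, 0, x, 0, 0)"] det[of "(0, 1, 0, 0, x, 0)"] det[of "(0, 0, 1, 0, 0, x)"]
    by (simp_all add: val \<Delta>_def zero N_zero mult_simps T_simps)
  have "T ((f A \<odot> f2 B) \<odot> f3 C) = T ((A \<odot> B) \<odot> C)" for A B C
    using det[of "(0, 0, 0, A, B, C)"] by (simp add: val \<Delta>_def)
  then have inn: "\<langle>f A \<odot> f2 B, cnj (f3 (cnj Z))\<rangle> = \<langle>A \<odot> B, Z\<rangle>" for A B Z
    using T_mult[of "A \<odot> B" "cnj Z"] T_mult[of "f A \<odot> f2 B" "f3 (cnj Z)"] by simp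
  define h where "h Z = cnj (f3 (cnj Z))" for Z
  have iso: "isometry f" "isometry f2" "isometry h"
    by (simp_all add: isometry_def lin scl N h_def cnj_simps)
  have "f A \<odot> f2 B = h (A \<odot> B)" for A B
  proof (rule inn_eqI)
    fix z
    obtain Z where Z: "z = h Z"
      using isometryD(5)[OF iso(3)] by (rule bij_pointE)
    show "\<langle>f A \<odot> f2 B, z\<rangle> = \<langle>h (A \<odot> B), z\<rangle>"
      unfolding Z isometryD(4)[OF iso(3)] using inn[of A B Z] by (simp add: h_def)
  qed
  then have "(f, f2, h) \<in> isotopies"
    using iso by (simp add: isotopies_def)
  moreover have "g = blocks (f, f2, h)"
    by (auto simp: fun_eq_iff val blocks_def h_def)
  ultimately show ?thesis
    by blast
qed

lemma card_stabiliser: "card {g \<in> G. g e1 = e1 \<and> g e2 = e2 \<and> g e3 = e3} = card isotopies"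
proof -
  have "blocks ` isotopies = {g \<in> G. g e1 = e1 \<and> g e2 = e2 \<and> g e3 = e3}"
    using blocks_isotopy blocks_surj by blast
  then show ?thesis
    using card_image[OF blocks_inj] by simp
qed

section \<open>The order of the group and of its centre\<close>

lemma card_white_third: "card {z. white z \<and> D e1 e2 z = 1} = q ^ 16"
proof -
  have "bij (rotation \<circ> rotation)"
    by (intro bij_comp G_bij G0_G rotation_G0)
  moreover have "(white z \<and> D e1 e2 z = 1) \<longleftrightarrow> (white ((rotation \<circ> rotation) z) \<and> fst ((rotation \<circ> rotation) z) = 1)" for z
    by (cases z) (simp add: D_e white_invariant[OF G0_G[OF rotation_G0]], simp add: rotation_def)
  ultimately have "bij_betw (rotation \<circ> rotation) {z. white z \<and> D e1 e2 z = 1} {x. white x \<and> fst x = 1}"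
    by (rule bij_betw_Collect)
  then have "card {z. white z \<and> D e1 e2 z = 1} = card {x. white x \<and> fst x = 1}"
    by (rule bij_betw_same_card)
  then show ?thesis
    by (simp add: card_white_first)
qed

lemma stabiliser_inverse:
  assumes "g \<in> G" "\<And>s. s \<in> S \<Longrightarrow> g s = s"
  shows "\<exists>h\<in>{h \<in> G. \<forall>s\<in>S. h s = s}. h \<circ> g = id \<and> g \<circ> h = id"
proof -
  obtain h where h: "h \<in> G" "h \<circ> g = id" "g \<circ> h = id"
    using G_inverse[OF assms(1)] by blast
  have "h s = s" if "s \<in> S" for s
    using h(2) assms(2)[OF that] by (metis comp_apply id_apply)
  then show ?thesis
    using h by blast
qed

lemma card_G: "card G = card {x. white x \<and> x \<noteq> 0} * (card {y. white y \<and> y \<notin> radical e1} * (q ^ 16 * card isotopies))"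
proof -
  let ?H = "\<lambda>S. {g \<in> G. \<forall>s\<in>S. g s = s}"
  have comp: "g \<circ> h \<in> ?H S" if "g \<in> ?H S" "h \<in> ?H S" for g h S
    using that by (simp add: G_comp)
  have inverse: "\<exists>h\<in>?H S. h \<circ> g = id \<and> g \<circ> h = id" if "g \<in> ?H S" for g S
    using that stabiliser_inverse by blast
  have trans: "\<exists>g\<in>?H S. g y = x" if "reach S y x" for S x y
    using reach_G[OF that] by blast
  have 1: "card (?H {}) = card {x. white x \<and> x \<noteq> 0} * card {g \<in> ?H {}. g e1 = e1}"
  proof (rule card_orbit[OF _ _ comp inverse _ trans])
    show "g e1 \<in> {x. white x \<and> x \<noteq> 0}" if "g \<in> ?H {}" for g
    proof -
      have "g \<in> G" using that by simp
      then have "g e1 \<noteq> 0"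
        using G_bij G_zero e_nonzero(1) by (metis bij_is_inj injD)
      then show ?thesis
        using white_invariant[OF \<open>g \<in> G\<close>] white_e1 by blast
    qed
  qed (use reach_e1 in auto)
  have 2: "card (?H {e1}) = card {y. white y \<and> y \<notin> radical e1} * card {g \<in> ?H {e1}. g e2 = e2}"
  proof (rule card_orbit[OF _ _ comp inverse _ trans])
    show "g e2 \<in> {y. white y \<and> y \<notin> radical e1}" if "g \<in> ?H {e1}" for g
    proof -
      have g: "g \<in> G" "g e1 = e1" using that by simp_all
      have "e2 \<notin> radical e1"
        using radical_axis(1)[of 1] by (simp add: e_defs)
      then show ?thesis
        using white_invariant[OF g(1)] white_e radical_invariant[OF g(1), of e2 e1] g(2) by simp
    qed
  qed (use reach_e2 in auto)
  have 3: "card (?H {e1, e2}) = card {z. white z \<and> D e1 e2 z = 1} * card {g \<in> ?H {e1, e2}. g e3 = e3}"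
  proof (rule card_orbit[OF _ _ comp inverse _ trans])
    show "g e3 \<in> {z. white z \<and> D e1 e2 z = 1}" if "g \<in> ?H {e1, e2}" for g
    proof -
      have g: "g \<in> G" "g e1 = e1" "g e2 = e2" using that by simp_all
      have "D e1 e2 e3 = 1"
        unfolding e3_def by (simp add: D_e)
      then show ?thesis
        using white_invariant[OF g(1)] white_e D_invariant[OF g(1), of e1 e2 e3] g(2,3) by simp
    qed
    show "reach {e1, e2} z e3" if "z \<in> {z. white z \<and> D e1 e2 z = 1}" for z
      using that reach_e3 by (cases z) (auto simp: D_e)
  qed auto
  have "{g \<in> ?H {}. g e1 = e1} = ?H {e1}" "{g \<in> ?H {e1}. g e2 = e2} = ?H {e1, e2}" "?H {} = G"
    "{g \<in> ?H {e1, e2}. g e3 = e3} = {g \<in> G. g e1 = e1 \<and> g e2 = e2 \<and> g e3 = e3}"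
    by auto
  then show ?thesis
    using 1 2 3 by (simp only: card_stabiliser card_white_third)
qed

theorem order_SE6:
  "int (order SE6) = int q ^ 36 * (int q ^ 12 - 1) * (int q ^ 9 - 1) * (int q ^ 8 - 1)
     * (int q ^ 6 - 1) * (int q ^ 5 - 1) * (int q ^ 2 - 1)"
proof -
  let ?q = "int q"
  have "{x. white x \<and> x \<noteq> 0} = {x. white x} - {0}"
    by auto
  moreover have "white 0"
    by (simp add: zero_prod_def white_def N_zero mult_simps cnj_simps)
  ultimately have "card {x. white x} = card {x. white x \<and> x \<noteq> 0} + 1"
    using card_Suc_Diff1[of "{x. white x}" 0] by simp
  then have 1: "int (card {x. white x \<and> x \<noteq> 0}) = (?q ^ 8 + ?q ^ 4 + 1) * (?q ^ 9 - 1)"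
    using card_white by (simp add: algebra_simps eval_nat_numeral)
  have "{x. white x} = {y. white y \<and> y \<notin> radical e1} \<union> {y. white y \<and> y \<in> radical e1}"
    by auto
  then have "card {x. white x} = card {y. white y \<and> y \<notin> radical e1} + card {y. white y \<and> y \<in> radical e1}"
    by (metis (no_types, lifting) card_Un_disjoint finite_albert disjoint_iff mem_Collect_eq)
  then have 2: "int (card {y. white y \<and> y \<notin> radical e1}) = ?q ^ 8 * (?q ^ 5 - 1) * (?q ^ 4 + 1)"
    using card_white card_annihilating by (simp add: card_white_radical algebra_simps eval_nat_numeral)
  have "q ^ 3 \<ge> q ^ 1" "q ^ 3 \<ge> 1"
    using q_gt_1 power_increasing[of 1 3 q] by auto
  then have 3: "int frame_count = (?q ^ 6 + ?q ^ 3) * ((?q ^ 3 - 1) * ((?q ^ 3 - ?q) * ?q ^ 2))"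
    by (simp add: frame_count_def of_nat_diff)
  have "int (order SE6) = ((?q ^ 8 + ?q ^ 4 + 1) * (?q ^ 9 - 1)) * ((?q ^ 8 * (?q ^ 5 - 1) * (?q ^ 4 + 1))
    * (?q ^ 16 * ((?q ^ 7 - ?q ^ 3) ^ 2 * ((?q ^ 6 + ?q ^ 3) * ((?q ^ 3 - 1) * ((?q ^ 3 - ?q) * ?q ^ 2))))))"
    unfolding order_def card_G of_nat_mult 1 2 3 card_isotopies by simp
  also have "\<dots> = ?q ^ 36 * ((?q ^ 8 + ?q ^ 4 + 1) * (?q ^ 4 - 1)) * (?q ^ 9 - 1) * ((?q ^ 4 + 1) * (?q ^ 4 - 1))
     * ((?q ^ 3 + 1) * (?q ^ 3 - 1)) * (?q ^ 5 - 1) * (?q ^ 2 - 1)"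
  proof -
    have "?q ^ 7 - ?q ^ 3 = ?q ^ 3 * (?q ^ 4 - 1)" "?q ^ 6 + ?q ^ 3 = ?q ^ 3 * (?q ^ 3 + 1)" "?q ^ 3 - ?q = ?q * (?q ^ 2 - 1)"
      by (simp_all add: algebra_simps eval_nat_numeral)
    moreover have "?q ^ 36 = ?q ^ 8 * (?q ^ 16 * ((?q ^ 3) ^ 2 * (?q ^ 3 * (?q * ?q ^ 2))))"
      by (simp add: eval_nat_numeral)
    ultimately show ?thesis
      by (simp only: power_mult_distrib) (simp only: power2_eq_square mult_ac)
  qed
  also have "(?q ^ 8 + ?q ^ 4 + 1) * (?q ^ 4 - 1) = ?q ^ 12 - 1"
    by (simp add: algebra_simps eval_nat_numeral)
  also have "(?q ^ 4 + 1) * (?q ^ 4 - 1) = ?q ^ 8 - 1"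
    by (simp add: algebra_simps eval_nat_numeral)
  also have "(?q ^ 3 + 1) * (?q ^ 3 - 1) = ?q ^ 6 - 1"
    by (simp add: algebra_simps eval_nat_numeral)
  finally show ?thesis .
qed

lemma \<Delta>_scale: "\<Delta> (albert_scale r x) = r ^ 3 * \<Delta> x"
  by (cases x) (simp add: \<Delta>_def albert_scale_def norm_scale mult_simps T_simps algebra_simps power2_eq_square power3_eq_cube)

text \<open>A central element maps \<open>e2\<close> to a vector fixed by all transvections that fix \<open>e2\<close>, i.e. to a multiple
  of \<open>e2\<close>. The images of \<open>e2\<close> under the group span the Albert space.\<close>

lemma central_is_scalar:
  assumes z: "z \<in> centre SE6"
  shows "\<exists>r. r ^ 3 = 1 \<and> z = albert_scale r"
proof -
  have comm: "z (g x) = g (z x)" if "g \<in> G" for g x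
    using z that unfolding centre_def by (auto simp: SE6_def fun_eq_iff simp del: split_paired_All)
  have zG: "z \<in> G"
    using z by (simp add: centre_def)
  have add: "z (x + y) = z x + z y" and scale: "z (albert_scale r x) = albert_scale r (z x)"
    and det: "\<Delta> (z x) = \<Delta> x" for x y r
    using zG unfolding G_iff by blast+
  note rot = comm[OF G0_G[OF rotation_G0]]
  note tr = comm[OF G0_G[OF transvection_G0]]
  note tr' = comm[OF G0_G[OF G0_comp[OF G0_comp[OF rotation_G0 rotation_G0] G0_comp[OF lower_transvection_G0 rotation_G0]]]]
  obtain a b c A B C where e2: "z e2 = (a, b, c, A, B, C)"
    by (cases "z e2") auto
  have 1: "transvection X (a, b, c, A, B, C) = (a, b, c, A, B, C)" for X
  proof -
    have "transvection X e2 = e2"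
      by (simp add: transvection_def e2_def inn_simps mult_simps cnj_simps)
    then show ?thesis
      using tr[of X e2] e2 by simp
  qed
  have 2: "(a, b + \<langle>A, X\<rangle> + c * N X, c, A + c *s X, B, C + cnj (X \<odot> B)) = (a, b, c, A, B, C)" for X
    using tr'[of X e2] e2 by (simp add: e2_def lower_transvection_def rotation_def inn_simps mult_simps cnj_simps)
  \<comment> \<open>Compare the coordinates in which the two families of transvections that fix \<open>e2\<close> add a multiple of \<open>X\<close>, at \<open>X = \<e>\<close>.\<close>
  have "a = 0" "c = 0" "cnj B = 0"
    using 1[of \<e>] 2[of \<e>] unit_nonzero by (auto simp: transvection_def unit_right)
  moreover have "A = 0" "C = 0"
    using 1 2 calculation by (auto simp: transvection_def intro!: polar_nondegenerate)
  moreover have "B = 0"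
    using \<open>cnj B = 0\<close> by (metis cnj_cnj cnj_simps(5))
  ultimately have E2: "z e2 = albert_scale b e2"
    by (simp add: e2) (simp add: e2_def albert_scale_def)
  have E1: "z e1 = albert_scale b e1" and E3: "z e3 = albert_scale b e3"
    using rot[of e2] rot[of e1] E2 by (simp_all add: rotation_e) (simp_all add: rotation_def e_defs albert_scale_def)
  have C: "z (0, 0, 0, 0, 0, X) = albert_scale b (0, 0, 0, 0, 0, X)" for X
  proof -
    have "transvection X e1 = e1 + albert_scale (N X) e2 + (0, 0, 0, 0, 0, X)"
      by (simp add: transvection_def e_defs albert_scale_def inn_simps mult_simps cnj_simps)
    then have "z e1 + albert_scale (N X) (z e2) + z (0, 0, 0, 0, 0, X) = transvection X (z e1)"
      using tr[of X e1] by (simp add: add scale)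
    then show ?thesis
      unfolding E1 E2
      by (cases "z (0, 0, 0, 0, 0, X)")
        (simp add: transvection_def e_defs albert_scale_def inn_simps mult_simps cnj_simps ac_simps)
  qed
  have B: "z (0, 0, 0, 0, X, 0) = albert_scale b (0, 0, 0, 0, X, 0)" for X
    using rot[of "(0, 0, 0, 0, 0, X)"] by (simp add: C) (simp add: rotation_def albert_scale_def)
  have A: "z (0, 0, 0, X, 0, 0) = albert_scale b (0, 0, 0, X, 0, 0)" for X
    using rot[of "(0, 0, 0, 0, X, 0)"] by (simp add: B) (simp add: rotation_def albert_scale_def)
  have val: "z (x1, x2, x3, X, Y, Z) = albert_scale b (x1, x2, x3, X, Y, Z)" for x1 x2 x3 X Y Z
    by (subst diagonal_decomposition, simp only: add scale E1 E2 E3 A B C)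
      (simp add: e_defs albert_scale_def mult.commute)
  then have "z = albert_scale b"
    by (auto simp: fun_eq_iff)
  moreover have "b ^ 3 = 1"
    using det[of "(1, 1, 1, 0, 0, 0)"] by (simp add: calculation \<Delta>_scale) (simp add: \<Delta>_def N_zero mult_simps T_simps)
  ultimately show ?thesis
    by blast
qed

lemma card_centre: "card (centre SE6) = gcd 3 (q - 1)"
proof -
  have "albert_scale r \<in> centre SE6" if r: "r ^ 3 = 1" for r
  proof -
    have add: "albert_scale r (x + y) = albert_scale r x + albert_scale r y" for x y
      by (cases x; cases y) (simp add: albert_scale_def scale_right_distrib distrib_left)
    have comm: "albert_scale r (albert_scale s x) = albert_scale s (albert_scale r x)" for s x
      by (cases x) (simp add: albert_scale_def mult.left_commute mult.commute)
    have "albert_scale r \<in> G"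
      unfolding G_iff using add comm \<Delta>_scale[of r] r by simp
    moreover have "albert_scale r \<circ> g = g \<circ> albert_scale r" if "g \<in> G" for g
      using that unfolding G_iff by (simp add: fun_eq_iff del: split_paired_All)
    ultimately show ?thesis
      by (simp add: centre_def) (simp add: SE6_def)
  qed
  then have "centre SE6 = albert_scale ` {r. r ^ 3 = 1}"
    using central_is_scalar by blast
  moreover have "inj_on albert_scale {r. r ^ 3 = 1}"
  proof (rule inj_onI)
    fix r s assume "albert_scale r = albert_scale s"
    then have "albert_scale r e1 = albert_scale s e1" by simp
    then show "r = s" by (simp add: e1_def albert_scale_def)
  qed
  ultimately show ?thesis
    using card_cube_roots_of_unity[where 'f = 'f] by (simp add: card_image)
qed

theorem order_E6: "order E6 * gcd 3 (q - 1) = order SE6"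
proof -
  interpret S: group SE6 by (rule group_SE6)
  have "order E6 = card (rcosets\<^bsub>SE6\<^esub> centre SE6)"
    by (simp add: order_def E6_def FactGroup_def)
  then show ?thesis
    using S.lagrange[OF normal_imp_subgroup[OF S.centre_normal]] by (simp add: card_centre)
qed

end

theorem mainTheorem3:
  fixes q :: nat
    and scale :: "'f::{field, finite} \<Rightarrow> 'o::ab_group_add \<Rightarrow> 'o"
    and mult :: "'o \<Rightarrow> 'o \<Rightarrow> 'o"
    and unit :: 'o
    and N :: "'o \<Rightarrow> 'f"
  assumes "primepow q"
    and "card (UNIV :: 'f set) = q"
    and "octonion_algebra scale mult unit N"
  shows "real (order (octonion_algebra.SE6 scale mult unit N)) =
           real q ^ 36 * (real q ^ 12 - 1) * (real q ^ 9 - 1) * (real q ^ 8 - 1)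
             * (real q ^ 6 - 1) * (real q ^ 5 - 1) * (real q ^ 2 - 1) \<and>
         real (order (octonion_algebra.E6 scale mult unit N)) =
           1 / real (gcd 3 (q - 1)) *
           (real q ^ 36 * (real q ^ 12 - 1) * (real q ^ 9 - 1) * (real q ^ 8 - 1)
             * (real q ^ 6 - 1) * (real q ^ 5 - 1) * (real q ^ 2 - 1))"
proof -
  interpret finite_octonion_algebra scale mult unit N q
    using assms(2,3) by (simp add: finite_octonion_algebra_def finite_octonion_algebra_axioms_def)
  have "real (order SE6) = of_int (int (order SE6))"
    by simp
  also have "\<dots> = real q ^ 36 * (real q ^ 12 - 1) * (real q ^ 9 - 1) * (real q ^ 8 - 1)
             * (real q ^ 6 - 1) * (real q ^ 5 - 1) * (real q ^ 2 - 1)"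
    unfolding order_SE6 by simp
  finally have 1: "real (order SE6) = real q ^ 36 * (real q ^ 12 - 1) * (real q ^ 9 - 1) * (real q ^ 8 - 1)
             * (real q ^ 6 - 1) * (real q ^ 5 - 1) * (real q ^ 2 - 1)" .
  have "real (order E6) * real (gcd 3 (q - 1)) = real (order SE6)"
    by (simp only: flip: of_nat_mult order_E6)
  then have "real (order E6) = 1 / real (gcd 3 (q - 1)) * real (order SE6)"
    by (simp add: field_simps)
  then show ?thesis
    unfolding 1 using 1 by blast
qed

end
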